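(* Assume the heat-kernel domination: there are $s_0>0$ and $a_{hk}\ge1$ such that the transition density of reflected Brownian motion in $M$ with respect to $\mu$ satisfies $p_t(x,y)\le a_{hk}$ for all $t\ge s_0$ and $x,y\in M$. Let $\mathcal A=\{A_1,\ldots,A_m\}$ be a finite family of measurable subsets of $M$, each of positive capacity. Then, for every $x\in M$ and every $T\ge s_0$, $$\mathbb P_x\big(H_T(\mathcal A)^c\big)\le a_{hk}\,\Phi_{\mathcal A}(T-s_0).$$
   Context: Setting. $d\ge2$; $M\subset\mathbb R^d$ is the closure of a bounded connected open set and $\mu(A)=|A|/|M|$ is normalized Lebesgue measure on $M$. The boundary of $M$ is regular enough that reflected Brownian motion in $M$ exists and is unique in law, has a symmetric Neumann heat kernel, the Neumann semigroup on $L^2(M,\mu)$ is compact, and the Neumann spectrum is discrete with positive spectral gap (a compact connected Lipschitz domain with uniform chart constants suffices). Process. $X=(X_t)_{t\ge0}$ is reflected Brownian motion in $M$: the conservative $\mu$-symmetric Hunt process with continuous paths associated with the Dirichlet form $\mathcal E(f,g)=\frac12\int_M\nabla f\cdot\nabla g\,d\mu$, $f,g\in H^1(M)$. $\mathbb P_x$ is its law started at $x$. Notation. $\tau_A=\inf\{t\ge0:X_t\in A\}$; $H_T(\mathcal A)=\bigcap_{i=1}^m\{\tau_{A_i}\le T\}$ is the event that all targets are hit by time $T$. Capacity and "quasi-everywhere" refer to $\mathcal E$. The principal killed eigenvalue of $A$ is $\lambda_A=\inf\{\mathcal E(f,f)/\|f\|_{L^2(\mu)}^2: f\in H^1(M),\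 f=0\text{ quasi-everywhere on }A,\ f\ne0\}$, and the spectral profile is $\Phi_{\mathcal A}(u)=\sum_{A\in\mathcal A}e^{-\lambda_Au}$, $u\ge0$. *)

theory Defs
  imports "HOL-Probability.Probability"
begin

section \<open>The state space and the Dirichlet form\<close>

text \<open>Normalized Lebesgue measure, as a measure whose space is \<open>M\<close> itself. For Borel \<open>M\<close>,
  \<open>sets (mu M)\<close> consists of the Borel subsets of \<open>M\<close>.\<close>

definition mu :: "'a::euclidean_space set \<Rightarrow> 'a measure" where
  "mu M = uniform_measure (restrict_space lborel M) M"

text \<open>Elements of \<open>L\<^sup>2(M, \<mu>)\<close> and of \<open>H\<^sup>1(M)\<close> are represented by functions; two functions
  represent the same element iff they agree \<open>\<mu>\<close>-almost everywhere on \<open>M\<close>.\<close>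

definition L2 :: "'a::euclidean_space set \<Rightarrow> ('a \<Rightarrow> real) set" where
  "L2 M = {f \<in> borel_measurable (mu M). integrable (mu M) (\<lambda>x. (f x)\<^sup>2)}"

definition inner_L2 :: "'a::euclidean_space set \<Rightarrow> ('a \<Rightarrow> real) \<Rightarrow> ('a \<Rightarrow> real) \<Rightarrow> real" where
  "inner_L2 M f g = (LINT x|mu M. f x * g x)"

primrec Ck :: "nat \<Rightarrow> ('a::euclidean_space \<Rightarrow> real) \<Rightarrow> bool" where
  "Ck 0 \<phi> \<longleftrightarrow> continuous_on UNIV \<phi>"
| "Ck (Suc k) \<phi> \<longleftrightarrow>
     (\<forall>x. \<phi> differentiable (at x)) \<and> (\<forall>b\<in>Basis. Ck k (\<lambda>x. frechet_derivative \<phi> (at x) b))"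

definition test_functions :: "'a::euclidean_space set \<Rightarrow> ('a \<Rightarrow> real) set" where
  "test_functions U = {\<phi>. (\<forall>k. Ck k \<phi>) \<and> (\<exists>K. compact K \<and> K \<subseteq> U \<and> (\<forall>x. x \<notin> K \<longrightarrow> \<phi> x = 0))}"

text \<open>\<open>h\<close> is a square-integrable distributional gradient of \<open>f\<close> on the interior of \<open>M\<close>.\<close>

definition is_weak_gradient ::
  "'a::euclidean_space set \<Rightarrow> ('a \<Rightarrow> real) \<Rightarrow> ('a \<Rightarrow> 'a) \<Rightarrow> bool" where
  "is_weak_gradient M f h \<longleftrightarrow>
     h \<in> borel_measurable borel \<and>
     set_integrable lborel (interior M) (\<lambda>x. (norm (h x))\<^sup>2) \<and>
     (\<forall>\<phi>\<in>test_functions (interior M). \<forall>b\<in>Basis.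
        (LINT x:interior M|lborel. f x * frechet_derivative \<phi> (at x) b) =
        - (LINT x:interior M|lborel. (h x \<bullet> b) * \<phi> x))"

definition H1 :: "'a::euclidean_space set \<Rightarrow> ('a \<Rightarrow> real) set" where
  "H1 M = {f \<in> L2 M. \<exists>h. is_weak_gradient M f h}"

text \<open>Weak gradients are unique up to null sets, so the choice is immaterial under the integral.\<close>

definition weak_gradient :: "'a::euclidean_space set \<Rightarrow> ('a \<Rightarrow> real) \<Rightarrow> 'a \<Rightarrow> 'a" where
  "weak_gradient M f = (SOME h. is_weak_gradient M f h)"

definition energy ::
  "'a::euclidean_space set \<Rightarrow> ('a \<Rightarrow> real) \<Rightarrow> ('a \<Rightarrow> real) \<Rightarrow> real" where
  "energy M f g = 1/2 * (LINT x:interior M|mu M. weak_gradient M f x \<bullet> weak_gradient M g x)"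

definition energy1 :: "'a::euclidean_space set \<Rightarrow> ('a \<Rightarrow> real) \<Rightarrow> real" where
  "energy1 M f = energy M f f + inner_L2 M f f"


section \<open>Capacity, quasi-everywhere, killed eigenvalues\<close>

text \<open>The 1-capacity of the form. Open sets are relatively open in \<open>M\<close>, which includes its
  boundary points. An infimum over an empty class is \<open>\<infinity>\<close>.\<close>

definition open_capacity :: "'a::euclidean_space set \<Rightarrow> 'a set \<Rightarrow> ereal" where
  "open_capacity M G =
     (INF f \<in> {f \<in> H1 M. AE x in mu M. x \<in> G \<longrightarrow> 1 \<le> f x}. ereal (energy1 M f))"

definition capacity :: "'a::euclidean_space set \<Rightarrow> 'a set \<Rightarrow> ereal" where
  "capacity M A =
     (INF G \<in> {G. openin (top_of_set M) G \<and> A \<subseteq> G}. open_capacity M G)"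

definition quasi_everywhere_on ::
  "'a::euclidean_space set \<Rightarrow> 'a set \<Rightarrow> ('a \<Rightarrow> bool) \<Rightarrow> bool" where
  "quasi_everywhere_on M A Q \<longleftrightarrow> capacity M {x \<in> A. \<not> Q x} = 0"

definition quasi_continuous :: "'a::euclidean_space set \<Rightarrow> ('a \<Rightarrow> real) \<Rightarrow> bool" where
  "quasi_continuous M f \<longleftrightarrow>
     (\<forall>\<epsilon>>0. \<exists>G. openin (top_of_set M) G \<and> capacity M G < ereal \<epsilon> \<and> continuous_on (M - G) f)"

text \<open>As usual, a quasi-everywhere condition on \<open>f \<in> H\<^sup>1(M)\<close> (an almost-everywhere class) refers
  to a quasi-continuous version of \<open>f\<close>.\<close>

definition vanishes_qe_on :: "'a::euclidean_space set \<Rightarrow> 'a set \<Rightarrow> ('a \<Rightarrow> real) \<Rightarrow> bool" where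
  "vanishes_qe_on M A f \<longleftrightarrow>
     (\<exists>g. quasi_continuous M g \<and> (AE x in mu M. g x = f x) \<and>
          quasi_everywhere_on M A (\<lambda>x. g x = 0))"

text \<open>Extended real valued: the infimum is \<open>\<infinity>\<close> if no nonzero \<open>f\<close> is admissible, for instance
  for \<open>A = M\<close>.\<close>

definition killed_eigenvalue :: "'a::euclidean_space set \<Rightarrow> 'a set \<Rightarrow> ereal" where
  "killed_eigenvalue M A =
     (INF f \<in> {f \<in> H1 M. vanishes_qe_on M A f \<and> \<not> (AE x in mu M. f x = 0)}.
        ereal (energy M f f / inner_L2 M f f))"

definition exp_neg :: "ereal \<Rightarrow> real" where
  "exp_neg z = (if z = \<infinity> then 0 else exp (- real_of_ereal z))"

text \<open>With the convention \<open>\<infinity> * 0 = 0\<close> of \<^typ>\<open>ereal\<close>, every set contributes \<open>1\<close> at \<open>u = 0\<close>.\<close>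

definition spectral_profile :: "'a::euclidean_space set \<Rightarrow> 'a set set \<Rightarrow> real \<Rightarrow> real" where
  "spectral_profile M \<A> u = (\<Sum>A\<in>\<A>. exp_neg (killed_eigenvalue M A * ereal u))"


section \<open>Hunt processes with continuous paths\<close>

text \<open>A process is given by a sample space \<open>\<Omega>\<close>, laws \<open>P x\<close> on it for \<open>x \<in> M\<close>, and
  coordinates \<open>X t\<close>; only the times \<open>t \<ge> 0\<close> matter.\<close>

definition natural_sets :: "'w measure \<Rightarrow> (real \<Rightarrow> 'w \<Rightarrow> 'a::euclidean_space) \<Rightarrow> real \<Rightarrow> 'w set set" where
  "natural_sets \<Omega> X t = sigma_sets (space \<Omega>)
     {X s -` B \<inter> space \<Omega> | s B. 0 \<le> s \<and> s \<le> t \<and> B \<in> sets borel}"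

definition rc_natural_sets :: "'w measure \<Rightarrow> (real \<Rightarrow> 'w \<Rightarrow> 'a::euclidean_space) \<Rightarrow> real \<Rightarrow> 'w set set" where
  "rc_natural_sets \<Omega> X t = (\<Inter>u\<in>{t<..}. natural_sets \<Omega> X u)"

definition rc_stopping_time ::
  "'w measure \<Rightarrow> (real \<Rightarrow> 'w \<Rightarrow> 'a::euclidean_space) \<Rightarrow> ('w \<Rightarrow> ereal) \<Rightarrow> bool" where
  "rc_stopping_time \<Omega> X \<sigma> \<longleftrightarrow>
     (\<forall>\<omega>\<in>space \<Omega>. 0 \<le> \<sigma> \<omega>) \<and>
     (\<forall>t\<ge>0. {\<omega>\<in>space \<Omega>. \<sigma> \<omega> \<le> ereal t} \<in> rc_natural_sets \<Omega> X t)"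

definition stopped_sets ::
  "'w measure \<Rightarrow> (real \<Rightarrow> 'w \<Rightarrow> 'a::euclidean_space) \<Rightarrow> ('w \<Rightarrow> ereal) \<Rightarrow> 'w set set" where
  "stopped_sets \<Omega> X \<sigma> =
     {S \<in> sets \<Omega>. \<forall>t\<ge>0. {\<omega>\<in>S. \<sigma> \<omega> \<le> ereal t} \<in> rc_natural_sets \<Omega> X t}"

definition trans_op ::
  "('a::euclidean_space \<Rightarrow> 'w measure) \<Rightarrow> (real \<Rightarrow> 'w \<Rightarrow> 'a) \<Rightarrow> real \<Rightarrow> ('a \<Rightarrow> real) \<Rightarrow> 'a \<Rightarrow> real" where
  "trans_op P X t f x = (LINT \<omega>|P x. f (X t \<omega>))"

text \<open>Quasi-left-continuity, the remaining axiom of a Hunt process, is automatic here: the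
  process is conservative and its paths are continuous on \<open>[0, \<infinity>)\<close>.\<close>

locale continuous_Hunt_process =
  fixes M :: "'a::euclidean_space set"
    and \<Omega> :: "'w measure" and P :: "'a \<Rightarrow> 'w measure" and X :: "real \<Rightarrow> 'w \<Rightarrow> 'a"
  assumes kernel: "P \<in> restrict_space borel M \<rightarrow>\<^sub>M prob_algebra \<Omega>"
    and coordinate: "\<And>t. 0 \<le> t \<Longrightarrow> X t \<in> \<Omega> \<rightarrow>\<^sub>M restrict_space borel M"
    and paths: "\<And>\<omega>. \<omega> \<in> space \<Omega> \<Longrightarrow> continuous_on {0..} (\<lambda>t. X t \<omega>)"
    and start: "\<And>x. x \<in> M \<Longrightarrow> AE \<omega> in P x. X 0 \<omega> = x"
    and strong_Markov: "\<And>x \<sigma> S t B.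
      x \<in> M \<Longrightarrow> rc_stopping_time \<Omega> X \<sigma> \<Longrightarrow> S \<in> stopped_sets \<Omega> X \<sigma> \<Longrightarrow> 0 \<le> t \<Longrightarrow> B \<in> sets borel \<Longrightarrow>
      emeasure (P x) {\<omega>\<in>space \<Omega>. \<omega> \<in> S \<and> \<sigma> \<omega> < \<infinity> \<and> X (real_of_ereal (\<sigma> \<omega>) + t) \<omega> \<in> B} =
      (\<integral>\<^sup>+\<omega>\<in>{\<omega>\<in>S. \<sigma> \<omega> < \<infinity>}.
         emeasure (P (X (real_of_ereal (\<sigma> \<omega>)) \<omega>)) {\<omega>'\<in>space \<Omega>. X t \<omega>' \<in> B} \<partial>P x)"


section \<open>Reflected Brownian motion\<close>

text \<open>The analytic regularity of the domain: the form is regular, and the spectrum is discrete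
  with a positive gap, i.e. there is an orthonormal basis \<open>e\<close> of eigenfunctions of the Neumann
  operator (in weak form), with eigenvalues \<open>0 = \<nu> 0 < \<nu> 1 \<le> \<nu> 2 \<le> \<dots>\<close> tending to \<open>\<infinity>\<close>.\<close>

definition regular_form :: "'a::euclidean_space set \<Rightarrow> bool" where
  "regular_form M \<longleftrightarrow>
     (\<forall>f\<in>H1 M. \<forall>\<epsilon>>0. \<exists>g\<in>H1 M. continuous_on M g \<and> energy1 M (\<lambda>x. f x - g x) < \<epsilon>) \<and>
     (\<forall>f. continuous_on M f \<longrightarrow>
        (\<forall>\<epsilon>>0. \<exists>g\<in>H1 M. continuous_on M g \<and> (\<forall>x\<in>M. \<bar>f x - g x\<bar> < \<epsilon>)))"

definition discrete_spectrum_with_gap :: "'a::euclidean_space set \<Rightarrow> bool" where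
  "discrete_spectrum_with_gap M \<longleftrightarrow>
     (\<exists>(e :: nat \<Rightarrow> 'a \<Rightarrow> real) (\<nu> :: nat \<Rightarrow> real).
        (\<forall>n. e n \<in> H1 M) \<and>
        (\<forall>i j. inner_L2 M (e i) (e j) = (if i = j then 1 else 0)) \<and>
        (\<forall>f\<in>L2 M. (\<forall>n. inner_L2 M f (e n) = 0) \<longrightarrow> (AE x in mu M. f x = 0)) \<and>
        (\<forall>n. \<forall>g\<in>H1 M. energy M (e n) g = \<nu> n * inner_L2 M (e n) g) \<and>
        mono \<nu> \<and> \<nu> 0 = 0 \<and> 0 < \<nu> 1 \<and> filterlim \<nu> at_top sequentially)"

locale neumann_domain =
  fixes M :: "'a::euclidean_space set"
  assumes dim: "2 \<le> DIM('a)"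
    and domain: "\<exists>U. open U \<and> connected U \<and> bounded U \<and> U \<noteq> {} \<and> M = closure U"
    and regular: "regular_form M"
    and spectrum: "discrete_spectrum_with_gap M"

text \<open>The association of the process with the form is the usual one,
  \<open>\<E>(f,f) = lim\<^sub>t\<^sub>\<down>\<^sub>0 t\<^sup>-\<^sup>1 \<langle>f, f - P\<^sub>t f\<rangle>\<close>, the domain of \<open>\<E>\<close> being the set of \<open>f \<in> L\<^sup>2\<close> for
  which this limit, which always exists in \<open>[0, \<infinity>]\<close>, is finite.
  For \<open>f \<in> L\<^sup>2\<close> the expectation \<open>P\<^sub>t f x\<close> may fail to exist on a \<open>\<mu>\<close>-null set of \<open>x\<close>.\<close>

locale reflected_brownian_motion = neumann_domain M + continuous_Hunt_process M \<Omega> P X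
  for M :: "'a::euclidean_space set"
    and \<Omega> :: "'w measure" and P :: "'a \<Rightarrow> 'w measure" and X :: "real \<Rightarrow> 'w \<Rightarrow> 'a" +
  assumes symmetric: "\<And>t B C. 0 \<le> t \<Longrightarrow> B \<in> sets (mu M) \<Longrightarrow> C \<in> sets (mu M) \<Longrightarrow>
      (\<integral>\<^sup>+x\<in>B. emeasure (P x) {\<omega>\<in>space \<Omega>. X t \<omega> \<in> C} \<partial>mu M) =
      (\<integral>\<^sup>+x\<in>C. emeasure (P x) {\<omega>\<in>space \<Omega>. X t \<omega> \<in> B} \<partial>mu M)"
    and associated: "\<And>f. f \<in> L2 M \<Longrightarrow>
      ((\<lambda>t. ereal (inner_L2 M f (\<lambda>x. f x - trans_op P X t f x) / t))
         \<longlongrightarrow> (if f \<in> H1 M then ereal (energy M f f) else \<infinity>)) (at_right 0)"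
    and compact_semigroup: "\<And>t (f :: nat \<Rightarrow> 'a \<Rightarrow> real) C. 0 < t \<Longrightarrow>
      (\<And>n. f n \<in> L2 M) \<Longrightarrow> (\<And>n. inner_L2 M (f n) (f n) \<le> C) \<Longrightarrow>
      \<exists>r g. strict_mono r \<and> g \<in> L2 M \<and>
        (\<lambda>n. LINT x|mu M. (trans_op P X t (f (r n)) x - g x)\<^sup>2) \<longlonglongrightarrow> 0"

definition neumann_heat_kernel ::
  "'a::euclidean_space set \<Rightarrow> 'w measure \<Rightarrow> ('a \<Rightarrow> 'w measure) \<Rightarrow> (real \<Rightarrow> 'w \<Rightarrow> 'a)
     \<Rightarrow> (real \<Rightarrow> 'a \<Rightarrow> 'a \<Rightarrow> real) \<Rightarrow> bool" where
  "neumann_heat_kernel M \<Omega> P X p \<longleftrightarrow>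
     (\<forall>t>0. (\<lambda>(x, y). p t x y) \<in> borel_measurable (mu M \<Otimes>\<^sub>M mu M)) \<and>
     (\<forall>t>0. \<forall>x\<in>M. \<forall>y\<in>M. 0 \<le> p t x y \<and> p t x y = p t y x) \<and>
     (\<forall>t>0. \<forall>x\<in>M. \<forall>B\<in>sets (mu M).
        emeasure (P x) {\<omega>\<in>space \<Omega>. X t \<omega> \<in> B} = (\<integral>\<^sup>+y\<in>B. ennreal (p t x y) \<partial>mu M))"


section \<open>Hitting times\<close>

definition hitting_time :: "(real \<Rightarrow> 'w \<Rightarrow> 'a) \<Rightarrow> 'a set \<Rightarrow> 'w \<Rightarrow> ereal" where
  "hitting_time X A \<omega> = (INF t \<in> {t. 0 \<le> t \<and> X t \<omega> \<in> A}. ereal t)"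

definition all_hit :: "'w measure \<Rightarrow> (real \<Rightarrow> 'w \<Rightarrow> 'a) \<Rightarrow> 'a set set \<Rightarrow> real \<Rightarrow> 'w set" where
  "all_hit \<Omega> X \<A> T = {\<omega>\<in>space \<Omega>. \<forall>A\<in>\<A>. hitting_time X A \<omega> \<le> ereal T}"

text \<open>For Borel \<open>A\<close> the event \<open>{\<tau>\<^sub>A \<le> T}\<close> is in general only analytic, hence measurable for the
  \<open>P x\<close>-completion and not for \<open>\<Omega>\<close>. Its probability is therefore taken with respect to the outer
  measure \<^const>\<open>outer_measure_of\<close>, which extends the completion of \<open>P x\<close>.\<close>

end

theory Submission
  imports Defs "HOL-Library.Diagonal_Subsequence"
begin

text \<open>By the union bound it suffices to treat one Borel target \<open>A\<close>. With \<open>u = T - s\<^sub>0\<close>, only hits during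
  \<open>[s\<^sub>0, s\<^sub>0 + u]\<close> are counted; by the Markov property at time \<open>s\<^sub>0\<close> and the bound on the heat kernel, the
  probability of no such hit is at most \<open>a\<close> times the same probability for the process started
  from \<open>\<mu>\<close> and run for time \<open>u\<close>. The latter is at most \<open>e\<^bsup>-\<Lambda>u\<^esup>\<close> for every real \<open>\<Lambda> < \<lambda>\<^sub>A\<close>.

  For a relatively open set \<open>G\<close> this is proved along a time grid (\<open>emeasure_grid_event_le\<close>,
  \<open>avoid_open\<close>). With \<open>F = M - G\<close>, the probability of staying in \<open>F\<close> at all times of a grid of mesh \<open>h\<close>
  is \<open>\<langle>1, (1\<^sub>F P\<^sub>h 1\<^sub>F)\<^sup>n 1\<^sub>F\<rangle>\<close>, and the norm of \<open>1\<^sub>F P\<^sub>h 1\<^sub>F\<close> is at most \<open>1 - h \<Lambda>\<^sub>h\<close>, where \<open>\<Lambda>\<^sub>h\<close> is the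
  bottom of the approximating form \<open>\<E>\<^sub>h(f) = \<langle>f, f - P\<^sub>h f\<rangle> / h\<close> on functions supported in \<open>F\<close>. As \<open>h\<close> is
  halved, \<open>\<E>\<^sub>h\<close> increases to \<open>\<E>\<close>, and compactness of the semigroup shows that \<open>\<Lambda>\<^sub>h\<close> finally exceeds
  every \<open>\<Lambda> < \<lambda>\<^sub>G\<close> (\<open>aform_lower_bound_open\<close>).

  A continuous path that avoids a compact set \<open>C\<close> avoids a neighbourhood \<open>G\<close> of it, and \<open>\<lambda>\<^sub>C \<le> \<lambda>\<^sub>G\<close>; this
  settles compact sets (\<open>avoid_compact\<close>). For a Borel set \<open>A\<close> it remains to find compact subsets whose
  eigenvalues approach \<open>\<lambda>\<^sub>A\<close> (\<open>killed_eigenvalue_compact_approximation\<close>). Choquet's capacitability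
  theorem yields compact sets \<open>C\<^sub>n \<subseteq> A\<close> so large that a quasi-continuous function vanishing
  quasi-everywhere on all of them vanishes quasi-everywhere on \<open>A\<close> (\<open>exists_compact_exhaustion\<close>); it
  applies because the capacity is continuous along increasing sequences of arbitrary sets
  (\<open>capacity_incseq\<close>). The domain of the form killed on \<open>A\<close> is then the intersection of the domains
  killed on the \<open>C\<^sub>n\<close>, and the bottoms of the spectrum converge by compactness.

  What has to be known about the form is read off its approximations. Since
  \<open>\<E>\<^sub>t(f) = (2t)\<^sup>-\<^sup>1 \<integral>\<integral> (f(x) - f(y))\<^sup>2 p\<^sub>t(x, y) \<mu>(dx) \<mu>(dy)\<close> increases when \<open>t\<close> is halved, \<open>f \<in> H\<^sup>1\<close> with
  \<open>\<E>(f) \<le> C\<close> means that \<open>\<E>\<^sub>t(f) \<le> C\<close> for all \<open>t = 2\<^sup>-\<^sup>n\<close>. So the Markov property, lower semicontinuity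
  and completeness of the form follow from pointwise inequalities and the completeness of \<open>L\<^sup>2\<close>,
  and weak gradients are not manipulated.\<close>

section \<open>Square-integrable functions\<close>

definition square_integrable :: "'b measure \<Rightarrow> ('b \<Rightarrow> real) \<Rightarrow> bool" where
  "square_integrable N f \<longleftrightarrow> f \<in> borel_measurable N \<and> integrable N (\<lambda>x. (f x)\<^sup>2)"

lemma square_integrable_integrable_mult:
  assumes "square_integrable N f" "square_integrable N g"
  shows "integrable N (\<lambda>x. f x * g x)"
proof (rule Bochner_Integration.integrable_bound)
  show "integrable N (\<lambda>x. (f x)\<^sup>2 + (g x)\<^sup>2)"
    using assms by (auto simp: square_integrable_def)
  show "(\<lambda>x. f x * g x) \<in> borel_measurable N"
    using assms by (auto simp: square_integrable_def)
  have "\<bar>f x * g x\<bar> \<le> (f x)\<^sup>2 + (g x)\<^sup>2" for x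
  proof -
    have "2 * (\<bar>f x\<bar> * \<bar>g x\<bar>) \<le> (f x)\<^sup>2 + (g x)\<^sup>2"
      using sum_squares_bound[of "\<bar>f x\<bar>" "\<bar>g x\<bar>"] by simp
    moreover have "0 \<le> \<bar>f x\<bar> * \<bar>g x\<bar>" by simp
    ultimately show ?thesis unfolding abs_mult by linarith
  qed
  then show "AE x in N. norm (f x * g x) \<le> norm ((f x)\<^sup>2 + (g x)\<^sup>2)"
    by auto
qed

lemma square_integrable_add:
  assumes "square_integrable N f" "square_integrable N g"
  shows "square_integrable N (\<lambda>x. f x + g x)"
proof -
  have "integrable N (\<lambda>x. (f x)\<^sup>2 + (g x)\<^sup>2 + 2 * (f x * g x))"
    using assms square_integrable_integrable_mult[OF assms]
    by (auto simp: square_integrable_def)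
  then show ?thesis
    using assms by (auto simp: square_integrable_def power2_sum algebra_simps)
qed

lemma square_integrable_cmult:
  "square_integrable N f \<Longrightarrow> square_integrable N (\<lambda>x. c * f x)"
  by (auto simp: square_integrable_def power_mult_distrib)

lemma square_integrable_diff:
  assumes "square_integrable N f" "square_integrable N g"
  shows "square_integrable N (\<lambda>x. f x - g x)"
  using square_integrable_add[OF assms(1) square_integrable_cmult[OF assms(2), of "-1"]] by simp

lemma square_integrable_bound:
  assumes "square_integrable N f" "g \<in> borel_measurable N"
    "AE x in N. \<bar>g x\<bar> \<le> \<bar>f x\<bar>"
  shows "square_integrable N g"
  unfolding square_integrable_def
proof
  show "integrable N (\<lambda>x. (g x)\<^sup>2)"
  proof (rule Bochner_Integration.integrable_bound)
    show "integrable N (\<lambda>x. (f x)\<^sup>2)" using assms by (simp add: square_integrable_def)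
    show "(\<lambda>x. (g x)\<^sup>2) \<in> borel_measurable N" using assms by simp
    show "AE x in N. norm ((g x)\<^sup>2) \<le> norm ((f x)\<^sup>2)"
      using assms(3) by eventually_elim (auto simp: abs_le_square_iff)
  qed
qed fact

lemma (in finite_measure) square_integrable_integrable:
  assumes "square_integrable M f"
  shows "integrable M f"
proof -
  have "square_integrable M (\<lambda>x. 1)" by (simp add: square_integrable_def)
  from square_integrable_integrable_mult[OF assms this] show ?thesis by simp
qed

lemma (in prob_space) square_integral_le:
  assumes "square_integrable M f"
  shows "(LINT x|M. f x)\<^sup>2 \<le> (LINT x|M. (f x)\<^sup>2)"
proof -
  have "0 \<le> variance f" by (rule variance_positive)
  also have "\<dots> = (LINT x|M. (f x)\<^sup>2) - (LINT x|M. f x)\<^sup>2"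
    using assms square_integrable_integrable[OF assms]
    by (intro variance_eq) (auto simp: square_integrable_def)
  finally show ?thesis by simp
qed

text \<open>Monotone convergence. A sequence that converges fast in \<open>L\<^sup>2\<close> therefore converges almost
  everywhere.\<close>

lemma AE_summable_squares:
  assumes "\<And>n. square_integrable N (f n)" "summable (\<lambda>n. LINT x|N. (f n x)\<^sup>2)"
  shows "AE x in N. summable (\<lambda>n. (f n x)\<^sup>2)"
proof -
  have [measurable]: "f n \<in> borel_measurable N" for n
    using assms(1)[of n] by (simp add: square_integrable_def)
  have int: "integrable N (\<lambda>x. (f n x)\<^sup>2)" for n
    using assms(1)[of n] by (simp add: square_integrable_def)
  have "(\<integral>\<^sup>+x. (\<Sum>n. ennreal ((f n x)\<^sup>2)) \<partial>N) = (\<Sum>n. \<integral>\<^sup>+x. ennreal ((f n x)\<^sup>2) \<partial>N)"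
    by (rule nn_integral_suminf) simp
  also have "\<dots> = (\<Sum>n. ennreal (LINT x|N. (f n x)\<^sup>2))"
    by (intro suminf_cong nn_integral_eq_integral int) simp
  also have "\<dots> = ennreal (\<Sum>n. LINT x|N. (f n x)\<^sup>2)"
    by (rule suminf_ennreal2) (auto intro: assms)
  also have "\<dots> < \<infinity>" by simp
  finally have "AE x in N. (\<Sum>n. ennreal ((f n x)\<^sup>2)) \<noteq> \<infinity>"
    by (intro nn_integral_PInf_AE) auto
  then show ?thesis
    by eventually_elim (auto intro: summable_suminf_not_top)
qed

lemma AE_convergent_of_summable_weighted_squares:
  fixes f :: "nat \<Rightarrow> 'b \<Rightarrow> real"
  assumes "\<And>n. square_integrable N (f n)"
    and "summable (\<lambda>n. 4 ^ n * (LINT x|N. (f (Suc n) x - f n x)\<^sup>2))"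
  shows "AE x in N. convergent (\<lambda>n. f n x)"
proof -
  have sq: "square_integrable N (\<lambda>x. 2 ^ n * (f (Suc n) x - f n x))" for n
    by (intro square_integrable_cmult square_integrable_diff assms)
  have p4: "(2 ^ n)\<^sup>2 = (4::real) ^ n" for n
    by (simp add: power2_eq_square flip: power_mult_distrib)
  have "AE x in N. summable (\<lambda>n. (2 ^ n * (f (Suc n) x - f n x))\<^sup>2)"
    by (rule AE_summable_squares[OF sq])
      (use assms(2) in \<open>simp add: power_mult_distrib p4\<close>)
  then show ?thesis
  proof eventually_elim
    case (elim x)
    then have "(\<lambda>n. (2 ^ n * (f (Suc n) x - f n x))\<^sup>2) \<longlonglongrightarrow> 0"
      by (rule summable_LIMSEQ_zero)
    then have "eventually (\<lambda>n. (2 ^ n * (f (Suc n) x - f n x))\<^sup>2 < 1) sequentially"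
      by (rule order_tendstoD) simp
    then have ev: "eventually (\<lambda>n. norm (f (Suc n) x - f n x) \<le> (1/2) ^ n) sequentially"
    proof eventually_elim
      case (elim n)
      then have "\<bar>2 ^ n * (f (Suc n) x - f n x)\<bar> < 1"
        by (simp add: abs_square_less_1)
      then have "2 ^ n * \<bar>f (Suc n) x - f n x\<bar> < 1" by (simp only: abs_mult) simp
      then have "\<bar>f (Suc n) x - f n x\<bar> < 1 / 2 ^ n" by (simp add: field_simps)
      then show ?case by (simp add: power_one_over)
    qed
    have "summable (\<lambda>n. f (Suc n) x - f n x)"
      by (rule summable_comparison_test_ev[OF ev]) (simp add: summable_geometric)
    then have "convergent (\<lambda>n. \<Sum>i<n. f (Suc i) x - f i x)"
      by (simp add: summable_iff_convergent)
    then have "convergent (\<lambda>n. f n x - f 0 x)"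
      by (simp only: sum_lessThan_telescope[of "\<lambda>i. f i x"])
    then have "convergent (\<lambda>n. f n x - f 0 x + f 0 x)"
      by (intro convergent_add convergent_const)
    then show ?case by simp
  qed
qed

text \<open>The rate \<open>8\<^sup>-\<^sup>n\<close> leaves room for the factor \<open>4\<^sup>n\<close> that thresholds \<open>2\<^sup>-\<^sup>n\<close> cost in Chebyshev's
  inequality.\<close>

lemma Cauchy_fast_subseq:
  fixes d :: "nat \<Rightarrow> nat \<Rightarrow> real"
  assumes "\<And>e. 0 < e \<Longrightarrow> \<exists>N. \<forall>m\<ge>N. \<forall>n\<ge>N. d m n < e"
  shows "\<exists>r::nat\<Rightarrow>nat. strict_mono r \<and> (\<forall>n. \<forall>m\<ge>r n. d m (r n) < (1/8) ^ n)"
proof -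
  have "\<exists>N. \<forall>m\<ge>N. \<forall>n\<ge>N. d m n < (1/8) ^ k" for k :: nat
    by (rule assms) simp
  then obtain N where N: "\<And>k m n. N k \<le> m \<Longrightarrow> N k \<le> n \<Longrightarrow> d m n < (1/8) ^ k"
    by metis
  define r where "r n = (\<Sum>i\<le>n. N i) + n" for n
  have "strict_mono r"
    by (rule strict_mono_Suc_iff[THEN iffD2]) (simp add: r_def)
  moreover have "N n \<le> r n" for n
    unfolding r_def by (rule trans_le_add1, rule member_le_sum) auto
  ultimately show ?thesis
    using N by (meson order_refl order_trans)
qed

text \<open>A fast subsequence converges almost everywhere, and Fatou's lemma shows that its limit is
  the limit in \<open>L\<^sup>2\<close> of the whole sequence.\<close>

lemma square_integrable_complete:
  fixes f :: "nat \<Rightarrow> 'b \<Rightarrow> real"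
  assumes sq: "\<And>n. square_integrable N (f n)"
    and Cauchy: "\<And>e. 0 < e \<Longrightarrow> \<exists>K. \<forall>m\<ge>K. \<forall>n\<ge>K. (LINT x|N. (f m x - f n x)\<^sup>2) < e"
  shows "\<exists>g. square_integrable N g \<and> (\<lambda>n. LINT x|N. (f n x - g x)\<^sup>2) \<longlonglongrightarrow> 0"
proof -
  have [measurable]: "f n \<in> borel_measurable N" for n
    using sq[of n] by (simp add: square_integrable_def)
  obtain r :: "nat \<Rightarrow> nat" where r: "strict_mono r"
    and fast: "\<And>n m. r n \<le> m \<Longrightarrow> (LINT x|N. (f m x - f (r n) x)\<^sup>2) < (1/8) ^ n"
    using Cauchy_fast_subseq[of "\<lambda>m n. LINT x|N. (f m x - f n x)\<^sup>2"] Cauchy by blast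
  have "AE x in N. convergent (\<lambda>n. f (r n) x)"
  proof (rule AE_convergent_of_summable_weighted_squares)
    show "summable (\<lambda>n. 4 ^ n * (LINT x|N. (f (r (Suc n)) x - f (r n) x)\<^sup>2))"
    proof (rule summable_comparison_test_ev)
      have "4 ^ n * (LINT x|N. (f (r (Suc n)) x - f (r n) x)\<^sup>2) \<le> (1/2) ^ n" for n
      proof -
        have "(LINT x|N. (f (r (Suc n)) x - f (r n) x)\<^sup>2) \<le> (1/8) ^ n"
          using fast[of n "r (Suc n)"] r by (simp add: strict_mono_less_eq)
        then have "4 ^ n * (LINT x|N. (f (r (Suc n)) x - f (r n) x)\<^sup>2) \<le> 4 ^ n * (1/8) ^ n"
          by (rule mult_left_mono) simp
        also have "\<dots> = (1/2::real) ^ n"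
          by (simp add: power_mult_distrib[symmetric])
        finally show ?thesis .
      qed
      then show "\<forall>\<^sub>F n in sequentially.
          norm (4 ^ n * (LINT x|N. (f (r (Suc n)) x - f (r n) x)\<^sup>2)) \<le> (1/2) ^ n"
        by (simp add: abs_mult)
    qed (simp add: summable_geometric)
  qed (rule sq)
  then have lim: "AE x in N. (\<lambda>n. f (r n) x) \<longlonglongrightarrow> lim (\<lambda>n. f (r n) x)"
    by eventually_elim (simp add: convergent_LIMSEQ_iff)
  define g where "g x = lim (\<lambda>n. f (r n) x)" for x
  have [measurable]: "g \<in> borel_measurable N"
    unfolding g_def by measurable
  have Fatou: "(\<integral>\<^sup>+x. ennreal ((f m x - g x)\<^sup>2) \<partial>N) \<le> ennreal e"
    if e: "\<And>n. n \<ge> k \<Longrightarrow> (LINT x|N. (f m x - f n x)\<^sup>2) \<le> e" for m k e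
  proof -
    have "(\<integral>\<^sup>+x. ennreal ((f m x - g x)\<^sup>2) \<partial>N)
        = (\<integral>\<^sup>+x. liminf (\<lambda>n. ennreal ((f m x - f (r n) x)\<^sup>2)) \<partial>N)"
    proof (rule nn_integral_cong_AE)
      show "AE x in N. ennreal ((f m x - g x)\<^sup>2) = liminf (\<lambda>n. ennreal ((f m x - f (r n) x)\<^sup>2))"
        using lim
      proof eventually_elim
        case (elim x)
        have "(\<lambda>n. ennreal ((f m x - f (r n) x)\<^sup>2)) \<longlonglongrightarrow> ennreal ((f m x - g x)\<^sup>2)"
          unfolding g_def by (intro tendsto_ennrealI tendsto_intros elim)
        then show ?case by (intro lim_imp_Liminf[symmetric]) auto
      qed
    qed
    also have "\<dots> \<le> liminf (\<lambda>n. \<integral>\<^sup>+x. ennreal ((f m x - f (r n) x)\<^sup>2) \<partial>N)"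
      by (rule nn_integral_liminf) simp
    also have "\<dots> = liminf (\<lambda>n. ennreal (LINT x|N. (f m x - f (r n) x)\<^sup>2))"
    proof -
      have "(\<integral>\<^sup>+x. ennreal ((f m x - f (r n) x)\<^sup>2) \<partial>N) = ennreal (LINT x|N. (f m x - f (r n) x)\<^sup>2)" for n
        using square_integrable_diff[OF sq sq, of m "r n"]
        by (intro nn_integral_eq_integral) (auto simp: square_integrable_def)
      then show ?thesis by simp
    qed
    also have "\<dots> \<le> ennreal e"
    proof (rule Liminf_le)
      have "k \<le> r n" if "k \<le> n" for n
        using that seq_suble[OF r, of n] by linarith
      then show "\<forall>\<^sub>F n in sequentially. ennreal (LINT x|N. (f m x - f (r n) x)\<^sup>2) \<le> ennreal e"
        by (intro eventually_sequentiallyI[of k] ennreal_leI e)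
    qed auto
    finally show ?thesis .
  qed
  have sqd: "square_integrable N (\<lambda>x. f m x - g x) \<and> (LINT x|N. (f m x - g x)\<^sup>2) \<le> e"
    if e: "\<And>n. n \<ge> k \<Longrightarrow> (LINT x|N. (f m x - f n x)\<^sup>2) \<le> e" for m k e
  proof
    have e0: "0 \<le> e" using e[OF order_refl] by (meson Bochner_Integration.integral_nonneg order_trans zero_le_power2)
    have fin: "(\<integral>\<^sup>+x. ennreal ((f m x - g x)\<^sup>2) \<partial>N) \<le> ennreal e" by (rule Fatou[OF e])
    have int: "integrable N (\<lambda>x. (f m x - g x)\<^sup>2)"
      by (rule integrableI_bounded)
        (use fin in \<open>auto simp: le_less_trans[OF _ ennreal_less_top]\<close>)
    then show "square_integrable N (\<lambda>x. f m x - g x)"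
      by (simp add: square_integrable_def)
    show "(LINT x|N. (f m x - g x)\<^sup>2) \<le> e"
      using fin nn_integral_eq_integral[OF int] e0 by simp
  qed
  obtain k0 where "\<And>m n. m \<ge> k0 \<Longrightarrow> n \<ge> k0 \<Longrightarrow> (LINT x|N. (f m x - f n x)\<^sup>2) \<le> 1"
    using Cauchy[of 1] by (meson less_imp_le zero_less_one)
  then have "square_integrable N (\<lambda>x. f k0 x - g x)" using sqd[of k0 k0 1] by simp
  from square_integrable_diff[OF sq this, of k0] have "square_integrable N g" by simp
  moreover have "(\<lambda>n. LINT x|N. (f n x - g x)\<^sup>2) \<longlonglongrightarrow> 0"
  proof (rule LIMSEQ_I)
    fix e :: real assume "0 < e"
    then obtain K where "\<And>m n. m \<ge> K \<Longrightarrow> n \<ge> K \<Longrightarrow> (LINT x|N. (f m x - f n x)\<^sup>2) < e / 2"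
      using Cauchy[of "e/2"] by auto
    then have "(LINT x|N. (f m x - g x)\<^sup>2) \<le> e / 2" if "m \<ge> K" for m
      using sqd[of K m "e/2"] that by (simp add: less_imp_le)
    then show "\<exists>K. \<forall>n\<ge>K. norm ((LINT x|N. (f n x - g x)\<^sup>2) - 0) < e"
      using \<open>0 < e\<close> by (intro exI[of _ K]) (fastforce simp: abs_of_nonneg)
  qed
  ultimately show ?thesis by blast
qed

section \<open>Analytic sets and Choquet capacitability\<close>

text \<open>Projections of closed subsets of a product with the Baire space: the quantifier over \<open>\<sigma>\<close> makes
  closure under countable unions and intersections a matter of recoding \<open>\<sigma>\<close>.\<close>

definition analytic_set :: "'a::metric_space set \<Rightarrow> bool" where
  "analytic_set A \<longleftrightarrow> (\<exists>F :: ('a \<times> (nat \<Rightarrow> nat)) set. closed F \<and> A = {x. \<exists>\<sigma>. (x, \<sigma>) \<in> F})"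

lemma closed_imp_analytic_set: "closed A \<Longrightarrow> analytic_set A"
  unfolding analytic_set_def by (intro exI[of _ "A \<times> UNIV"]) (auto intro: closed_Times)

lemma continuous_on_recode:
  "continuous_on UNIV (\<lambda>z :: 'a::metric_space \<times> (nat \<Rightarrow> nat). (fst z, \<lambda>k. snd z (e k)))"
proof (intro continuous_on_Pair continuous_on_coordinatewise_then_product continuous_on_fst continuous_on_id)
  fix k
  show "continuous_on UNIV (\<lambda>z :: 'a \<times> (nat \<Rightarrow> nat). snd z (e k))"
    by (rule continuous_on_product_then_coordinatewise) (intro continuous_on_snd continuous_on_id)
qed

lemma analytic_set_UN:
  fixes A :: "nat \<Rightarrow> 'a::metric_space set"
  assumes "\<And>n. analytic_set (A n)"
  shows "analytic_set (\<Union>n. A n)"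
proof -
  obtain F :: "nat \<Rightarrow> ('a \<times> (nat \<Rightarrow> nat)) set"
    where F: "\<And>n. closed (F n)" "\<And>n. A n = {x. \<exists>\<sigma>. (x, \<sigma>) \<in> F n}"
    using assms unfolding analytic_set_def by metis
  let ?\<phi> = "\<lambda>z :: 'a \<times> (nat \<Rightarrow> nat). (fst z, \<lambda>k. snd z (Suc k))"
  \<comment> \<open>\<open>\<sigma> 0\<close> selects one of the sets, and the tail of \<open>\<sigma>\<close> is a witness for it\<close>
  define E where "E = (\<Inter>n. (\<lambda>z. snd z 0) -` (- {n}) \<union> ?\<phi> -` F n)"
  have "closed E"
    unfolding E_def
  proof (intro closed_INT ballI closed_Un)
    fix n :: nat
    have "continuous_on UNIV (\<lambda>z :: 'a \<times> (nat \<Rightarrow> nat). snd z 0)"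
      by (rule continuous_on_product_then_coordinatewise) (intro continuous_on_snd continuous_on_id)
    moreover have "closed (- {n})" unfolding closed_def by (rule Topological_Spaces.open_discrete)
    ultimately show "closed ((\<lambda>z :: 'a \<times> (nat \<Rightarrow> nat). snd z 0) -` (- {n}))"
      by (intro closed_vimage)
    show "closed (?\<phi> -` F n)"
      by (intro closed_vimage F continuous_on_recode)
  qed
  moreover have "(\<Union>n. A n) = {x. \<exists>\<sigma>. (x, \<sigma>) \<in> E}"
  proof (intro equalityI subsetI)
    fix x assume "x \<in> (\<Union>n. A n)"
    then obtain n \<sigma> where "(x, \<sigma>) \<in> F n" using F(2) by auto
    then have "(x, case_nat n \<sigma>) \<in> E" by (auto simp: E_def)
    then show "x \<in> {x. \<exists>\<sigma>. (x, \<sigma>) \<in> E}" by blast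
  next
    fix x assume "x \<in> {x. \<exists>\<sigma>. (x, \<sigma>) \<in> E}"
    then obtain \<sigma> where "(x, \<sigma>) \<in> E" by blast
    then have "(x, \<lambda>k. \<sigma> (Suc k)) \<in> F (\<sigma> 0)" by (auto simp: E_def)
    then show "x \<in> (\<Union>n. A n)" using F(2) by auto
  qed
  ultimately show ?thesis unfolding analytic_set_def by blast
qed

lemma analytic_set_INT:
  fixes A :: "nat \<Rightarrow> 'a::metric_space set"
  assumes "\<And>n. analytic_set (A n)"
  shows "analytic_set (\<Inter>n. A n)"
proof -
  obtain F :: "nat \<Rightarrow> ('a \<times> (nat \<Rightarrow> nat)) set"
    where F: "\<And>n. closed (F n)" "\<And>n. A n = {x. \<exists>\<sigma>. (x, \<sigma>) \<in> F n}"
    using assms unfolding analytic_set_def by metis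
  let ?\<phi> = "\<lambda>n z. (fst z, \<lambda>k. snd z (prod_encode (n, k)))"
  \<comment> \<open>\<open>\<sigma>\<close> encodes one witness for each \<open>n\<close>\<close>
  define E where "E = (\<Inter>n. ?\<phi> n -` F n)"
  have "closed E"
    unfolding E_def by (intro closed_INT ballI closed_vimage F continuous_on_recode)
  moreover have "(\<Inter>n. A n) = {x. \<exists>\<sigma>. (x, \<sigma>) \<in> E}"
  proof (intro equalityI subsetI)
    fix x assume "x \<in> (\<Inter>n. A n)"
    then have "\<forall>n. \<exists>\<sigma>. (x, \<sigma>) \<in> F n" using F(2) by auto
    then obtain \<sigma> where "\<And>n. (x, \<sigma> n) \<in> F n" by metis
    then have "(x, \<lambda>j. case prod_decode j of (n, k) \<Rightarrow> \<sigma> n k) \<in> E" by (auto simp: E_def)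
    then show "x \<in> {x. \<exists>\<sigma>. (x, \<sigma>) \<in> E}" by blast
  next
    fix x assume "x \<in> {x. \<exists>\<sigma>. (x, \<sigma>) \<in> E}"
    then show "x \<in> (\<Inter>n. A n)" using F(2) by (auto simp: E_def)
  qed
  ultimately show ?thesis unfolding analytic_set_def by blast
qed

lemma open_imp_analytic_set:
  fixes U :: "'a::euclidean_space set"
  assumes "open U"
  shows "analytic_set U"
proof -
  obtain C :: "nat \<Rightarrow> 'a set" where C: "\<And>n. compact (C n)" "\<Union>(range C) = U"
    using open_Union_compact_subsets[OF assms] by metis
  have "analytic_set (\<Union>n. C n)"
    by (intro analytic_set_UN closed_imp_analytic_set compact_imp_closed C)
  then show ?thesis using C(2) by simp
qed

text \<open>Analytic sets are not closed under complements, so the induction carries the claim for the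
  complement along.\<close>

lemma borel_imp_analytic_set:
  fixes A :: "'a::euclidean_space set"
  assumes "A \<in> sets borel"
  shows "analytic_set A"
proof -
  have "A \<in> sigma_sets UNIV {S. open S}" using assms by (simp add: sets_borel)
  then have "analytic_set A \<and> analytic_set (- A)"
  proof induction
    case (Basic U)
    then show ?case by (auto intro: open_imp_analytic_set closed_imp_analytic_set)
  next
    case Empty
    show ?case by (auto intro: closed_imp_analytic_set)
  next
    case (Compl A)
    then show ?case by (simp add: Compl_eq_Diff_UNIV[symmetric])
  next
    case (Union A)
    then show ?case by (simp add: Compl_UN analytic_set_UN analytic_set_INT)
  qed
  then show ?thesis ..
qed

lemma compact_bounded_sequences: "compact {\<sigma> :: nat \<Rightarrow> nat. \<forall>i. \<sigma> i \<le> m i}"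
proof -
  have "compactin (product_topology (\<lambda>_. euclidean) UNIV) (PiE UNIV (\<lambda>i. {..m i}))"
    unfolding compactin_PiE by (auto intro: finite_imp_compact)
  moreover have "PiE UNIV (\<lambda>i. {..m i}) = {\<sigma> :: nat \<Rightarrow> nat. \<forall>i. \<sigma> i \<le> m i}"
    by (auto simp: PiE_UNIV_domain Pi_def)
  ultimately show ?thesis by (simp add: euclidean_product_topology)
qed

lemma tendsto_fun_iff:
  fixes f :: "'b \<Rightarrow> 'i \<Rightarrow> 'c::topological_space"
  shows "(f \<longlongrightarrow> l) F \<longleftrightarrow> (\<forall>i. ((\<lambda>k. f k i) \<longlongrightarrow> l i) F)"
  using limitin_componentwise[of "\<lambda>_::'i. euclidean :: 'c topology" UNIV f l F]
  by (simp add: euclidean_product_topology)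

text \<open>The coordinates of \<open>\<sigma>\<close> are bounded one after the other, by bounds so large that the value of
  \<open>c\<close> stays above \<open>r\<close>, which is possible by continuity along increasing sequences. Bounding all the
  coordinates leaves a compact set, and by compactness each of its neighbourhoods contains the set
  obtained by bounding only finitely many of them.\<close>

lemma Choquet_capacitability:
  fixes c :: "'a::euclidean_space set \<Rightarrow> ereal"
  assumes M: "compact M" and mono: "\<And>A B. A \<subseteq> B \<Longrightarrow> c A \<le> c B"
    and inc: "\<And>A. incseq A \<Longrightarrow> (\<And>n. A n \<subseteq> M) \<Longrightarrow> (\<And>n. c (A n) \<le> r) \<Longrightarrow> c (\<Union>n::nat. A n) \<le> r"
    and A: "A \<in> sets borel" "A \<subseteq> M" and r: "r < c A"
  shows "\<exists>K. compact K \<and> K \<subseteq> A \<and> (\<forall>G. openin (top_of_set M) G \<longrightarrow> K \<subseteq> G \<longrightarrow> r < c G)"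
proof -
  obtain F :: "('a \<times> (nat \<Rightarrow> nat)) set" where F: "closed F" "A = {x. \<exists>\<sigma>. (x, \<sigma>) \<in> F}"
    using borel_imp_analytic_set[OF A(1)] by (auto simp: analytic_set_def)
  define D where "D m n = {x. \<exists>\<sigma>. (x, \<sigma>) \<in> F \<and> (\<forall>i<n. \<sigma> i \<le> m i)}" for m :: "nat \<Rightarrow> nat" and n :: nat
  have DA: "D m n \<subseteq> A" for m n using F(2) by (auto simp: D_def)
  obtain s where s: "\<And>n. r < c (D (s n) n)" "\<And>n i. i < n \<Longrightarrow> s (Suc n) i = s n i"
  proof -
    have "\<exists>s. \<forall>n. r < c (D (s n) n) \<and> (\<forall>i<n. s (Suc n) i = s n i)"
    proof (rule dependent_nat_choice)
      have "D (\<lambda>_. 0) 0 = A" using F(2) by (simp add: D_def)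
      then show "\<exists>m. r < c (D m 0)" using r by metis
    next
      fix m n assume m: "r < c (D m n)"
      define B where "B k = D (m(n := k)) (Suc n)" for k
      have "incseq B"
        unfolding incseq_Suc_iff B_def D_def by (fastforce simp: less_Suc_eq)
      moreover have "(\<Union>k. B k) = D m n"
      proof (intro equalityI subsetI)
        fix x assume "x \<in> D m n"
        then obtain \<sigma> where "(x, \<sigma>) \<in> F" "\<forall>i<n. \<sigma> i \<le> m i" by (auto simp: D_def)
        then have "x \<in> B (\<sigma> n)" by (auto simp: B_def D_def less_Suc_eq)
        then show "x \<in> (\<Union>k. B k)" by blast
      qed (force simp: B_def D_def less_Suc_eq)
      moreover have "B k \<subseteq> M" for k using DA A(2) by (auto simp: B_def)
      ultimately obtain k where "r < c (B k)"
        using inc[of B] m by (metis not_le)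
      then show "\<exists>m'. r < c (D m' (Suc n)) \<and> (\<forall>i<n. m' i = m i)"
        unfolding B_def by (intro exI[of _ "m(n := k)"]) auto
    qed
    then show thesis using that by blast
  qed
  define m where "m i = s (Suc i) i" for i
  have sm: "s n i = m i" if "i < n" for n i
    using that
  proof (induction n)
    case (Suc n)
    then show ?case by (cases "i = n") (auto simp: m_def s(2))
  qed simp
  have Dm: "D (s n) n = D m n" for n
    unfolding D_def using sm by auto
  then have rD: "r < c (D m n)" for n using s(1)[of n] by simp
  define B where "B = {\<sigma> :: nat \<Rightarrow> nat. \<forall>i. \<sigma> i \<le> m i}"
  define K where "K = fst ` (F \<inter> M \<times> B)"
  have cMB: "compact (M \<times> B)"
    unfolding B_def by (intro compact_Times M compact_bounded_sequences)
  have "compact K"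
    unfolding K_def by (intro compact_continuous_image continuous_on_fst continuous_on_id closed_Int_compact F cMB)
  moreover have "K \<subseteq> A" unfolding K_def using F(2) by force
  moreover have "r < c G" if G: "openin (top_of_set M) G" and KG: "K \<subseteq> G" for G
  proof -
    have "\<exists>n. D m n \<subseteq> G"
    proof (rule ccontr)
      assume "\<nexists>n. D m n \<subseteq> G"
      then have "\<forall>n. \<exists>y. y \<in> D m n \<and> y \<notin> G" by blast
      then obtain x where xD: "\<And>n. x n \<in> D m n" and xG: "\<And>n. x n \<notin> G" by metis
      have "\<forall>n. \<exists>\<sigma>. (x n, \<sigma>) \<in> F \<and> (\<forall>i<n. \<sigma> i \<le> m i)" using xD by (simp add: D_def)
      then obtain \<sigma> where x: "\<And>n. (x n, \<sigma> n) \<in> F" "\<And>n i. i < n \<Longrightarrow> \<sigma> n i \<le> m i" by metis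
      have xM: "x n \<in> M" for n using xD DA A(2) by blast
      \<comment> \<open>only the first \<open>n\<close> coordinates of \<open>\<sigma> n\<close> are bounded; cutting off the others moves it into
        a compact set without affecting pointwise limits\<close>
      define \<tau> where "\<tau> n i = min (\<sigma> n i) (m i)" for n i
      have MB: "\<forall>n. (x n, \<tau> n) \<in> M \<times> B" using xM by (auto simp: \<tau>_def B_def)
      obtain l q where l: "l \<in> M \<times> B" and q: "strict_mono q" and lim: "((\<lambda>n. (x n, \<tau> n)) \<circ> q) \<longlonglongrightarrow> l"
        by (rule seq_compactE[OF compact_imp_seq_compact[OF cMB] MB])
      have lx: "(\<lambda>n. x (q n)) \<longlonglongrightarrow> fst l" and l\<tau>: "(\<lambda>n. \<tau> (q n)) \<longlonglongrightarrow> snd l"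
        using tendsto_fst[OF lim] tendsto_snd[OF lim] by (simp_all add: comp_def)
      have "(\<lambda>n. \<sigma> (q n)) \<longlonglongrightarrow> snd l"
        unfolding tendsto_fun_iff
      proof
        fix i
        have "eventually (\<lambda>n. \<tau> (q n) i = \<sigma> (q n) i) sequentially"
        proof (rule eventually_sequentiallyI[of "Suc i"])
          fix n assume "Suc i \<le> n"
          then have "i < q n" using seq_suble[OF q, of n] by simp
          then show "\<tau> (q n) i = \<sigma> (q n) i" using x(2) by (simp add: \<tau>_def)
        qed
        moreover have "(\<lambda>n. \<tau> (q n) i) \<longlonglongrightarrow> snd l i" using l\<tau> unfolding tendsto_fun_iff by blast
        ultimately show "(\<lambda>n. \<sigma> (q n) i) \<longlonglongrightarrow> snd l i" by (rule Lim_transform_eventually[rotated])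
      qed
      from tendsto_Pair[OF lx this] have "(\<lambda>n. (x (q n), \<sigma> (q n))) \<longlonglongrightarrow> l" by simp
      then have "l \<in> F" by (rule closed_sequentially[OF F(1) x(1)])
      then have "fst l \<in> K" using l by (auto simp: K_def)
      moreover have "fst l \<in> M - G"
      proof (rule closed_sequentially[OF _ _ lx])
        have "closedin (top_of_set M) (M - G)" using G by (simp add: closedin_def Diff_Diff_Int inf_absorb2 openin_imp_subset)
        then show "closed (M - G)" using closedin_closed_trans compact_imp_closed[OF M] by blast
        show "x (q n) \<in> M - G" for n using xG xM by simp
      qed
      ultimately show False using KG by blast
    qed
    then obtain n where "D m n \<subseteq> G" by blast
    then show ?thesis using rD[of n] mono by (meson less_le_trans)
  qed
  ultimately show ?thesis by blast
qed

section \<open>The transition kernel\<close>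

locale rbm_kernel = reflected_brownian_motion M \<Omega> P X
  for M :: "'a::euclidean_space set"
    and \<Omega> :: "'w measure" and P :: "'a \<Rightarrow> 'w measure" and X :: "real \<Rightarrow> 'w \<Rightarrow> 'a" +
  fixes p :: "real \<Rightarrow> 'a \<Rightarrow> 'a \<Rightarrow> real"
  assumes heat_kernel: "neumann_heat_kernel M \<Omega> P X p"
begin

abbreviation "\<T> \<equiv> trans_op P X"
abbreviation "\<E> f \<equiv> energy M f f"
abbreviation "\<E>1 \<equiv> energy1 M"
abbreviation "relopen \<equiv> openin (top_of_set M)"
abbreviation "Cap \<equiv> capacity M"
abbreviation "qe \<equiv> quasi_everywhere_on M"
abbreviation "eig \<equiv> killed_eigenvalue M"

lemma compact_M: "compact M"
  using domain compact_closure by blast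

lemma M_borel [measurable]: "M \<in> sets borel"
  using compact_M by (simp add: borel_compact)

lemma space_mu [simp]: "space (mu M) = M"
  by (simp add: mu_def space_restrict_space)

lemma sets_mu: "sets (mu M) = sets (restrict_space borel M)"
  by (simp add: mu_def cong: sets_restrict_space_cong)

lemma measurable_mu_eq: "measurable N (mu M) = measurable N (restrict_space borel M)"
  by (rule measurable_cong_sets) (auto simp: sets_mu)

lemma sets_muI: "B \<in> sets borel \<Longrightarrow> B \<subseteq> M \<Longrightarrow> B \<in> sets (mu M)"
  by (auto simp: sets_mu sets_restrict_space_iff)

lemma sets_muD: "B \<in> sets (mu M) \<Longrightarrow> B \<in> sets borel \<and> B \<subseteq> M"
  by (auto simp: sets_mu sets_restrict_space_iff)

lemma prob_space_mu: "prob_space (mu M)"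
  unfolding mu_def
proof (rule prob_space_uniform_measure)
  have eq: "emeasure (restrict_space lborel M) M = emeasure lborel M"
    by (rule emeasure_restrict_space) auto
  obtain U where U: "open U" "U \<noteq> {}" "U \<subseteq> M"
    using domain closure_subset by blast
  then obtain x e where "0 < e" "ball x e \<subseteq> M"
    by (metis open_contains_ball_eq ex_in_conv subset_trans)
  moreover from \<open>0 < e\<close> have "emeasure lborel (ball x e) \<noteq> 0"
    using less_imp_neq[OF unit_ball_vol_pos[of "real DIM('a)"]] by (simp add: emeasure_ball)
  ultimately have "0 < emeasure lborel (ball x e)" "emeasure lborel (ball x e) \<le> emeasure lborel M"
    by (auto intro!: emeasure_mono simp: zero_less_iff_neq_zero)
  then show "emeasure (restrict_space lborel M) M \<noteq> 0"
    using eq by auto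
  show "emeasure (restrict_space lborel M) M \<noteq> \<infinity>"
    using eq emeasure_compact_finite[OF compact_M] by auto
qed

sublocale mu: prob_space "mu M"
  by (rule prob_space_mu)

sublocale mumu: pair_prob_space "mu M" "mu M" ..

lemma L2_iff: "f \<in> L2 M \<longleftrightarrow> square_integrable (mu M) f"
  by (simp add: L2_def square_integrable_def)

lemma p_measurable [measurable]:
  "0 < t \<Longrightarrow> (\<lambda>z. p t (fst z) (snd z)) \<in> borel_measurable (mu M \<Otimes>\<^sub>M mu M)"
  using heat_kernel by (simp add: neumann_heat_kernel_def case_prod_beta')

lemma p_measurable1 [measurable]:
  "0 < t \<Longrightarrow> x \<in> M \<Longrightarrow> p t x \<in> borel_measurable (mu M)"
  using measurable_compose[OF measurable_Pair1'[of x "mu M" "mu M"] p_measurable[of t]] by simp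

lemma p_nonneg: "0 < t \<Longrightarrow> x \<in> M \<Longrightarrow> y \<in> M \<Longrightarrow> 0 \<le> p t x y"
  using heat_kernel by (simp add: neumann_heat_kernel_def)

lemma p_sym: "0 < t \<Longrightarrow> x \<in> M \<Longrightarrow> y \<in> M \<Longrightarrow> p t x y = p t y x"
  using heat_kernel unfolding neumann_heat_kernel_def by blast

lemma prob_space_P: "x \<in> M \<Longrightarrow> prob_space (P x)"
  using measurable_space[OF kernel, of x] by (simp add: space_restrict_space space_prob_algebra)

lemma sets_P [simp]: "x \<in> M \<Longrightarrow> sets (P x) = sets \<Omega>"
  using measurable_space[OF kernel, of x] by (simp add: space_restrict_space space_prob_algebra)

lemma space_P [simp]: "x \<in> M \<Longrightarrow> space (P x) = space \<Omega>"
  using sets_P by (rule sets_eq_imp_space_eq)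

lemma measurable_X: "0 \<le> t \<Longrightarrow> X t \<in> \<Omega> \<rightarrow>\<^sub>M mu M"
  using coordinate by (simp add: measurable_mu_eq)

lemma measurable_X_P: "0 \<le> t \<Longrightarrow> x \<in> M \<Longrightarrow> X t \<in> P x \<rightarrow>\<^sub>M mu M"
  using measurable_X[of t] measurable_cong_sets[OF sets_P, of x] by blast

lemma X_in_M: "0 \<le> t \<Longrightarrow> \<omega> \<in> space \<Omega> \<Longrightarrow> X t \<omega> \<in> M"
  using measurable_space[OF measurable_X] by simp

text \<open>The law of \<open>X\<^sub>t\<close> under \<open>P\<^sub>x\<close>, written with its density so that Fubini's theorem and the symmetry
  of \<open>p\<^sub>t\<close> can be used.\<close>

definition K :: "real \<Rightarrow> 'a \<Rightarrow> 'a measure" where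
  "K t x = density (mu M) (\<lambda>y. ennreal (p t x y))"

lemma sets_K [simp, measurable_cong]: "sets (K t x) = sets (mu M)"
  by (simp add: K_def)

lemma space_K [simp]: "space (K t x) = M"
  by (simp add: K_def)

lemma distr_X: "0 < t \<Longrightarrow> x \<in> M \<Longrightarrow> distr (P x) (mu M) (X t) = K t x"
proof (rule measure_eqI)
  fix B assume t: "0 < t" "x \<in> M" and "B \<in> sets (distr (P x) (mu M) (X t))"
  then have B: "B \<in> sets (mu M)" by simp
  have "emeasure (distr (P x) (mu M) (X t)) B = emeasure (P x) {\<omega>\<in>space \<Omega>. X t \<omega> \<in> B}"
    using t B by (subst emeasure_distr[OF measurable_X_P])
      (auto intro!: arg_cong2[of _ _ _ _ emeasure])
  also have "\<dots> = (\<integral>\<^sup>+y\<in>B. ennreal (p t x y) \<partial>mu M)"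
    using heat_kernel t B by (simp add: neumann_heat_kernel_def)
  also have "\<dots> = emeasure (K t x) B"
    unfolding K_def using t B by (subst emeasure_density) auto
  finally show "emeasure (distr (P x) (mu M) (X t)) B = emeasure (K t x) B" .
qed auto

lemma prob_space_K: "0 < t \<Longrightarrow> x \<in> M \<Longrightarrow> prob_space (K t x)"
  unfolding distr_X[symmetric]
  by (intro prob_space.prob_space_distr prob_space_P measurable_X_P) auto

lemma nn_integral_K:
  "0 < t \<Longrightarrow> x \<in> M \<Longrightarrow> f \<in> borel_measurable (mu M) \<Longrightarrow>
    (\<integral>\<^sup>+y. f y \<partial>K t x) = (\<integral>\<^sup>+y. ennreal (p t x y) * f y \<partial>mu M)"
  unfolding K_def by (subst nn_integral_density) auto

lemma trans_op_K:
  assumes "0 < t" "x \<in> M" "f \<in> borel_measurable (mu M)"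
  shows "\<T> t f x = (LINT y|K t x. f y)"
  unfolding trans_op_def distr_X[OF assms(1,2), symmetric]
  using assms by (subst integral_distr[OF measurable_X_P]) auto

lemma trans_op_eq:
  assumes "0 < t" "x \<in> M" "f \<in> borel_measurable (mu M)"
  shows "\<T> t f x = (LINT y|mu M. p t x y * f y)"
  unfolding trans_op_K[OF assms] K_def
  using assms by (subst integral_density) (auto intro!: p_nonneg AE_I2)

lemma measurable_trans_op [measurable]:
  assumes "0 < t" "f \<in> borel_measurable (mu M)"
  shows "\<T> t f \<in> borel_measurable (mu M)"
proof -
  have "(\<lambda>x. LINT y|mu M. p t x y * f y) \<in> borel_measurable (mu M)"
  proof (rule mu.borel_measurable_lebesgue_integral)
    show "(\<lambda>(x, y). p t x y * f y) \<in> borel_measurable (mu M \<Otimes>\<^sub>M mu M)"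
      using p_measurable[OF assms(1)] assms(2) by (simp add: case_prod_beta')
  qed
  then show ?thesis
    using trans_op_eq[OF assms(1) _ assms(2)] by (subst measurable_cong) auto
qed

lemma measurable_nn_integral_K [measurable]:
  assumes "0 < t" "f \<in> borel_measurable (mu M)"
  shows "(\<lambda>x. \<integral>\<^sup>+y. f y \<partial>K t x) \<in> borel_measurable (mu M)"
proof -
  have "(\<lambda>x. \<integral>\<^sup>+y. ennreal (p t x y) * f y \<partial>mu M) \<in> borel_measurable (mu M)"
  proof (rule mu.borel_measurable_nn_integral)
    show "(\<lambda>(x, y). ennreal (p t x y) * f y) \<in> borel_measurable (mu M \<Otimes>\<^sub>M mu M)"
      using p_measurable[OF assms(1)] assms(2) by (simp add: case_prod_beta')
  qed
  then show ?thesis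
    using nn_integral_K[OF assms(1) _ assms(2)] by (subst measurable_cong) auto
qed

subsection \<open>The Markov property at deterministic times\<close>

lemma natural_sets_mono: "s \<le> t \<Longrightarrow> natural_sets \<Omega> X s \<subseteq> natural_sets \<Omega> X t"
  unfolding natural_sets_def by (rule sigma_sets_mono') fastforce

lemma natural_sets_subset: "natural_sets \<Omega> X s \<subseteq> sets \<Omega>"
  unfolding natural_sets_def
proof (rule sets.sigma_sets_subset, safe)
  fix r :: real and B assume "0 \<le> r" and B: "(B :: 'a set) \<in> sets borel"
  have "X r -` (B \<inter> M) \<inter> space \<Omega> \<in> sets \<Omega>"
    using B by (intro measurable_sets[OF measurable_X[OF \<open>0 \<le> r\<close>]] sets_muI) auto
  also have "X r -` (B \<inter> M) \<inter> space \<Omega> = X r -` B \<inter> space \<Omega>"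
    using X_in_M[OF \<open>0 \<le> r\<close>] by auto
  finally show "X r -` B \<inter> space \<Omega> \<in> sets \<Omega>" .
qed

lemma natural_sets_const: "{} \<in> natural_sets \<Omega> X s" "space \<Omega> \<in> natural_sets \<Omega> X s"
  by (auto simp: natural_sets_def sigma_sets_top intro: sigma_sets.Empty)

text \<open>A constant time \<open>s\<close> is a stopping time, and the events of the past up to \<open>s\<close> belong to the
  sigma-algebra stopped at \<open>s\<close>.\<close>

lemma Markov_property_set:
  assumes "x \<in> M" "0 \<le> s" "0 < t" and S: "S \<in> natural_sets \<Omega> X s" and B: "B \<in> sets (mu M)"
  shows "emeasure (P x) {\<omega>\<in>S. X (s + t) \<omega> \<in> B} = (\<integral>\<^sup>+\<omega>\<in>S. emeasure (K t (X s \<omega>)) B \<partial>P x)"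
proof -
  have Ssub: "S \<subseteq> space \<Omega>" using S natural_sets_subset sets.sets_into_space by blast
  have "{\<omega>\<in>space \<Omega>. ereal s \<le> ereal u} = (if s \<le> u then space \<Omega> else {})" for u
    by auto
  then have "rc_stopping_time \<Omega> X (\<lambda>_. ereal s)"
    unfolding rc_stopping_time_def rc_natural_sets_def
    using \<open>0 \<le> s\<close> natural_sets_const by simp
  moreover have "{\<omega>\<in>S. ereal s \<le> ereal u} = (if s \<le> u then S else {})" for u
    by auto
  then have "S \<in> stopped_sets \<Omega> X (\<lambda>_. ereal s)"
    unfolding stopped_sets_def rc_natural_sets_def
    using S natural_sets_subset natural_sets_const natural_sets_mono[of s]
    by (auto dest: less_imp_le) (meson less_imp_le order_trans subsetD)
  ultimately have "emeasure (P x) {\<omega>\<in>space \<Omega>. \<omega> \<in> S \<and> ereal s < \<infinity> \<and> X (s + t) \<omega> \<in> B} =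
      (\<integral>\<^sup>+\<omega>\<in>{\<omega>\<in>S. ereal s < \<infinity>}. emeasure (P (X s \<omega>)) {\<omega>'\<in>space \<Omega>. X t \<omega>' \<in> B} \<partial>P x)"
    using strong_Markov[of x "\<lambda>_. ereal s" S t B] assms sets_muD[OF B] by auto
  also have "\<dots> = (\<integral>\<^sup>+\<omega>\<in>S. emeasure (K t (X s \<omega>)) B \<partial>P x)"
  proof (rule nn_integral_cong)
    fix \<omega> assume "\<omega> \<in> space (P x)"
    then have XM: "X s \<omega> \<in> M" using X_in_M assms by simp
    have "emeasure (P (X s \<omega>)) {\<omega>'\<in>space \<Omega>. X t \<omega>' \<in> B} = emeasure (K t (X s \<omega>)) B"
      unfolding distr_X[OF \<open>0 < t\<close> XM, symmetric] using B XM \<open>0 < t\<close>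
      by (subst emeasure_distr[OF measurable_X_P]) (auto intro!: arg_cong2[of _ _ _ _ emeasure])
    then show "emeasure (P (X s \<omega>)) {\<omega>'\<in>space \<Omega>. X t \<omega>' \<in> B} * indicator {\<omega>\<in>S. ereal s < \<infinity>} \<omega>
        = emeasure (K t (X s \<omega>)) B * indicator S \<omega>"
      by (auto split: split_indicator)
  qed
  also have "{\<omega>\<in>space \<Omega>. \<omega> \<in> S \<and> ereal s < \<infinity> \<and> X (s + t) \<omega> \<in> B} = {\<omega>\<in>S. X (s + t) \<omega> \<in> B}"
    using Ssub by auto
  finally show ?thesis .
qed

lemma Markov_property:
  assumes x: "x \<in> M" and s: "0 \<le> s" and t: "0 < t"
    and S: "S \<in> natural_sets \<Omega> X s" and f: "f \<in> borel_measurable (mu M)"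
  shows "(\<integral>\<^sup>+\<omega>. indicator S \<omega> * f (X (s + t) \<omega>) \<partial>P x)
       = (\<integral>\<^sup>+\<omega>. indicator S \<omega> * (\<integral>\<^sup>+y. f y \<partial>K t (X s \<omega>)) \<partial>P x)"
proof -
  have [measurable]: "S \<in> sets (P x)"
    using S natural_sets_subset x by auto
  have [measurable]: "X (s + t) \<in> P x \<rightarrow>\<^sub>M mu M" "X s \<in> P x \<rightarrow>\<^sub>M mu M"
    using assms by (auto intro: measurable_X_P)
  note [measurable] = measurable_nn_integral_K[OF t]
  have KX[measurable]: "(\<lambda>\<omega>. \<integral>\<^sup>+y. g y \<partial>K t (X s \<omega>)) \<in> borel_measurable (P x)"
    if "g \<in> borel_measurable (mu M)" for g
    using measurable_compose[OF _ measurable_nn_integral_K[OF t that], of "X s" "P x"] by simp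
  from f show ?thesis
  proof (induction rule: borel_measurable_induct)
    case (cong f g)
    have "(\<integral>\<^sup>+\<omega>. indicator S \<omega> * f (X (s + t) \<omega>) \<partial>P x) = (\<integral>\<^sup>+\<omega>. indicator S \<omega> * g (X (s + t) \<omega>) \<partial>P x)"
      using cong(3) X_in_M s t x by (intro nn_integral_cong) auto
    moreover have "(\<integral>\<^sup>+y. f y \<partial>K t z) = (\<integral>\<^sup>+y. g y \<partial>K t z)" for z
      using cong(3) by (intro nn_integral_cong) auto
    ultimately show ?case using cong by simp
  next
    case (set B)
    have "(\<integral>\<^sup>+\<omega>. indicator S \<omega> * indicator B (X (s + t) \<omega>) \<partial>P x)
        = (\<integral>\<^sup>+\<omega>. indicator {\<omega>\<in>S. X (s + t) \<omega> \<in> B} \<omega> \<partial>P x)"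
      by (intro nn_integral_cong) (auto split: split_indicator)
    also have "{\<omega>\<in>S. X (s + t) \<omega> \<in> B} = S \<inter> (X (s + t) -` B \<inter> space (P x))"
      using sets.sets_into_space[OF \<open>S \<in> sets (P x)\<close>] by auto
    then have "{\<omega>\<in>S. X (s + t) \<omega> \<in> B} \<in> sets (P x)"
      using set by (auto intro!: measurable_sets[of _ "P x" "mu M"])
    then have "(\<integral>\<^sup>+\<omega>. indicator {\<omega>\<in>S. X (s + t) \<omega> \<in> B} \<omega> \<partial>P x) = emeasure (P x) {\<omega>\<in>S. X (s + t) \<omega> \<in> B}"
      by simp
    also have "\<dots> = (\<integral>\<^sup>+\<omega>\<in>S. emeasure (K t (X s \<omega>)) B \<partial>P x)"
      by (rule Markov_property_set[OF x s t S]) fact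
    finally show ?case
      using set by (simp add: mult.commute)
  next
    case (mult u c)
    then show ?case
      by (simp add: nn_integral_cmult mult.left_commute[of _ c])
  next
    case (add u v)
    then show ?case
      by (simp add: nn_integral_add distrib_left)
  next
    case (seq U)
    have "(\<integral>\<^sup>+\<omega>. indicator S \<omega> * (SUP i. U i) (X (s + t) \<omega>) \<partial>P x)
        = (\<integral>\<^sup>+\<omega>. (SUP i. indicator S \<omega> * U i (X (s + t) \<omega>)) \<partial>P x)"
      by (simp add: SUP_mult_left_ennreal image_comp)
    also have "\<dots> = (SUP i. \<integral>\<^sup>+\<omega>. indicator S \<omega> * U i (X (s + t) \<omega>) \<partial>P x)"
      using seq by (intro nn_integral_monotone_convergence_SUP)
        (auto simp: incseq_def le_fun_def intro!: mult_left_mono)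
    also have "\<dots> = (SUP i. \<integral>\<^sup>+\<omega>. indicator S \<omega> * (\<integral>\<^sup>+y. U i y \<partial>K t (X s \<omega>)) \<partial>P x)"
      using seq by simp
    also have "\<dots> = (\<integral>\<^sup>+\<omega>. (SUP i. indicator S \<omega> * (\<integral>\<^sup>+y. U i y \<partial>K t (X s \<omega>))) \<partial>P x)"
      using seq by (intro nn_integral_monotone_convergence_SUP[symmetric])
        (auto simp: incseq_def le_fun_def intro!: mult_left_mono nn_integral_mono)
    also have "\<dots> = (\<integral>\<^sup>+\<omega>. indicator S \<omega> * (\<integral>\<^sup>+y. (SUP i. U i) y \<partial>K t (X s \<omega>)) \<partial>P x)"
    proof -
      have "(\<integral>\<^sup>+y. (SUP i. U i) y \<partial>K t z) = (SUP i. \<integral>\<^sup>+y. U i y \<partial>K t z)" for z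
        using seq by (simp add: image_comp)
          (intro nn_integral_monotone_convergence_SUP, auto simp: incseq_def le_fun_def)
      then show ?thesis by (simp add: SUP_mult_left_ennreal)
    qed
    finally show ?case .
  qed
qed

lemma nn_integral_P_K:
  assumes "0 < t" "x \<in> M" "f \<in> borel_measurable (mu M)"
  shows "(\<integral>\<^sup>+\<omega>. f (X t \<omega>) \<partial>P x) = (\<integral>\<^sup>+y. f y \<partial>K t x)"
  unfolding distr_X[OF assms(1,2), symmetric] using assms
  by (subst nn_integral_distr[OF measurable_X_P]) auto

lemma Chapman_Kolmogorov_nn:
  assumes "0 < s" "0 < t" "x \<in> M" and f[measurable]: "f \<in> borel_measurable (mu M)"
  shows "(\<integral>\<^sup>+z. f z \<partial>K (s + t) x) = (\<integral>\<^sup>+y. (\<integral>\<^sup>+z. f z \<partial>K t y) \<partial>K s x)"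
proof -
  have "(\<integral>\<^sup>+z. f z \<partial>K (s + t) x) = (\<integral>\<^sup>+\<omega>. f (X (s + t) \<omega>) \<partial>P x)"
    using assms by (intro nn_integral_P_K[symmetric]) auto
  also have "\<dots> = (\<integral>\<^sup>+\<omega>. indicator (space \<Omega>) \<omega> * f (X (s + t) \<omega>) \<partial>P x)"
    using assms by (intro nn_integral_cong) auto
  also have "\<dots> = (\<integral>\<^sup>+\<omega>. indicator (space \<Omega>) \<omega> * (\<integral>\<^sup>+y. f y \<partial>K t (X s \<omega>)) \<partial>P x)"
    using assms natural_sets_const by (intro Markov_property) auto
  also have "\<dots> = (\<integral>\<^sup>+\<omega>. (\<integral>\<^sup>+y. f y \<partial>K t (X s \<omega>)) \<partial>P x)"
    using assms by (intro nn_integral_cong) auto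
  also have "\<dots> = (\<integral>\<^sup>+y. (\<integral>\<^sup>+z. f z \<partial>K t y) \<partial>K s x)"
    using assms measurable_nn_integral_K[OF \<open>0 < t\<close> f] by (intro nn_integral_P_K) auto
  finally show ?thesis .
qed

section \<open>The semigroup on square-integrable functions\<close>

text \<open>The joint law of \<open>X\<^sub>0\<close> and \<open>X\<^sub>t\<close> when \<open>X\<^sub>0\<close> has law \<open>\<mu>\<close>.\<close>

definition J :: "real \<Rightarrow> ('a \<times> 'a) measure" where
  "J t = density (mu M \<Otimes>\<^sub>M mu M) (\<lambda>z. ennreal (p t (fst z) (snd z)))"

lemma sets_J [simp, measurable_cong]: "sets (J t) = sets (mu M \<Otimes>\<^sub>M mu M)"
  by (simp add: J_def)

lemma space_J [simp]: "space (J t) = M \<times> M"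
  by (simp add: J_def space_pair_measure)

lemma nn_integral_p_eq_1: "0 < t \<Longrightarrow> x \<in> M \<Longrightarrow> (\<integral>\<^sup>+y. ennreal (p t x y) \<partial>mu M) = 1"
  using nn_integral_K[of t x "\<lambda>_. 1"] prob_space.emeasure_space_1[OF prob_space_K, of t x] by simp

lemma distr_J_fst: "0 < t \<Longrightarrow> distr (J t) (mu M) fst = mu M"
proof (rule measure_eqI)
  fix B assume t: "0 < t" and "B \<in> sets (distr (J t) (mu M) fst)"
  then have B[measurable]: "B \<in> sets (mu M)" by simp
  have "emeasure (distr (J t) (mu M) fst) B = (\<integral>\<^sup>+x. indicator B x \<partial>distr (J t) (mu M) fst)"
    by simp
  also have "\<dots> = (\<integral>\<^sup>+z. indicator B (fst z) \<partial>J t)"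
    by (subst nn_integral_distr) auto
  also have "\<dots> = (\<integral>\<^sup>+z. ennreal (p t (fst z) (snd z)) * indicator B (fst z) \<partial>(mu M \<Otimes>\<^sub>M mu M))"
    unfolding J_def using t by (subst nn_integral_density) auto
  also have "\<dots> = (\<integral>\<^sup>+x. \<integral>\<^sup>+y. ennreal (p t x y) * indicator B x \<partial>mu M \<partial>mu M)"
    using t by (subst mu.nn_integral_fst[symmetric]) auto
  also have "\<dots> = (\<integral>\<^sup>+x. indicator B x \<partial>mu M)"
    using t by (intro nn_integral_cong) (simp add: nn_integral_multc nn_integral_p_eq_1)
  finally show "emeasure (distr (J t) (mu M) fst) B = emeasure (mu M) B" by simp
qed auto

lemma distr_J_swap: "0 < t \<Longrightarrow> distr (J t) (mu M \<Otimes>\<^sub>M mu M) (\<lambda>z. (snd z, fst z)) = J t"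
proof (rule measure_eqI)
  fix B assume t: "0 < t" and "B \<in> sets (distr (J t) (mu M \<Otimes>\<^sub>M mu M) (\<lambda>z. (snd z, fst z)))"
  then have B[measurable]: "B \<in> sets (mu M \<Otimes>\<^sub>M mu M)" by simp
  have "emeasure (distr (J t) (mu M \<Otimes>\<^sub>M mu M) (\<lambda>z. (snd z, fst z))) B
      = (\<integral>\<^sup>+z. indicator B z \<partial>distr (J t) (mu M \<Otimes>\<^sub>M mu M) (\<lambda>z. (snd z, fst z)))"
    by simp
  also have "\<dots> = (\<integral>\<^sup>+z. indicator B (snd z, fst z) \<partial>J t)"
    by (subst nn_integral_distr) auto
  also have "\<dots> = (\<integral>\<^sup>+z. ennreal (p t (fst z) (snd z)) * indicator B (snd z, fst z) \<partial>(mu M \<Otimes>\<^sub>M mu M))"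
    unfolding J_def using t by (subst nn_integral_density) auto
  also have "\<dots> = (\<integral>\<^sup>+x. \<integral>\<^sup>+y. ennreal (p t x y) * indicator B (y, x) \<partial>mu M \<partial>mu M)"
    using t by (subst mu.nn_integral_fst[symmetric]) auto
  also have "\<dots> = (\<integral>\<^sup>+x. \<integral>\<^sup>+y. ennreal (p t y x) * indicator B (y, x) \<partial>mu M \<partial>mu M)"
    using t by (intro nn_integral_cong) (simp add: p_sym)
  also have "\<dots> = (\<integral>\<^sup>+z. ennreal (p t (fst z) (snd z)) * indicator B z \<partial>(mu M \<Otimes>\<^sub>M mu M))"
    using t by (subst mumu.nn_integral_snd[symmetric]) (auto simp: case_prod_beta')
  also have "\<dots> = (\<integral>\<^sup>+z. indicator B z \<partial>J t)"
    unfolding J_def using t by (subst nn_integral_density) auto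
  finally show "emeasure (distr (J t) (mu M \<Otimes>\<^sub>M mu M) (\<lambda>z. (snd z, fst z))) B = emeasure (J t) B" by simp
qed auto

lemma distr_J_snd: assumes "0 < t" shows "distr (J t) (mu M) snd = mu M"
proof -
  have "distr (J t) (mu M) snd = distr (distr (J t) (mu M \<Otimes>\<^sub>M mu M) (\<lambda>z. (snd z, fst z))) (mu M) fst"
    by (subst distr_distr) (auto simp: comp_def)
  also have "\<dots> = mu M"
    using assms by (simp add: distr_J_swap distr_J_fst)
  finally show ?thesis .
qed

lemma integral_J_marginals:
  fixes g :: "'a \<Rightarrow> real"
  assumes "0 < t" "g \<in> borel_measurable (mu M)"
  shows "(LINT z|J t. g (fst z)) = (LINT x|mu M. g x)" "(LINT z|J t. g (snd z)) = (LINT x|mu M. g x)"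
    "integrable (J t) (\<lambda>z. g (fst z)) \<longleftrightarrow> integrable (mu M) g"
    "integrable (J t) (\<lambda>z. g (snd z)) \<longleftrightarrow> integrable (mu M) g"
  using integral_distr[of fst "J t" "mu M" g] integral_distr[of snd "J t" "mu M" g]
    integrable_distr_eq[of fst "J t" "mu M" g] integrable_distr_eq[of snd "J t" "mu M" g] assms
  by (simp_all add: distr_J_fst distr_J_snd)

lemma square_integrable_J:
  assumes "0 < t" "square_integrable (mu M) f"
  shows "square_integrable (J t) (\<lambda>z. f (fst z))" "square_integrable (J t) (\<lambda>z. f (snd z))"
  using assms integral_J_marginals(3,4)[of t "\<lambda>x. (f x)\<^sup>2"]
  by (auto simp: square_integrable_def)

lemma integral_J_product:
  assumes t: "0 < t" and f: "square_integrable (mu M) f" and g: "square_integrable (mu M) g"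
  shows "integrable (mu M) (\<lambda>x. f x * \<T> t g x)"
    and "(LINT x|mu M. f x * \<T> t g x) = (LINT z|J t. f (fst z) * g (snd z))"
proof -
  have [measurable]: "f \<in> borel_measurable (mu M)" "g \<in> borel_measurable (mu M)"
    using f g by (auto simp: square_integrable_def)
  have [measurable]: "(\<lambda>z. p t (fst z) (snd z)) \<in> borel_measurable (mu M \<Otimes>\<^sub>M mu M)"
    using t by (rule p_measurable)
  have nn: "AE z in mu M \<Otimes>\<^sub>M mu M. 0 \<le> p t (fst z) (snd z)"
    by (rule AE_I2) (use t in \<open>auto simp: space_pair_measure intro: p_nonneg\<close>)
  have "integrable (J t) (\<lambda>z. f (fst z) * g (snd z))"
    using square_integrable_J[OF t f] square_integrable_J[OF t g]
    by (intro square_integrable_integrable_mult)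
  then have int: "integrable (mu M \<Otimes>\<^sub>M mu M) (\<lambda>z. p t (fst z) (snd z) * (f (fst z) * g (snd z)))"
    unfolding J_def by (subst (asm) integrable_density) (use nn in auto)
  have eq: "(LINT y|mu M. p t x y * (f x * g y)) = f x * \<T> t g x" if "x \<in> M" for x
    using t that by (simp add: trans_op_eq mult.left_commute)
  have "integrable (mu M) (\<lambda>x. LINT y|mu M. p t x y * (f x * g y))"
    using mumu.integrable_fst'[OF int] by simp
  then show "integrable (mu M) (\<lambda>x. f x * \<T> t g x)"
    by (rule Bochner_Integration.integrable_cong[THEN iffD1, rotated -1]) (auto simp: eq)
  have "(LINT z|J t. f (fst z) * g (snd z))
      = (LINT z|(mu M \<Otimes>\<^sub>M mu M). p t (fst z) (snd z) * (f (fst z) * g (snd z)))"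
    unfolding J_def by (subst integral_density) (use nn in auto)
  also have "\<dots> = (LINT x|mu M. LINT y|mu M. p t x y * (f x * g y))"
    using mumu.integral_fst'[OF int] by simp
  also have "\<dots> = (LINT x|mu M. f x * \<T> t g x)"
    by (rule Bochner_Integration.integral_cong) (auto simp: eq)
  finally show "(LINT x|mu M. f x * \<T> t g x) = (LINT z|J t. f (fst z) * g (snd z))" ..
qed

lemma trans_op_symmetric:
  assumes t: "0 < t" and f: "square_integrable (mu M) f" and g: "square_integrable (mu M) g"
  shows "(LINT x|mu M. f x * \<T> t g x) = (LINT x|mu M. \<T> t f x * g x)"
proof -
  have [measurable]: "f \<in> borel_measurable (mu M)" "g \<in> borel_measurable (mu M)"
    using f g by (auto simp: square_integrable_def)
  have "(LINT x|mu M. f x * \<T> t g x) = (LINT z|J t. f (fst z) * g (snd z))"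
    by (rule integral_J_product[OF t f g])
  also have "\<dots> = (LINT z|distr (J t) (mu M \<Otimes>\<^sub>M mu M) (\<lambda>z. (snd z, fst z)). f (fst z) * g (snd z))"
    using t by (simp add: distr_J_swap)
  also have "\<dots> = (LINT z|J t. f (snd z) * g (fst z))"
    by (subst integral_distr) auto
  also have "\<dots> = (LINT z|J t. g (fst z) * f (snd z))"
    by (simp add: mult.commute)
  also have "\<dots> = (LINT x|mu M. g x * \<T> t f x)"
    by (rule integral_J_product(2)[OF t g f, symmetric])
  finally show ?thesis by (simp add: mult.commute)
qed

lemma AE_K_square_integrable:
  assumes t: "0 < t" and f: "square_integrable (mu M) f"
  shows "AE x in mu M. square_integrable (K t x) f"
proof -
  have [measurable]: "f \<in> borel_measurable (mu M)"
    using f by (auto simp: square_integrable_def)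
  have "integrable (J t) (\<lambda>z. (f (snd z))\<^sup>2)"
    using square_integrable_J(2)[OF t f] by (simp add: square_integrable_def)
  then have "(\<integral>\<^sup>+z. ennreal ((f (snd z))\<^sup>2) \<partial>J t) \<noteq> \<infinity>"
    by (simp add: integrable_iff_bounded)
  also have "(\<integral>\<^sup>+z. ennreal ((f (snd z))\<^sup>2) \<partial>J t) = (\<integral>\<^sup>+x. \<integral>\<^sup>+y. ennreal (p t x y) * ennreal ((f y)\<^sup>2) \<partial>mu M \<partial>mu M)"
    unfolding J_def using t by (subst nn_integral_density) (auto simp: mu.nn_integral_fst[symmetric])
  finally have "AE x in mu M. (\<integral>\<^sup>+y. ennreal (p t x y) * ennreal ((f y)\<^sup>2) \<partial>mu M) \<noteq> \<infinity>"
  proof (rule nn_integral_PInf_AE[rotated])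
    show "(\<lambda>x. \<integral>\<^sup>+y. ennreal (p t x y) * ennreal ((f y)\<^sup>2) \<partial>mu M) \<in> borel_measurable (mu M)"
      using p_measurable[OF t] by (intro mu.borel_measurable_nn_integral) (simp add: case_prod_beta')
  qed
  then show ?thesis
    using AE_space
  proof eventually_elim
    case (elim x)
    then have "(\<integral>\<^sup>+y. ennreal ((f y)\<^sup>2) \<partial>K t x) < \<infinity>"
      using t by (simp add: nn_integral_K less_top)
    then show ?case
      by (simp add: square_integrable_def integrable_iff_bounded)
  qed
qed

text \<open>Jensen's inequality for \<open>K t x\<close>, at almost every \<open>x\<close>.\<close>

lemma trans_op_square_integrable:
  assumes t: "0 < t" and f: "square_integrable (mu M) f"
  shows "square_integrable (mu M) (\<T> t f)"
    and "(LINT x|mu M. (\<T> t f x)\<^sup>2) \<le> (LINT x|mu M. (f x)\<^sup>2)"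
proof -
  have [measurable]: "f \<in> borel_measurable (mu M)"
    using f by (auto simp: square_integrable_def)
  note [measurable] = measurable_trans_op[OF t]
  have "(\<integral>\<^sup>+x. ennreal ((\<T> t f x)\<^sup>2) \<partial>mu M) \<le> (\<integral>\<^sup>+x. \<integral>\<^sup>+y. ennreal ((f y)\<^sup>2) \<partial>K t x \<partial>mu M)"
  proof (rule nn_integral_mono_AE)
    show "AE x in mu M. ennreal ((\<T> t f x)\<^sup>2) \<le> (\<integral>\<^sup>+y. ennreal ((f y)\<^sup>2) \<partial>K t x)"
      using AE_K_square_integrable[OF t f] AE_space
    proof eventually_elim
      case (elim x)
      interpret K: prob_space "K t x" using elim t by (intro prob_space_K) auto
      have "(\<T> t f x)\<^sup>2 \<le> (LINT y|K t x. (f y)\<^sup>2)"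
        using K.square_integral_le[OF elim(1)] elim t by (simp add: trans_op_K)
      also have "ennreal \<dots> = (\<integral>\<^sup>+y. ennreal ((f y)\<^sup>2) \<partial>K t x)"
        using elim(1) by (intro nn_integral_eq_integral[symmetric]) (auto simp: square_integrable_def)
      finally show ?case by (simp add: ennreal_leI)
    qed
  qed
  also have "\<dots> = (\<integral>\<^sup>+x. \<integral>\<^sup>+y. ennreal (p t x y) * ennreal ((f y)\<^sup>2) \<partial>mu M \<partial>mu M)"
    using t by (intro nn_integral_cong) (simp add: nn_integral_K)
  also have "\<dots> = (\<integral>\<^sup>+z. ennreal ((f (snd z))\<^sup>2) \<partial>J t)"
    unfolding J_def using t by (subst nn_integral_density) (auto simp: mu.nn_integral_fst[symmetric])
  also have "\<dots> = ennreal (LINT z|J t. (f (snd z))\<^sup>2)"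
    using square_integrable_J(2)[OF t f] by (intro nn_integral_eq_integral) (auto simp: square_integrable_def)
  also have "\<dots> = ennreal (LINT x|mu M. (f x)\<^sup>2)"
    using t by (simp add: integral_J_marginals(2)[of t "\<lambda>x. (f x)\<^sup>2"])
  finally have le: "(\<integral>\<^sup>+x. ennreal ((\<T> t f x)\<^sup>2) \<partial>mu M) \<le> ennreal (LINT x|mu M. (f x)\<^sup>2)" .
  then have "(\<integral>\<^sup>+x. ennreal ((\<T> t f x)\<^sup>2) \<partial>mu M) < \<infinity>"
    by (simp add: le_less_trans[OF _ ennreal_less_top])
  then have int: "integrable (mu M) (\<lambda>x. (\<T> t f x)\<^sup>2)"
    by (simp add: integrable_iff_bounded)
  then show "square_integrable (mu M) (\<T> t f)"
    by (simp add: square_integrable_def)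
  show "(LINT x|mu M. (\<T> t f x)\<^sup>2) \<le> (LINT x|mu M. (f x)\<^sup>2)"
    using le nn_integral_eq_integral[OF int] by simp
qed

text \<open>The Bochner integral that defines \<open>P\<^sub>t f x\<close> has the default value \<open>0\<close> at the points \<open>x\<close> where
  \<open>f\<close> is not integrable, hence the exceptional null set. Elsewhere the positive and negative parts
  reduce the identity to the one for nonnegative functions.\<close>

lemma trans_op_semigroup:
  assumes s: "0 < s" and t: "0 < t" and f: "square_integrable (mu M) f"
  shows "AE x in mu M. \<T> (s + t) f x = \<T> s (\<T> t f) x"
proof -
  have [measurable]: "f \<in> borel_measurable (mu M)"
    using f by (auto simp: square_integrable_def)
  have st: "0 < s + t" using s t by simp
  note [measurable] = measurable_trans_op[OF t] measurable_nn_integral_K[OF t]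
  show ?thesis
    using AE_K_square_integrable[OF st f] AE_space
  proof eventually_elim
    case (elim x)
    then have x: "x \<in> M" by simp
    interpret Kst: prob_space "K (s + t) x" using x st by (intro prob_space_K) auto
    have int: "integrable (K (s + t) x) f"
      by (rule Kst.square_integrable_integrable[OF elim(1)])
    define A where "A y = (\<integral>\<^sup>+z. ennreal (f z) \<partial>K t y)" for y
    define B where "B y = (\<integral>\<^sup>+z. ennreal (- f z) \<partial>K t y)" for y
    have [measurable]: "A \<in> borel_measurable (mu M)" "B \<in> borel_measurable (mu M)"
      unfolding A_def B_def by measurable
    have A: "(\<integral>\<^sup>+z. ennreal (f z) \<partial>K (s + t) x) = (\<integral>\<^sup>+y. A y \<partial>K s x)"
      unfolding A_def using s t x by (intro Chapman_Kolmogorov_nn) auto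
    have B: "(\<integral>\<^sup>+z. ennreal (- f z) \<partial>K (s + t) x) = (\<integral>\<^sup>+y. B y \<partial>K s x)"
      unfolding B_def using s t x by (intro Chapman_Kolmogorov_nn) auto
    have fin: "(\<integral>\<^sup>+y. A y \<partial>K s x) \<noteq> \<infinity>" "(\<integral>\<^sup>+y. B y \<partial>K s x) \<noteq> \<infinity>"
      unfolding A[symmetric] B[symmetric]
      using int by (auto simp: real_integrable_def)
    have AEf: "AE y in K s x. A y \<noteq> \<infinity>" "AE y in K s x. B y \<noteq> \<infinity>"
      by (rule nn_integral_PInf_AE[OF _ fin(1)], simp cong: measurable_cong_sets)
        (rule nn_integral_PInf_AE[OF _ fin(2)], simp cong: measurable_cong_sets)
    have intAB: "integrable (K s x) (\<lambda>y. enn2real (A y))" "integrable (K s x) (\<lambda>y. enn2real (B y))"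
      "(LINT y|K s x. enn2real (A y)) = enn2real (\<integral>\<^sup>+y. A y \<partial>K s x)"
      "(LINT y|K s x. enn2real (B y)) = enn2real (\<integral>\<^sup>+y. B y \<partial>K s x)"
    proof -
      have eqA: "(\<integral>\<^sup>+y. ennreal (enn2real (A y)) \<partial>K s x) = (\<integral>\<^sup>+y. A y \<partial>K s x)"
        using AEf(1) by (intro nn_integral_cong_AE) (auto simp: less_top)
      have eqB: "(\<integral>\<^sup>+y. ennreal (enn2real (B y)) \<partial>K s x) = (\<integral>\<^sup>+y. B y \<partial>K s x)"
        using AEf(2) by (intro nn_integral_cong_AE) (auto simp: less_top)
      show "integrable (K s x) (\<lambda>y. enn2real (A y))"
        using fin(1) eqA by (intro integrableI_nonneg) (auto simp: less_top)
      show "integrable (K s x) (\<lambda>y. enn2real (B y))"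
        using fin(2) eqB by (intro integrableI_nonneg) (auto simp: less_top)
      show "(LINT y|K s x. enn2real (A y)) = enn2real (\<integral>\<^sup>+y. A y \<partial>K s x)"
        by (subst integral_eq_nn_integral) (auto simp: eqA)
      show "(LINT y|K s x. enn2real (B y)) = enn2real (\<integral>\<^sup>+y. B y \<partial>K s x)"
        by (subst integral_eq_nn_integral) (auto simp: eqB)
    qed
    have "\<T> s (\<T> t f) x = (LINT y|K s x. \<T> t f y)"
      using s x by (intro trans_op_K) auto
    also have "\<dots> = (LINT y|K s x. enn2real (A y) - enn2real (B y))"
    proof (rule integral_cong_AE)
      show "AE y in K s x. \<T> t f y = enn2real (A y) - enn2real (B y)"
        using AEf AE_space
      proof eventually_elim
        case (elim y)
        then have y: "y \<in> M" by simp
        have "integrable (K t y) f"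
          using elim by (auto simp: real_integrable_def A_def B_def)
        then show ?case
          using y t by (simp add: trans_op_K real_lebesgue_integral_def A_def B_def)
      qed
    qed (auto cong: measurable_cong_sets)
    also have "\<dots> = enn2real (\<integral>\<^sup>+y. A y \<partial>K s x) - enn2real (\<integral>\<^sup>+y. B y \<partial>K s x)"
      using intAB by simp
    also have "\<dots> = (LINT z|K (s + t) x. f z)"
      using int by (simp add: real_lebesgue_integral_def A B)
    also have "\<dots> = \<T> (s + t) f x"
      using st x by (intro trans_op_K[symmetric]) auto
    finally show ?case ..
  qed
qed

lemma trans_op_split:
  assumes s: "0 < s" and t: "0 < t"
    and f: "square_integrable (mu M) f" and g: "square_integrable (mu M) g"
  shows "(LINT x|mu M. f x * \<T> (s + t) g x)
       = (LINT x|mu M. \<T> s f x * \<T> t g x)"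
proof -
  have [measurable]: "f \<in> borel_measurable (mu M)" "g \<in> borel_measurable (mu M)"
    using f g by (auto simp: square_integrable_def)
  note [measurable] = measurable_trans_op
  have "(LINT x|mu M. f x * \<T> (s + t) g x)
      = (LINT x|mu M. f x * \<T> s (\<T> t g) x)"
    using trans_op_semigroup[OF s t g] s t by (intro integral_cong_AE) auto
  also have "\<dots> = (LINT x|mu M. \<T> s f x * \<T> t g x)"
    by (rule trans_op_symmetric[OF s f trans_op_square_integrable(1)[OF t g]])
  finally show ?thesis .
qed

section \<open>The Dirichlet form through its approximating forms\<close>

definition nsq :: "('a \<Rightarrow> real) \<Rightarrow> real" where
  "nsq f = (LINT x|mu M. (f x)\<^sup>2)"

text \<open>The approximating form \<open>\<langle>f, f - P\<^sub>t f\<rangle> / t\<close>, written as an integral of squared increments so that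
  pointwise inequalities apply to it.\<close>

definition aform :: "real \<Rightarrow> ('a \<Rightarrow> real) \<Rightarrow> real" where
  "aform t f = (LINT z|J t. (f (fst z) - f (snd z))\<^sup>2) / (2 * t)"

lemma inner_L2_self: "inner_L2 M f f = nsq f"
  by (simp add: inner_L2_def nsq_def power2_eq_square)

lemma nsq_nonneg: "0 \<le> nsq f"
  by (simp add: nsq_def)

lemma aform_nonneg: "0 < t \<Longrightarrow> 0 \<le> aform t f"
  by (simp add: aform_def)

lemma L2_measurable: "f \<in> L2 M \<Longrightarrow> f \<in> borel_measurable (mu M)"
  by (simp add: L2_def)

lemma L2_add: "f \<in> L2 M \<Longrightarrow> g \<in> L2 M \<Longrightarrow> (\<lambda>x. f x + g x) \<in> L2 M"
  by (simp add: L2_iff square_integrable_add)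

lemma L2_diff: "f \<in> L2 M \<Longrightarrow> g \<in> L2 M \<Longrightarrow> (\<lambda>x. f x - g x) \<in> L2 M"
  by (simp add: L2_iff square_integrable_diff)

lemma L2_cmult: "f \<in> L2 M \<Longrightarrow> (\<lambda>x. c * f x) \<in> L2 M"
  by (simp add: L2_iff square_integrable_cmult)

lemma aform_integrable:
  assumes "0 < t" "f \<in> L2 M"
  shows "integrable (J t) (\<lambda>z. (f (fst z) - f (snd z))\<^sup>2)"
  using square_integrable_diff[OF square_integrable_J[of t f]] assms
  by (simp add: L2_iff square_integrable_def)

lemma aform_eq:
  assumes t: "0 < t" and f: "f \<in> L2 M"
  shows "aform t f = (nsq f - (LINT x|mu M. f x * \<T> t f x)) / t"
proof -
  have sq: "square_integrable (mu M) f" using f by (simp add: L2_iff)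
  have [measurable]: "f \<in> borel_measurable (mu M)" using f by (simp add: L2_def)
  note J = square_integrable_J[OF t sq]
  have "(LINT z|J t. (f (fst z) - f (snd z))\<^sup>2)
      = (LINT z|J t. (f (fst z))\<^sup>2 + (f (snd z))\<^sup>2 - 2 * (f (fst z) * f (snd z)))"
    by (simp add: power2_diff mult.assoc)
  also have "\<dots> = (LINT z|J t. (f (fst z))\<^sup>2) + (LINT z|J t. (f (snd z))\<^sup>2)
      - 2 * (LINT z|J t. f (fst z) * f (snd z))"
    using J square_integrable_integrable_mult[OF J] by (simp add: square_integrable_def)
  also have "\<dots> = 2 * nsq f - 2 * (LINT x|mu M. f x * \<T> t f x)"
    using t integral_J_marginals(1,2)[of t "\<lambda>x. (f x)\<^sup>2"]
    by (simp add: integral_J_product(2)[OF t sq sq] nsq_def)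
  finally show ?thesis
    using t by (simp add: aform_def field_simps)
qed

lemma aform_inner:
  assumes t: "0 < t" and f: "f \<in> L2 M"
  shows "inner_L2 M f (\<lambda>x. f x - \<T> t f x) / t = aform t f"
proof -
  have sq: "square_integrable (mu M) f" using f by (simp add: L2_iff)
  have "inner_L2 M f (\<lambda>x. f x - \<T> t f x)
      = (LINT x|mu M. (f x)\<^sup>2 - f x * \<T> t f x)"
    by (simp add: inner_L2_def power2_eq_square algebra_simps)
  also have "\<dots> = nsq f - (LINT x|mu M. f x * \<T> t f x)"
    using sq integral_J_product(1)[OF t sq sq] by (simp add: nsq_def square_integrable_def)
  finally show ?thesis by (simp add: aform_eq[OF t f])
qed

lemma nsq_diff_trans_op:
  assumes t: "0 < t" and f: "f \<in> L2 M"
  shows "nsq (\<lambda>x. f x - \<T> t f x)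
       = nsq f - 2 * (LINT x|mu M. f x * \<T> t f x) + nsq (\<T> t f)"
proof -
  have sq: "square_integrable (mu M) f" using f by (simp add: L2_iff)
  have sqP: "square_integrable (mu M) (\<T> t f)"
    by (rule trans_op_square_integrable[OF t sq])
  have "nsq (\<lambda>x. f x - \<T> t f x)
      = (LINT x|mu M. (f x)\<^sup>2 - 2 * (f x * \<T> t f x) + (\<T> t f x)\<^sup>2)"
    by (simp add: nsq_def power2_diff algebra_simps)
  also have "\<dots> = nsq f - 2 * (LINT x|mu M. f x * \<T> t f x) + nsq (\<T> t f)"
    using sq sqP integral_J_product(1)[OF t sq sq] by (simp add: nsq_def square_integrable_def)
  finally show ?thesis .
qed

text \<open>The difference of the two sides is a multiple of \<open>\<parallel>f - P\<^sub>t f\<parallel>\<^sup>2\<close>. So the form is the supremum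
  of its approximations along halved time steps.\<close>

lemma aform_double:
  assumes t: "0 < t" and f: "f \<in> L2 M"
  shows "aform (2 * t) f \<le> aform t f"
proof -
  have sq: "square_integrable (mu M) f" using f by (simp add: L2_iff)
  have "(LINT x|mu M. f x * \<T> (2 * t) f x) = nsq (\<T> t f)"
    using trans_op_split[OF t t sq sq] unfolding nsq_def power2_eq_square mult_2 .
  moreover have "0 \<le> nsq f - 2 * (LINT x|mu M. f x * \<T> t f x) + nsq (\<T> t f)"
    using nsq_diff_trans_op[OF t f] nsq_nonneg by metis
  moreover have "N - A \<le> 2 * (N - B)" if "A = Q" "0 \<le> N - 2 * B + Q" for N A B Q :: real
    using that by (simp add: right_diff_distrib)
  ultimately have "nsq f - (LINT x|mu M. f x * \<T> (2 * t) f x)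
      \<le> 2 * (nsq f - (LINT x|mu M. f x * \<T> t f x))"
    by blast
  from divide_right_mono[OF this, of "2 * t"] show ?thesis
    using t f by (simp add: aform_eq del: right_diff_distrib_numeral)
qed

lemma nsq_diff_trans_op_le:
  assumes t: "0 < t" and f: "f \<in> L2 M"
  shows "nsq (\<lambda>x. f x - \<T> t f x) \<le> 2 * t * aform t f"
proof -
  have "nsq (\<T> t f) \<le> nsq f"
    using trans_op_square_integrable(2)[OF t] f by (simp add: nsq_def L2_iff)
  then show ?thesis
    using t f by (simp add: nsq_diff_trans_op aform_eq)
qed

lemma aform_halving_mono:
  assumes t: "0 < t" and f: "f \<in> L2 M" and "m \<le> n"
  shows "aform (t / 2 ^ m) f \<le> aform (t / 2 ^ n) f"
proof (rule lift_Suc_mono_le[OF _ \<open>m \<le> n\<close>])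
  fix k
  show "aform (t / 2 ^ k) f \<le> aform (t / 2 ^ Suc k) f"
    using aform_double[of "t / 2 ^ Suc k" f] t f by simp
qed

lemma filterlim_halving: "0 < t \<Longrightarrow> filterlim (\<lambda>n. t / 2 ^ n :: real) (at_right 0) sequentially"
proof -
  assume "0 < t"
  have "(\<lambda>n. t * (1/2) ^ n) \<longlonglongrightarrow> t * 0"
    by (intro tendsto_mult tendsto_const LIMSEQ_power_zero) simp
  then show ?thesis
    using \<open>0 < t\<close> unfolding filterlim_at by (simp add: power_one_over)
qed

lemma aform_tendsto_ereal:
  assumes t: "0 < t" and f: "f \<in> L2 M"
  shows "(\<lambda>n. ereal (aform (t / 2 ^ n) f)) \<longlonglongrightarrow> (if f \<in> H1 M then ereal (\<E> f) else \<infinity>)"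
proof -
  have "(\<lambda>n. ereal (inner_L2 M f (\<lambda>x. f x - \<T> (t / 2 ^ n) f x) / (t / 2 ^ n)))
      \<longlonglongrightarrow> (if f \<in> H1 M then ereal (\<E> f) else \<infinity>)"
    by (rule filterlim_compose[OF associated[OF f] filterlim_halving[OF t]])
  then show ?thesis
    using t f by (simp only: aform_inner zero_less_divide_iff zero_less_power zero_less_numeral
        simp_thms power_strict_mono if_True)
qed

lemma H1_L2: "f \<in> H1 M \<Longrightarrow> f \<in> L2 M"
  by (simp add: H1_def)

lemma H1_measurable: "f \<in> H1 M \<Longrightarrow> f \<in> borel_measurable (mu M)"
  by (simp add: H1_def L2_def)

lemma aform_tendsto_energy:
  assumes "0 < t" "f \<in> H1 M"
  shows "(\<lambda>n. aform (t / 2 ^ n) f) \<longlonglongrightarrow> \<E> f"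
  using aform_tendsto_ereal[of t f] assms by (simp add: H1_L2)

lemma aform_le_energy:
  assumes t: "0 < t" and f: "f \<in> H1 M"
  shows "aform t f \<le> \<E> f"
proof (rule LIMSEQ_le_const[OF aform_tendsto_energy[OF t f]])
  show "\<exists>N. \<forall>n\<ge>N. aform t f \<le> aform (t / 2 ^ n) f"
    using aform_halving_mono[OF t H1_L2[OF f], of 0] by auto
qed

text \<open>Together with \<open>aform_le_energy\<close> this turns statements about \<open>H\<^sup>1\<close> and the energy into statements
  about the approximating forms; weak gradients do not occur below.\<close>

lemma H1I:
  assumes t: "0 < t" and f: "f \<in> L2 M" and C: "\<And>n. aform (t / 2 ^ n) f \<le> C"
  shows "f \<in> H1 M" "\<E> f \<le> C"
proof -
  have "(if f \<in> H1 M then ereal (\<E> f) else \<infinity>) \<le> ereal C"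
    by (rule LIMSEQ_le_const2[OF aform_tendsto_ereal[OF t f]]) (use C in auto)
  then show "f \<in> H1 M" "\<E> f \<le> C"
    by (auto split: if_splits)
qed

lemma energy_nonneg: "f \<in> H1 M \<Longrightarrow> 0 \<le> \<E> f"
  using aform_le_energy[of 1 f] aform_nonneg[of 1 f] by simp

lemma energy1_eq: "\<E>1 f = \<E> f + nsq f"
  by (simp add: energy1_def inner_L2_self)

lemma energy1_nonneg: "f \<in> H1 M \<Longrightarrow> 0 \<le> \<E>1 f"
  using energy_nonneg nsq_nonneg by (simp add: energy1_eq)

lemma nsq_le_energy1: "f \<in> H1 M \<Longrightarrow> nsq f \<le> \<E>1 f"
  using energy_nonneg by (simp add: energy1_eq)

subsection \<open>Pointwise domination\<close>

lemma aform_le_combination: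
  assumes t: "0 < t" and h: "h \<in> L2 M" and f: "f \<in> L2 M" and g: "g \<in> L2 M"
    and le: "\<And>x y. x \<in> M \<Longrightarrow> y \<in> M \<Longrightarrow> (h x - h y)\<^sup>2 \<le> a * (f x - f y)\<^sup>2 + b * (g x - g y)\<^sup>2"
  shows "aform t h \<le> a * aform t f + b * aform t g"
proof -
  have "(LINT z|J t. (h (fst z) - h (snd z))\<^sup>2)
      \<le> (LINT z|J t. a * (f (fst z) - f (snd z))\<^sup>2 + b * (g (fst z) - g (snd z))\<^sup>2)"
    using aform_integrable[OF t h] aform_integrable[OF t f] aform_integrable[OF t g] le
    by (intro integral_mono) auto
  also have "\<dots> = a * (LINT z|J t. (f (fst z) - f (snd z))\<^sup>2) + b * (LINT z|J t. (g (fst z) - g (snd z))\<^sup>2)"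
    using aform_integrable[OF t f] aform_integrable[OF t g] by simp
  finally show ?thesis
    using t by (simp add: aform_def divide_simps)
qed

lemma nsq_le_combination:
  assumes h: "h \<in> borel_measurable (mu M)" and f: "f \<in> L2 M" and g: "g \<in> L2 M"
    and le: "\<And>x. x \<in> M \<Longrightarrow> (h x)\<^sup>2 \<le> a * (f x)\<^sup>2 + b * (g x)\<^sup>2"
  shows "h \<in> L2 M" "nsq h \<le> a * nsq f + b * nsq g"
proof -
  have int: "integrable (mu M) (\<lambda>x. a * (f x)\<^sup>2 + b * (g x)\<^sup>2)"
    using f g by (simp add: L2_def)
  have "integrable (mu M) (\<lambda>x. (h x)\<^sup>2)"
  proof (rule Bochner_Integration.integrable_bound[OF int])
    show "AE x in mu M. norm ((h x)\<^sup>2) \<le> norm (a * (f x)\<^sup>2 + b * (g x)\<^sup>2)"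
      using le by (intro AE_I2) (simp add: order_trans[OF _ abs_ge_self])
  qed (use h in simp)
  then show L: "h \<in> L2 M" using h by (simp add: L2_def)
  have "nsq h \<le> (LINT x|mu M. a * (f x)\<^sup>2 + b * (g x)\<^sup>2)"
    unfolding nsq_def using L int le by (intro integral_mono) (auto simp: L2_def)
  also have "\<dots> = a * nsq f + b * nsq g"
    using f g by (simp add: L2_def nsq_def)
  finally show "nsq h \<le> a * nsq f + b * nsq g" .
qed

text \<open>Sums, multiples, contractions and maxima of functions in the form domain are all handled by
  pointwise inequalities between squared increments, through this lemma.\<close>

lemma H1_combination:
  assumes h: "h \<in> borel_measurable (mu M)" and f: "f \<in> H1 M" and g: "g \<in> H1 M"
    and ab: "0 \<le> a" "0 \<le> b"
    and le1: "\<And>x y. x \<in> M \<Longrightarrow> y \<in> M \<Longrightarrow> (h x - h y)\<^sup>2 \<le> a * (f x - f y)\<^sup>2 + b * (g x - g y)\<^sup>2"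
    and le2: "\<And>x. x \<in> M \<Longrightarrow> (h x)\<^sup>2 \<le> a * (f x)\<^sup>2 + b * (g x)\<^sup>2"
  shows "h \<in> H1 M" "\<E> h \<le> a * \<E> f + b * \<E> g"
    "nsq h \<le> a * nsq f + b * nsq g" "\<E>1 h \<le> a * \<E>1 f + b * \<E>1 g"
proof -
  note L = nsq_le_combination[OF h H1_L2[OF f] H1_L2[OF g] le2]
  have "aform (1 / 2 ^ n) h \<le> a * \<E> f + b * \<E> g" for n
  proof -
    have "aform (1 / 2 ^ n) h \<le> a * aform (1 / 2 ^ n) f + b * aform (1 / 2 ^ n) g"
      by (rule aform_le_combination) (use L f g le1 in \<open>auto simp: H1_L2\<close>)
    also have "\<dots> \<le> a * \<E> f + b * \<E> g"
      using ab f g by (intro add_mono mult_left_mono aform_le_energy) auto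
    finally show ?thesis .
  qed
  then show 1: "h \<in> H1 M" "\<E> h \<le> a * \<E> f + b * \<E> g"
    using H1I[of 1 h] L by auto
  show "nsq h \<le> a * nsq f + b * nsq g" by (rule L)
  then show "\<E>1 h \<le> a * \<E>1 f + b * \<E>1 g"
    using 1 by (simp add: energy1_eq algebra_simps)
qed

lemma power2_add_le:
  fixes x y s :: real
  assumes "0 < s"
  shows "(x + y)\<^sup>2 \<le> (1 + s) * x\<^sup>2 + (1 + 1 / s) * y\<^sup>2"
proof -
  have "0 \<le> (s * x - y)\<^sup>2 / s" using assms by simp
  also have "\<dots> = s * x\<^sup>2 - 2 * x * y + y\<^sup>2 / s"
    using assms by (simp add: power2_diff power_mult_distrib field_simps power2_eq_square)
  finally show ?thesis by (simp add: power2_sum algebra_simps)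
qed

text \<open>With \<open>s\<close> free, this serves as the triangle inequality for the seminorm \<open>\<E>\<^sup>1\<^sup>/\<^sup>2\<close>: as \<open>s\<close> tends to \<open>0\<close>, the
  first coefficient tends to \<open>1\<close>, and \<open>g\<close> is in the end sent to \<open>0\<close>.\<close>

lemma H1_add:
  assumes f: "f \<in> H1 M" and g: "g \<in> H1 M" and s: "0 < s"
  shows "(\<lambda>x. f x + g x) \<in> H1 M"
    "\<E> (\<lambda>x. f x + g x) \<le> (1 + s) * \<E> f + (1 + 1/s) * \<E> g"
    "nsq (\<lambda>x. f x + g x) \<le> (1 + s) * nsq f + (1 + 1/s) * nsq g"
    "\<E>1 (\<lambda>x. f x + g x) \<le> (1 + s) * \<E>1 f + (1 + 1/s) * \<E>1 g"
proof -
  have m: "(\<lambda>x. f x + g x) \<in> borel_measurable (mu M)"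
    using f g by (intro borel_measurable_add H1_measurable)
  have le1: "((f x + g x) - (f y + g y))\<^sup>2 \<le> (1 + s) * (f x - f y)\<^sup>2 + (1 + 1/s) * (g x - g y)\<^sup>2" for x y
    using power2_add_le[OF s, of "f x - f y" "g x - g y"] by (simp add: algebra_simps)
  note * = H1_combination[OF m f g _ _ le1 power2_add_le[OF s]]
  show "(\<lambda>x. f x + g x) \<in> H1 M"
    "\<E> (\<lambda>x. f x + g x) \<le> (1 + s) * \<E> f + (1 + 1/s) * \<E> g"
    "nsq (\<lambda>x. f x + g x) \<le> (1 + s) * nsq f + (1 + 1/s) * nsq g"
    "\<E>1 (\<lambda>x. f x + g x) \<le> (1 + s) * \<E>1 f + (1 + 1/s) * \<E>1 g"
    using * s by auto
qed

lemma H1_cmult: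
  assumes f: "f \<in> H1 M"
  shows "(\<lambda>x. c * f x) \<in> H1 M"
    "\<E> (\<lambda>x. c * f x) \<le> c\<^sup>2 * \<E> f"
    "nsq (\<lambda>x. c * f x) = c\<^sup>2 * nsq f"
    "\<E>1 (\<lambda>x. c * f x) \<le> c\<^sup>2 * \<E>1 f"
proof -
  have m: "(\<lambda>x. c * f x) \<in> borel_measurable (mu M)"
    by (intro borel_measurable_times borel_measurable_const H1_measurable f)
  have le1: "(c * f x - c * f y)\<^sup>2 \<le> c\<^sup>2 * (f x - f y)\<^sup>2 + 0 * (f x - f y)\<^sup>2" for x y
    by (simp add: right_diff_distrib[symmetric] power_mult_distrib)
  have le2: "(c * f x)\<^sup>2 \<le> c\<^sup>2 * (f x)\<^sup>2 + 0 * (f x)\<^sup>2" for x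
    by (simp add: power_mult_distrib)
  note * = H1_combination[OF m f f _ _ le1 le2]
  show "(\<lambda>x. c * f x) \<in> H1 M" "\<E> (\<lambda>x. c * f x) \<le> c\<^sup>2 * \<E> f"
    "\<E>1 (\<lambda>x. c * f x) \<le> c\<^sup>2 * \<E>1 f"
    using * by auto
  show "nsq (\<lambda>x. c * f x) = c\<^sup>2 * nsq f"
    by (simp add: nsq_def power_mult_distrib)
qed

lemma H1_diff:
  assumes f: "f \<in> H1 M" and g: "g \<in> H1 M"
  shows "(\<lambda>x. f x - g x) \<in> H1 M"
    "\<E>1 (\<lambda>x. f x - g x) \<le> 2 * \<E>1 f + 2 * \<E>1 g"
proof -
  note a = H1_add[OF f H1_cmult(1)[OF g, of "-1"], of 1]
  show "(\<lambda>x. f x - g x) \<in> H1 M" using a by simp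
  have "\<E>1 (\<lambda>x. f x - g x) \<le> 2 * \<E>1 f + 2 * \<E>1 (\<lambda>x. -1 * g x)"
    using a by simp
  also have "\<E>1 (\<lambda>x. -1 * g x) \<le> \<E>1 g"
    using H1_cmult(4)[OF g, of "-1"] by simp
  finally show "\<E>1 (\<lambda>x. f x - g x) \<le> 2 * \<E>1 f + 2 * \<E>1 g" by simp
qed

lemma energy1_diff_commute:
  assumes "f \<in> H1 M" "g \<in> H1 M"
  shows "\<E>1 (\<lambda>x. f x - g x) = \<E>1 (\<lambda>x. g x - f x)"
proof -
  have "\<E>1 (\<lambda>x. u x - v x) \<le> \<E>1 (\<lambda>x. v x - u x)" if "u \<in> H1 M" "v \<in> H1 M" for u v
    using H1_cmult(4)[OF H1_diff(1)[OF that(2,1)], of "-1"] by simp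
  then show ?thesis using assms by (intro antisym) auto
qed

lemma energy1_diff_triangle:
  assumes "f \<in> H1 M" "g \<in> H1 M" "h \<in> H1 M"
  shows "\<E>1 (\<lambda>x. f x - h x) \<le> 2 * \<E>1 (\<lambda>x. f x - g x) + 2 * \<E>1 (\<lambda>x. g x - h x)"
  using H1_add(4)[OF H1_diff(1)[OF assms(1,2)] H1_diff(1)[OF assms(2,3)], of 1] by simp

lemma H1_const: "(\<lambda>x. c) \<in> H1 M" "\<E>1 (\<lambda>x. c) \<le> c\<^sup>2"
proof -
  have L: "(\<lambda>x. c) \<in> L2 M" by (simp add: L2_def)
  have "aform (1 / 2 ^ n) (\<lambda>x. c) \<le> 0" for n by (simp add: aform_def)
  note * = H1I[OF zero_less_one L this]
  show "(\<lambda>x. c) \<in> H1 M" by (rule *)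
  show "\<E>1 (\<lambda>x. c) \<le> c\<^sup>2" using *(2) by (simp add: energy1_eq nsq_def mu.prob_space[simplified])
qed

text \<open>The Markov property of the form: normal contractions decrease squared increments.\<close>

lemma H1_contraction:
  fixes \<phi> :: "real \<Rightarrow> real"
  assumes f: "f \<in> H1 M" and meas: "\<phi> \<in> borel_measurable borel"
    and lip: "\<And>u v. \<bar>\<phi> u - \<phi> v\<bar> \<le> \<bar>u - v\<bar>" and zero: "\<phi> 0 = 0"
  shows "(\<lambda>x. \<phi> (f x)) \<in> H1 M" "\<E>1 (\<lambda>x. \<phi> (f x)) \<le> \<E>1 f"
proof -
  have m: "(\<lambda>x. \<phi> (f x)) \<in> borel_measurable (mu M)"
    using H1_measurable[OF f] meas by measurable
  have le1: "(\<phi> (f x) - \<phi> (f y))\<^sup>2 \<le> 1 * (f x - f y)\<^sup>2 + 0 * (f x - f y)\<^sup>2" for x y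
    using lip by (simp add: abs_le_square_iff)
  have le2: "(\<phi> (f x))\<^sup>2 \<le> 1 * (f x)\<^sup>2 + 0 * (f x)\<^sup>2" for x
    using lip[of "f x" 0] zero by (simp add: abs_le_square_iff)
  note * = H1_combination[OF m f f _ _ le1 le2]
  then show "(\<lambda>x. \<phi> (f x)) \<in> H1 M" "\<E>1 (\<lambda>x. \<phi> (f x)) \<le> \<E>1 f" by auto
qed

lemma H1_max:
  assumes f: "f \<in> H1 M" and g: "g \<in> H1 M"
  shows "(\<lambda>x. max (f x) (g x)) \<in> H1 M"
    "\<E>1 (\<lambda>x. max (f x) (g x)) \<le> \<E>1 f + \<E>1 g"
proof -
  have m: "(\<lambda>x. max (f x) (g x)) \<in> borel_measurable (mu M)"
    using f g by (intro borel_measurable_max H1_measurable)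
  have le1: "(max (f x) (g x) - max (f y) (g y))\<^sup>2 \<le> 1 * (f x - f y)\<^sup>2 + 1 * (g x - g y)\<^sup>2" for x y
  proof -
    have "\<bar>max (f x) (g x) - max (f y) (g y)\<bar> \<le> max \<bar>f x - f y\<bar> \<bar>g x - g y\<bar>" by auto
    then have "(max (f x) (g x) - max (f y) (g y))\<^sup>2 \<le> (max \<bar>f x - f y\<bar> \<bar>g x - g y\<bar>)\<^sup>2"
      by (simp add: abs_le_square_iff[symmetric])
    also have "\<dots> \<le> (f x - f y)\<^sup>2 + (g x - g y)\<^sup>2" by (simp add: max_def)
    finally show ?thesis by simp
  qed
  have le2: "(max (f x) (g x))\<^sup>2 \<le> 1 * (f x)\<^sup>2 + 1 * (g x)\<^sup>2" for x
    by (simp add: max_def)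
  note * = H1_combination[OF m f g _ _ le1 le2]
  then show "(\<lambda>x. max (f x) (g x)) \<in> H1 M"
    "\<E>1 (\<lambda>x. max (f x) (g x)) \<le> \<E>1 f + \<E>1 g" by auto
qed

lemma energy_parallelogram:
  assumes f: "f \<in> H1 M" and g: "g \<in> H1 M"
  shows "\<E> (\<lambda>x. f x + g x) + \<E> (\<lambda>x. f x - g x)
       = 2 * \<E> f + 2 * \<E> g"
proof -
  have sum: "(\<lambda>x. f x + g x) \<in> H1 M" by (rule H1_add[OF f g zero_less_one])
  have diff: "(\<lambda>x. f x - g x) \<in> H1 M" by (rule H1_diff[OF f g])
  have eq: "aform t (\<lambda>x. f x + g x) + aform t (\<lambda>x. f x - g x) = 2 * aform t f + 2 * aform t g" if t: "0 < t" for t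
  proof -
    note i = aform_integrable[OF t H1_L2]
    have "(LINT z|J t. (f (fst z) + g (fst z) - (f (snd z) + g (snd z)))\<^sup>2)
        + (LINT z|J t. (f (fst z) - g (fst z) - (f (snd z) - g (snd z)))\<^sup>2)
        = (LINT z|J t. (f (fst z) + g (fst z) - (f (snd z) + g (snd z)))\<^sup>2
        + (f (fst z) - g (fst z) - (f (snd z) - g (snd z)))\<^sup>2)"
      using i[OF sum] i[OF diff] by simp
    also have "\<dots> = (LINT z|J t. 2 * (f (fst z) - f (snd z))\<^sup>2 + 2 * (g (fst z) - g (snd z))\<^sup>2)"
      by (rule arg_cong[where f="integral\<^sup>L (J t)"]) (auto simp: power2_eq_square algebra_simps)
    also have "\<dots> = 2 * (LINT z|J t. (f (fst z) - f (snd z))\<^sup>2) + 2 * (LINT z|J t. (g (fst z) - g (snd z))\<^sup>2)"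
      using i[OF f] i[OF g] by simp
    finally show ?thesis using t by (simp add: aform_def field_simps)
  qed
  have "(\<lambda>n. aform (1 / 2 ^ n) (\<lambda>x. f x + g x) + aform (1 / 2 ^ n) (\<lambda>x. f x - g x))
      \<longlonglongrightarrow> \<E> (\<lambda>x. f x + g x) + \<E> (\<lambda>x. f x - g x)"
    using sum diff by (intro tendsto_add aform_tendsto_energy) auto
  moreover have "(\<lambda>n. 2 * aform (1 / 2 ^ n) f + 2 * aform (1 / 2 ^ n) g)
      \<longlonglongrightarrow> 2 * \<E> f + 2 * \<E> g"
    using f g by (intro tendsto_intros aform_tendsto_energy) auto
  ultimately show ?thesis
    using LIMSEQ_unique by (simp add: eq)
qed

lemma nsq_parallelogram:
  assumes f: "f \<in> L2 M" and g: "g \<in> L2 M"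
  shows "nsq (\<lambda>x. f x + g x) + nsq (\<lambda>x. f x - g x) = 2 * nsq f + 2 * nsq g"
proof -
  have "nsq (\<lambda>x. f x + g x) + nsq (\<lambda>x. f x - g x) = (LINT x|mu M. (f x + g x)\<^sup>2 + (f x - g x)\<^sup>2)"
    using L2_add[OF f g] L2_diff[OF f g] by (simp add: nsq_def L2_def)
  also have "\<dots> = (LINT x|mu M. 2 * (f x)\<^sup>2 + 2 * (g x)\<^sup>2)"
    by (rule arg_cong[where f="integral\<^sup>L (mu M)"]) (auto simp: power2_eq_square algebra_simps)
  also have "\<dots> = 2 * nsq f + 2 * nsq g"
    using f g by (simp add: nsq_def L2_def)
  finally show ?thesis .
qed

subsection \<open>Lower semicontinuity and completeness\<close>

lemma le_of_le_one_plus_mult: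
  fixes x c :: real
  assumes "\<And>s. 0 < s \<Longrightarrow> x \<le> (1 + s) * c"
  shows "x \<le> c"
proof (rule field_le_epsilon)
  fix e :: real assume "0 < e"
  define s where "s = e / (\<bar>c\<bar> + 1)"
  have "0 < s" using \<open>0 < e\<close> by (simp add: s_def add_nonneg_pos)
  have "s * c \<le> s * (\<bar>c\<bar> + 1)" using \<open>0 < s\<close> by (intro mult_left_mono) auto
  also have "\<dots> = e" by (simp add: s_def add_nonneg_eq_0_iff)
  finally show "x \<le> c + e" using assms[OF \<open>0 < s\<close>] by (simp add: algebra_simps)
qed

lemma nsq_add_le:
  assumes "f \<in> L2 M" "g \<in> L2 M" "0 < s"
  shows "nsq (\<lambda>x. f x + g x) \<le> (1 + s) * nsq f + (1 + 1/s) * nsq g"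
  using assms by (intro nsq_le_combination(2) power2_add_le borel_measurable_add L2_measurable)

lemma aform_le_nsq:
  assumes t: "0 < t" and f: "f \<in> L2 M"
  shows "aform t f \<le> 2 * nsq f / t"
proof -
  have sq: "square_integrable (mu M) f" using f by (simp add: L2_iff)
  have "(LINT z|J t. (f (fst z) - f (snd z))\<^sup>2) \<le> (LINT z|J t. 2 * (f (fst z))\<^sup>2 + 2 * (f (snd z))\<^sup>2)"
  proof (rule integral_mono)
    show "integrable (J t) (\<lambda>z. 2 * (f (fst z))\<^sup>2 + 2 * (f (snd z))\<^sup>2)"
      using square_integrable_J[OF t sq] by (simp add: square_integrable_def)
    fix z show "(f (fst z) - f (snd z))\<^sup>2 \<le> 2 * (f (fst z))\<^sup>2 + 2 * (f (snd z))\<^sup>2"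
      using power2_add_le[of 1 "f (fst z)" "- f (snd z)"] by simp
  qed (rule aform_integrable[OF t f])
  also have "\<dots> = 4 * nsq f"
    using square_integrable_J[OF t sq] integral_J_marginals(1,2)[of t "\<lambda>x. (f x)\<^sup>2"] t
      borel_measurable_power[OF L2_measurable[OF f], of 2]
    by (simp add: square_integrable_def nsq_def)
  finally show ?thesis using t by (simp add: aform_def field_simps)
qed

lemma nsq_limit:
  assumes f: "\<And>n. f n \<in> L2 M" and g: "g \<in> L2 M" and lim: "(\<lambda>n. nsq (\<lambda>x. f n x - g x)) \<longlonglongrightarrow> 0"
    and C: "eventually (\<lambda>n. nsq (f n) \<le> C) sequentially"
  shows "nsq g \<le> C"
proof (rule le_of_le_one_plus_mult)
  fix s :: real assume s: "0 < s"
  have sym: "nsq (\<lambda>x. g x - f n x) = nsq (\<lambda>x. f n x - g x)" for n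
    by (simp add: nsq_def power2_commute)
  have "(\<lambda>n. (1 + s) * C + (1 + 1/s) * nsq (\<lambda>x. f n x - g x)) \<longlonglongrightarrow> (1 + s) * C + (1 + 1/s) * 0"
    by (intro tendsto_intros lim)
  moreover have "eventually (\<lambda>n. nsq g \<le> (1 + s) * C + (1 + 1/s) * nsq (\<lambda>x. f n x - g x)) sequentially"
    using C
  proof eventually_elim
    case (elim n)
    have "nsq g \<le> (1 + s) * nsq (f n) + (1 + 1/s) * nsq (\<lambda>x. g x - f n x)"
      using nsq_add_le[OF f L2_diff[OF g f] s, of n n] by simp
    also have "\<dots> \<le> (1 + s) * C + (1 + 1/s) * nsq (\<lambda>x. g x - f n x)"
      using s elim by (intro add_right_mono mult_left_mono) auto
    finally show ?case by (simp add: sym)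
  qed
  ultimately show "nsq g \<le> (1 + s) * C"
    using tendsto_lowerbound[of _ _ sequentially "nsq g"] by fastforce
qed

text \<open>For fixed \<open>t\<close> the approximating form is bounded on \<open>L\<^sup>2\<close>, so it is continuous; lower
  semicontinuity of the energy follows because it is the supremum of the approximating forms.\<close>

lemma aform_limit:
  assumes t: "0 < t" and f: "\<And>n. f n \<in> L2 M" and g: "g \<in> L2 M"
    and lim: "(\<lambda>n. nsq (\<lambda>x. f n x - g x)) \<longlonglongrightarrow> 0"
    and C: "eventually (\<lambda>n. aform t (f n) \<le> C) sequentially"
  shows "aform t g \<le> C"
proof (rule le_of_le_one_plus_mult)
  fix s :: real assume s: "0 < s"
  have sym: "nsq (\<lambda>x. g x - f n x) = nsq (\<lambda>x. f n x - g x)" for n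
    by (simp add: nsq_def power2_commute)
  have "(\<lambda>n. (1 + s) * C + (1 + 1/s) * (2 * nsq (\<lambda>x. f n x - g x) / t)) \<longlonglongrightarrow> (1 + s) * C + (1 + 1/s) * (2 * 0 / t)"
    by (intro tendsto_intros lim) (use t in auto)
  moreover have "eventually (\<lambda>n. aform t g \<le> (1 + s) * C + (1 + 1/s) * (2 * nsq (\<lambda>x. f n x - g x) / t)) sequentially"
    using C
  proof eventually_elim
    case (elim n)
    have "aform t g \<le> (1 + s) * aform t (f n) + (1 + 1/s) * aform t (\<lambda>x. g x - f n x)"
    proof (rule aform_le_combination[OF t g f L2_diff[OF g f]])
      show "(g x - g y)\<^sup>2 \<le> (1 + s) * (f n x - f n y)\<^sup>2 + (1 + 1/s) * (g x - f n x - (g y - f n y))\<^sup>2" for x y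
        using power2_add_le[OF s, of "f n x - f n y" "g x - f n x - (g y - f n y)"] by simp
    qed
    also have "\<dots> \<le> (1 + s) * C + (1 + 1/s) * (2 * nsq (\<lambda>x. g x - f n x) / t)"
      using s elim aform_le_nsq[OF t L2_diff[OF g f], of n] by (intro add_mono mult_left_mono) auto
    finally show ?case by (simp add: sym)
  qed
  ultimately show "aform t g \<le> (1 + s) * C"
    using tendsto_lowerbound[of _ _ sequentially "aform t g"] by fastforce
qed

lemma energy_limit:
  assumes f: "\<And>n. f n \<in> H1 M" and g: "g \<in> L2 M"
    and lim: "(\<lambda>n. nsq (\<lambda>x. f n x - g x)) \<longlonglongrightarrow> 0"
    and C: "eventually (\<lambda>n. \<E> (f n) \<le> C) sequentially"
  shows "g \<in> H1 M" "\<E> g \<le> C"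
proof -
  have "aform (1 / 2 ^ k) g \<le> C" for k
  proof (rule aform_limit[OF _ H1_L2[OF f] g lim])
    show "eventually (\<lambda>n. aform (1 / 2 ^ k) (f n) \<le> C) sequentially"
      using C by eventually_elim (rule order_trans[OF aform_le_energy[OF _ f]], auto)
  qed simp
  then show "g \<in> H1 M" "\<E> g \<le> C"
    using H1I[OF zero_less_one g] by auto
qed

text \<open>The limit \<open>g\<close> exists in \<open>L\<^sup>2\<close>; lower semicontinuity along \<open>f\<^sub>m - f\<^sub>n\<close>, as \<open>n\<close> tends to infinity,
  bounds the energy of \<open>f\<^sub>m - g\<close>.\<close>

lemma H1_complete:
  assumes f: "\<And>n. f n \<in> H1 M"
    and Cauchy: "\<And>e. 0 < e \<Longrightarrow> \<exists>K. \<forall>m\<ge>K. \<forall>n\<ge>K. \<E>1 (\<lambda>x. f m x - f n x) < e"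
  shows "\<exists>g\<in>H1 M. (\<lambda>n. \<E>1 (\<lambda>x. f n x - g x)) \<longlonglongrightarrow> 0"
proof -
  have "\<exists>g. square_integrable (mu M) g \<and> (\<lambda>n. LINT x|mu M. (f n x - g x)\<^sup>2) \<longlonglongrightarrow> 0"
  proof (rule square_integrable_complete)
    show "square_integrable (mu M) (f n)" for n using f by (simp add: L2_iff[symmetric] H1_L2)
    fix e :: real assume "0 < e"
    then obtain K where "\<forall>m\<ge>K. \<forall>n\<ge>K. \<E>1 (\<lambda>x. f m x - f n x) < e" using Cauchy by blast
    then show "\<exists>K. \<forall>m\<ge>K. \<forall>n\<ge>K. (LINT x|mu M. (f m x - f n x)\<^sup>2) < e"
      using nsq_le_energy1[OF H1_diff(1)[OF f f]] unfolding nsq_def by (meson le_less_trans)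
  qed
  then obtain g where g: "g \<in> L2 M" and lim: "(\<lambda>n. nsq (\<lambda>x. f n x - g x)) \<longlonglongrightarrow> 0"
    by (auto simp: L2_iff nsq_def)
  have main: "(\<lambda>x. f m x - g x) \<in> H1 M \<and> \<E> (\<lambda>x. f m x - g x) \<le> e"
    if K: "\<And>n. n \<ge> K \<Longrightarrow> \<E>1 (\<lambda>x. f m x - f n x) < e" for m K e
  proof -
    have "(\<lambda>n. nsq (\<lambda>x. (f m x - f n x) - (f m x - g x))) \<longlonglongrightarrow> 0"
      using lim by (simp add: nsq_def power2_commute)
    moreover have "eventually (\<lambda>n. \<E> (\<lambda>x. f m x - f n x) \<le> e) sequentially"
    proof (rule eventually_sequentiallyI[of K])
      fix n assume "K \<le> n"
      then show "\<E> (\<lambda>x. f m x - f n x) \<le> e"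
        using K[of n] nsq_nonneg[of "\<lambda>x. f m x - f n x"] by (simp add: energy1_eq)
    qed
    ultimately show ?thesis
      using energy_limit[of "\<lambda>n x. f m x - f n x" "\<lambda>x. f m x - g x" e] H1_diff(1)[OF f f] L2_diff[OF H1_L2[OF f] g]
      by blast
  qed
  obtain K where "\<forall>m\<ge>K. \<forall>n\<ge>K. \<E>1 (\<lambda>x. f m x - f n x) < 1" using Cauchy[of 1] by auto
  then have "(\<lambda>x. f K x - g x) \<in> H1 M" using main[of K K 1] by auto
  from H1_diff(1)[OF f[of K] this] have gH: "g \<in> H1 M" by simp
  have "(\<lambda>n. \<E> (\<lambda>x. f n x - g x)) \<longlonglongrightarrow> 0"
  proof (rule LIMSEQ_I)
    fix e :: real assume "0 < e"
    then obtain K where "\<forall>m\<ge>K. \<forall>n\<ge>K. \<E>1 (\<lambda>x. f m x - f n x) < e / 2" using Cauchy[of "e/2"] by auto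
    then have "\<E> (\<lambda>x. f m x - g x) \<le> e / 2" if "K \<le> m" for m
      using main[of K m "e / 2"] that by auto
    then show "\<exists>no. \<forall>n\<ge>no. norm (\<E> (\<lambda>x. f n x - g x) - 0) < e"
      using \<open>0 < e\<close> energy_nonneg[OF H1_diff(1)[OF f gH]]
      by (intro exI[of _ K]) (fastforce simp: abs_of_nonneg)
  qed
  from tendsto_add[OF this lim] have "(\<lambda>n. \<E>1 (\<lambda>x. f n x - g x)) \<longlonglongrightarrow> 0"
    by (simp add: energy1_eq)
  with gH show ?thesis by blast
qed

section \<open>Minimization and compactness\<close>

lemma penalized_parallelogram:
  assumes f: "f \<in> H1 M" and g: "g \<in> H1 M" and v: "v \<in> L2 M" and N: "0 \<le> N"
  defines "F \<equiv> \<lambda>u. \<E> u + N * nsq (\<lambda>x. u x - v x)"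
  shows "\<E> (\<lambda>x. f x - g x) + N * nsq (\<lambda>x. f x - g x)
       \<le> 2 * F f + 2 * F g - 4 * F (\<lambda>x. (f x + g x) / 2)"
proof -
  have "\<E> (\<lambda>x. (f x + g x) / 2)
      \<le> (1/2)\<^sup>2 * \<E> (\<lambda>x. f x + g x)"
    using H1_cmult(2)[OF H1_add(1)[OF f g zero_less_one], of "1/2"] by simp
  then have mid: "4 * \<E> (\<lambda>x. (f x + g x) / 2)
      \<le> \<E> (\<lambda>x. f x + g x)"
    by (simp add: power2_eq_square)
  have "4 * nsq (\<lambda>x. (f x + g x) / 2 - v x) = nsq (\<lambda>x. 2 * ((f x + g x) / 2 - v x))"
    by (simp add: nsq_def power_mult_distrib del: right_diff_distrib_numeral)
  also have "\<dots> = nsq (\<lambda>x. (f x - v x) + (g x - v x))"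
    by (rule arg_cong[where f=nsq]) (auto simp: field_simps)
  finally have mid2: "4 * nsq (\<lambda>x. (f x + g x) / 2 - v x) = nsq (\<lambda>x. (f x - v x) + (g x - v x))" .
  have "nsq (\<lambda>x. (f x - v x) + (g x - v x)) + nsq (\<lambda>x. f x - g x)
      = 2 * nsq (\<lambda>x. f x - v x) + 2 * nsq (\<lambda>x. g x - v x)"
    using nsq_parallelogram[OF L2_diff[OF H1_L2[OF f] v] L2_diff[OF H1_L2[OF g] v]] by simp
  then have "N * nsq (\<lambda>x. f x - g x)
     = N * (2 * nsq (\<lambda>x. f x - v x) + 2 * nsq (\<lambda>x. g x - v x) - 4 * nsq (\<lambda>x. (f x + g x) / 2 - v x))"
    unfolding mid2 by (intro arg_cong[where f="(*) N"]) argo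
  then show ?thesis
    using energy_parallelogram[OF f g] mid unfolding F_def by (simp add: algebra_simps)
qed

text \<open>Near-minimizers of a strictly convex functional over a decreasing sequence of closed convex
  sets form a Cauchy sequence, by the parallelogram law, as long as the infima stay bounded; the
  limit lies in all the sets.\<close>

lemma exists_minimizer_in_Inter:
  fixes C :: "nat \<Rightarrow> ('a \<Rightarrow> real) set"
  assumes sub: "\<And>n. C n \<subseteq> H1 M" and dec: "\<And>n. C (Suc n) \<subseteq> C n"
    and mid: "\<And>n f g. f \<in> C n \<Longrightarrow> g \<in> C n \<Longrightarrow> (\<lambda>x. (f x + g x) / 2) \<in> C n"
    and closed: "\<And>n f g. (\<And>k. f k \<in> C n) \<Longrightarrow> g \<in> H1 M \<Longrightarrow>
      (\<lambda>k. \<E>1 (\<lambda>x. f k x - g x)) \<longlonglongrightarrow> 0 \<Longrightarrow> g \<in> C n"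
    and v: "v \<in> L2 M" and N: "0 < N"
    and near: "\<And>n e. 0 < e \<Longrightarrow> \<exists>g\<in>C n. \<E> g + N * nsq (\<lambda>x. g x - v x) < L + e"
  shows "\<exists>g. (\<forall>n. g \<in> C n) \<and> \<E> g + N * nsq (\<lambda>x. g x - v x) \<le> L"
proof -
  define F where "F u = \<E> u + N * nsq (\<lambda>x. u x - v x)" for u
  have F0: "0 \<le> F u" if "u \<in> H1 M" for u
    unfolding F_def using that N nsq_nonneg energy_nonneg by simp
  define m where "m n = (INF g\<in>C n. F g)" for n
  have ne: "C n \<noteq> {}" for n using near[of 1 n] by auto
  have bdd: "bdd_below (F ` C n)" for n
    using F0 sub by (intro bdd_belowI[of _ 0]) auto
  have m_le: "m n \<le> F g" if "g \<in> C n" for n g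
    unfolding m_def by (rule cINF_lower[OF bdd that])
  have mL: "m n \<le> L" for n
  proof (rule field_le_epsilon)
    fix e :: real assume "0 < e"
    then obtain g where "g \<in> C n" "F g < L + e" using near[of e n] by (auto simp: F_def)
    then show "m n \<le> L + e" using m_le[of g n] by simp
  qed
  have "incseq m"
    unfolding m_def using dec ne bdd by (intro incseq_SucI cINF_superset_mono) auto
  then obtain l where l: "m \<longlonglongrightarrow> l" "\<And>n. m n \<le> l"
    using incseq_convergent[of m L] mL by blast
  have "\<exists>g\<in>C n. F g < m n + (1/2) ^ n" for n
    using cINF_less_iff[OF ne bdd, of n "m n + (1/2) ^ n"] unfolding m_def by simp
  then obtain g where gC: "\<And>n. g n \<in> C n" and gF: "\<And>n. F (g n) < m n + (1/2) ^ n" by metis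
  have gH: "g n \<in> H1 M" for n using gC sub by blast
  have Cmono: "C k \<subseteq> C n" if "n \<le> k" for n k
    using lift_Suc_antimono_le[of C, OF dec that] .
  define \<delta> where "\<delta> n = (1 + 1 / N) * (2 * (l - m n) + 4 * (1/2) ^ n)" for n
  have dist: "\<E>1 (\<lambda>x. g n x - g k x) \<le> \<delta> n" if "n \<le> k" for n k
  proof -
    let ?d = "\<lambda>x. g n x - g k x"
    have "m n \<le> F (\<lambda>x. (g n x + g k x) / 2)"
      using mid[OF gC[of n], of "g k"] gC[of k] Cmono[OF that] by (intro m_le) auto
    moreover have "(1/2) ^ k \<le> (1/2 :: real) ^ n"
      using that by (simp add: power_decreasing)
    moreover have "\<E> ?d + N * nsq ?d \<le> 2 * F (g n) + 2 * F (g k) - 4 * F (\<lambda>x. (g n x + g k x) / 2)"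
      unfolding F_def using N by (intro penalized_parallelogram gH v) simp
    ultimately have le: "\<E> ?d + N * nsq ?d \<le> 2 * (l - m n) + 4 * (1/2) ^ n" (is "_ \<le> ?R")
      using gF[of n] gF[of k] l(2)[of k] by argo
    have "0 \<le> \<E> ?d" "0 \<le> nsq ?d"
      using gH by (auto intro: energy_nonneg H1_diff nsq_nonneg)
    then have "\<E> ?d \<le> ?R" "N * nsq ?d \<le> ?R"
      using le N by (auto intro: order_trans[rotated])
    then have "\<E> ?d + nsq ?d \<le> ?R + ?R / N"
      using N by (intro add_mono) (auto simp: field_simps)
    also have "?R + ?R / N = \<delta> n" by (simp add: \<delta>_def distrib_right)
    finally show ?thesis by (simp add: energy1_eq)
  qed
  have "\<delta> \<longlonglongrightarrow> (1 + 1 / N) * (2 * (l - l) + 4 * 0)"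
    unfolding \<delta>_def by (intro tendsto_intros l LIMSEQ_power_zero) auto
  then have \<delta>0: "\<delta> \<longlonglongrightarrow> 0" by simp
  obtain u where uH: "u \<in> H1 M" and lim: "(\<lambda>n. \<E>1 (\<lambda>x. g n x - u x)) \<longlonglongrightarrow> 0"
  proof -
    have "\<exists>K. \<forall>m\<ge>K. \<forall>n\<ge>K. \<E>1 (\<lambda>x. g m x - g n x) < e" if "0 < e" for e
    proof -
      obtain K where K: "\<And>n. K \<le> n \<Longrightarrow> \<delta> n < e"
        using order_tendstoD(2)[OF \<delta>0 \<open>0 < e\<close>] by (auto simp: eventually_sequentially)
      have "\<E>1 (\<lambda>x. g m x - g n x) < e" if "K \<le> m" "K \<le> n" for m n
      proof (cases "m \<le> n")
        case True
        then show ?thesis using dist[OF True] K[OF \<open>K \<le> m\<close>] by simp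
      next
        case False
        then show ?thesis
          using dist[of n m] K[OF \<open>K \<le> n\<close>] energy1_diff_commute[OF gH[of m] gH[of n]] by simp
      qed
      then show ?thesis by blast
    qed
    from H1_complete[of g, OF gH this] show thesis using that by auto
  qed
  have "u \<in> C n" for n
  proof (rule closed)
    show "g (k + n) \<in> C n" for k using gC[of "k + n"] Cmono[of n "k + n"] by auto
    show "(\<lambda>k. \<E>1 (\<lambda>x. g (k + n) x - u x)) \<longlonglongrightarrow> 0" using lim by (rule LIMSEQ_ignore_initial_segment)
  qed (rule uH)
  moreover have "F u \<le> L"
  proof (rule le_of_le_one_plus_mult)
    fix s :: real assume s: "0 < s"
    have le: "F u \<le> (1 + s) * (L + (1/2) ^ n) + (1 + 1/s) * ((1 + N) * \<E>1 (\<lambda>x. g n x - u x))" for n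
    proof -
      let ?d = "\<lambda>x. u x - g n x"
      have d: "?d \<in> H1 M" by (intro H1_diff uH gH)
      have 1: "\<E> u \<le> (1 + s) * \<E> (g n) + (1 + 1/s) * \<E> ?d"
        using H1_add(2)[OF gH d s, of n] by simp
      have "nsq (\<lambda>x. u x - v x) \<le> (1 + s) * nsq (\<lambda>x. g n x - v x) + (1 + 1/s) * nsq ?d"
        using nsq_add_le[OF L2_diff[OF H1_L2[OF gH] v] H1_L2[OF d] s, of n] by simp
      then have 2: "N * nsq (\<lambda>x. u x - v x) \<le> N * ((1 + s) * nsq (\<lambda>x. g n x - v x) + (1 + 1/s) * nsq ?d)"
        using N by (intro mult_left_mono) auto
      have "F u \<le> (1 + s) * F (g n) + (1 + 1/s) * (\<E> ?d + N * nsq ?d)"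
        using add_mono[OF 1 2] unfolding F_def by (simp add: algebra_simps)
      also have "\<dots> \<le> (1 + s) * (L + (1/2) ^ n) + (1 + 1/s) * ((1 + N) * \<E>1 ?d)"
      proof (intro add_mono mult_left_mono)
        show "F (g n) \<le> L + (1/2) ^ n" using gF[of n] mL[of n] by simp
        have "0 \<le> \<E> ?d" "0 \<le> nsq ?d"
          using d by (auto intro: energy_nonneg nsq_nonneg)
        then show "\<E> ?d + N * nsq ?d \<le> (1 + N) * \<E>1 ?d"
          using N by (simp add: energy1_eq algebra_simps)
      qed (use s in auto)
      finally show ?thesis using energy1_diff_commute[OF uH gH[of n]] by simp
    qed
    have "(\<lambda>n. (1 + s) * (L + (1/2) ^ n) + (1 + 1/s) * ((1 + N) * \<E>1 (\<lambda>x. g n x - u x)))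
        \<longlonglongrightarrow> (1 + s) * (L + 0) + (1 + 1/s) * ((1 + N) * 0)"
      by (intro tendsto_intros lim LIMSEQ_power_zero) auto
    from LIMSEQ_le_const[OF this] le show "F u \<le> (1 + s) * L" by auto
  qed
  ultimately show ?thesis unfolding F_def by blast
qed

text \<open>\<open>P\<^sub>s\<close> is compact and \<open>\<parallel>f - P\<^sub>s f\<parallel>\<^sup>2 \<le> 2 s \<E>\<^sub>s(f)\<close> is uniformly small, so a sequence along which
  the approximating forms stay bounded is totally bounded.\<close>

lemma L2_compactness:
  fixes f :: "nat \<Rightarrow> 'a \<Rightarrow> real"
  assumes f: "\<And>k. f k \<in> L2 M" and B: "\<And>k. nsq (f k) \<le> B" and h: "0 < h"
    and C: "\<And>j k. j \<le> k \<Longrightarrow> aform (h / 2 ^ j) (f k) \<le> C"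
  shows "\<exists>r g. strict_mono r \<and> g \<in> L2 M \<and> (\<lambda>n. nsq (\<lambda>x. f (r n) x - g x)) \<longlonglongrightarrow> 0"
proof -
  define Q where "Q j s \<longleftrightarrow> (\<exists>g\<in>L2 M. (\<lambda>n. nsq (\<lambda>x. \<T> (h / 2 ^ j) (f (s n)) x - g x)) \<longlonglongrightarrow> 0)"
    for j :: nat and s :: "nat \<Rightarrow> nat"
  have "\<exists>r. strict_mono r \<and> Q j (s \<circ> r)" for j and s :: "nat \<Rightarrow> nat"
    using compact_semigroup[of "h / 2 ^ j" "\<lambda>n. f (s n)" B] f B h
    unfolding Q_def by (auto simp: inner_L2_self nsq_def)
  then interpret subseqs Q by unfold_locales auto
  have diag: "Q j (diagseq \<circ> (+) (Suc j))" for j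
  proof (rule diagseq_holds)
    fix n :: nat and s r :: "nat \<Rightarrow> nat" assume r: "strict_mono r" and "Q n s"
    then obtain g where "g \<in> L2 M" "(\<lambda>k. nsq (\<lambda>x. \<T> (h / 2 ^ n) (f (s k)) x - g x)) \<longlonglongrightarrow> 0"
      by (auto simp: Q_def)
    then show "Q n (s \<circ> r)"
      using LIMSEQ_subseq_LIMSEQ[OF _ r] unfolding Q_def comp_def by fast
  qed
  have "0 \<le> C" using C[of 0 0] aform_nonneg[OF h, of "f 0"] by simp
  have "\<exists>K. \<forall>m\<ge>K. \<forall>n\<ge>K. nsq (\<lambda>x. f (diagseq m) x - f (diagseq n) x) < e" if e: "0 < e" for e
  proof -
    have "(\<lambda>j. 12 * C * (h * (1/2) ^ j)) \<longlonglongrightarrow> 12 * C * (h * 0)"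
      by (intro tendsto_intros LIMSEQ_power_zero) auto
    then have "eventually (\<lambda>j. 12 * C * (h * (1/2) ^ j) < e / 2) sequentially"
      using e by (intro order_tendstoD) auto
    then obtain j where j: "12 * C * (h / 2 ^ j) < e / 2"
      by (auto simp: eventually_sequentially power_one_over)
    define t where "t = h / 2 ^ j"
    have t: "0 < t" using h by (simp add: t_def)
    let ?P = "\<T> t"
    have PL: "?P (f k) \<in> L2 M" for k
      using trans_op_square_integrable(1)[OF t] f by (simp add: L2_iff)
    have fP: "nsq (\<lambda>x. f k x - ?P (f k) x) \<le> 2 * t * C" if "j \<le> k" for k
    proof -
      have "nsq (\<lambda>x. f k x - ?P (f k) x) \<le> 2 * t * aform t (f k)"
        by (rule nsq_diff_trans_op_le[OF t f])
      also have "\<dots> \<le> 2 * t * C"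
        using C[OF that] t by (intro mult_left_mono) (auto simp: t_def)
      finally show ?thesis .
    qed
    obtain g where g: "g \<in> L2 M" and "(\<lambda>n. nsq (\<lambda>x. ?P (f (diagseq (Suc j + n))) x - g x)) \<longlonglongrightarrow> 0"
      using diag[of j] by (auto simp: Q_def t_def)
    from order_tendstoD(2)[OF this(2), of "e / 32"] e
    obtain K where K: "\<And>n. K \<le> n \<Longrightarrow> nsq (\<lambda>x. ?P (f (diagseq (Suc j + n))) x - g x) < e / 32"
      by (auto simp: eventually_sequentially)
    have Pg: "nsq (\<lambda>x. ?P (f (diagseq m)) x - g x) < e / 32" if "Suc j + K \<le> m" for m
      using K[of "m - Suc j"] that by simp
    have dj: "j \<le> diagseq m" if "Suc j + K \<le> m" for m
      using seq_suble[OF subseq_diagseq, of m] that by simp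
    have sym: "nsq (\<lambda>x. u x - w x) = nsq (\<lambda>x. w x - u x)" for u w
      by (simp add: nsq_def power2_commute)
    have tri: "nsq (\<lambda>x. u x - w x) \<le> 2 * nsq (\<lambda>x. u x - z x) + 2 * nsq (\<lambda>x. z x - w x)"
      if "u \<in> L2 M" "w \<in> L2 M" "z \<in> L2 M" for u w z
      using nsq_add_le[OF L2_diff[OF that(1,3)] L2_diff[OF that(3,2)], of 1] by simp
    have "nsq (\<lambda>x. f (diagseq m) x - f (diagseq n) x) < e"
      if mn: "Suc j + K \<le> m" "Suc j + K \<le> n" for m n
    proof -
      let ?a = "f (diagseq m)" and ?b = "f (diagseq n)"
      have "nsq (\<lambda>x. ?a x - ?b x) \<le> 2 * nsq (\<lambda>x. ?a x - ?P ?a x) + 2 * nsq (\<lambda>x. ?P ?a x - ?b x)"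
        by (rule tri[OF f f PL])
      moreover have "nsq (\<lambda>x. ?P ?a x - ?b x) \<le> 2 * nsq (\<lambda>x. ?P ?a x - ?P ?b x) + 2 * nsq (\<lambda>x. ?P ?b x - ?b x)"
        by (rule tri[OF PL f PL])
      moreover have "nsq (\<lambda>x. ?P ?a x - ?P ?b x) \<le> 2 * nsq (\<lambda>x. ?P ?a x - g x) + 2 * nsq (\<lambda>x. g x - ?P ?b x)"
        by (rule tri[OF PL PL g])
      moreover have "nsq (\<lambda>x. ?a x - ?P ?a x) \<le> 2 * t * C" "nsq (\<lambda>x. ?P ?b x - ?b x) \<le> 2 * t * C"
        using fP[OF dj[OF mn(1)]] fP[OF dj[OF mn(2)]] sym[of ?b "?P ?b"] by auto
      moreover have "nsq (\<lambda>x. ?P ?a x - g x) < e / 32" "nsq (\<lambda>x. g x - ?P ?b x) < e / 32"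
        using Pg mn sym[of g] by auto
      moreover have "12 * C * t < e / 2" using j by (simp add: t_def)
      ultimately show ?thesis by (simp add: algebra_simps)
    qed
    then show ?thesis by blast
  qed
  then have "\<exists>g. square_integrable (mu M) g \<and> (\<lambda>n. LINT x|mu M. (f (diagseq n) x - g x)\<^sup>2) \<longlonglongrightarrow> 0"
    using f by (intro square_integrable_complete) (auto simp: L2_iff nsq_def)
  then show ?thesis
    using subseq_diagseq by (auto simp: L2_iff nsq_def)
qed

section \<open>Capacity\<close>

lemma capacity_less_iff:
  "Cap A < ereal c \<longleftrightarrow> (\<exists>G f. relopen G \<and> A \<subseteq> G \<and> f \<in> H1 M \<and>
     (AE x in mu M. x \<in> G \<longrightarrow> 1 \<le> f x) \<and> \<E>1 f < c)"
  unfolding capacity_def open_capacity_def INF_less_iff by auto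

lemma capacity_leI:
  assumes "relopen G" "A \<subseteq> G" "f \<in> H1 M" "AE x in mu M. x \<in> G \<longrightarrow> 1 \<le> f x"
  shows "Cap A \<le> ereal (\<E>1 f)"
  unfolding capacity_def open_capacity_def
  by (rule INF_lower2[of G], use assms in simp, rule INF_lower2[of f]) (use assms in auto)

text \<open>Truncation to \<open>[0, 1]\<close> is a normal contraction. It keeps the supremum of countably many
  witnesses finite.\<close>

lemma capacity_lessE:
  assumes "Cap A < ereal c"
  obtains G f where "relopen G" "A \<subseteq> G" "f \<in> H1 M" "\<And>x. 0 \<le> f x" "\<And>x. f x \<le> 1"
    "AE x in mu M. x \<in> G \<longrightarrow> 1 \<le> f x" "\<E>1 f < c"
proof -
  obtain G f where G: "relopen G" "A \<subseteq> G" "f \<in> H1 M"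
    "AE x in mu M. x \<in> G \<longrightarrow> 1 \<le> f x" "\<E>1 f < c"
    using assms unfolding capacity_less_iff by auto
  define \<phi> :: "real \<Rightarrow> real" where "\<phi> u = max 0 (min 1 u)" for u
  have *: "(\<lambda>x. \<phi> (f x)) \<in> H1 M" "\<E>1 (\<lambda>x. \<phi> (f x)) \<le> \<E>1 f"
    by (rule H1_contraction[OF G(3)]; auto simp: \<phi>_def)+
  have "AE x in mu M. x \<in> G \<longrightarrow> 1 \<le> \<phi> (f x)"
    using G(4) by eventually_elim (auto simp: \<phi>_def)
  then show thesis
    by (intro that[of G "\<lambda>x. \<phi> (f x)"]) (use G * in \<open>auto simp: \<phi>_def\<close>)
qed

lemma capacity_mono: "A \<subseteq> B \<Longrightarrow> Cap A \<le> Cap B"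
  unfolding capacity_def by (rule INF_superset_mono) auto

lemma capacity_nonneg: "0 \<le> Cap A"
  unfolding capacity_def open_capacity_def
  by (intro INF_greatest) (auto intro: energy1_nonneg)

lemma capacity_le_1: "A \<subseteq> M \<Longrightarrow> Cap A \<le> 1"
proof -
  assume "A \<subseteq> M"
  then have "Cap A \<le> ereal (\<E>1 (\<lambda>x. 1))"
    by (intro capacity_leI[of M]) (auto simp: H1_const)
  also have "\<dots> \<le> 1" using H1_const(2)[of 1] by simp
  finally show ?thesis .
qed

lemma capacity_empty: "Cap {} = 0"
proof (rule antisym)
  have "Cap {} \<le> ereal (\<E>1 (\<lambda>x. 0))"
    by (intro capacity_leI[of "{}"]) (auto simp: H1_const)
  also have "\<dots> \<le> 0" using H1_const(2)[of 0] by simp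
  finally show "Cap {} \<le> 0" .
qed (rule capacity_nonneg)

lemma capacity_zeroI:
  assumes "\<And>e. 0 < e \<Longrightarrow> Cap A \<le> ereal e"
  shows "Cap A = 0"
proof (rule antisym)
  show "Cap A \<le> 0"
    by (rule ereal_le_epsilon2) (use assms in auto)
qed (rule capacity_nonneg)

lemma capacity_Un:
  assumes "Cap A < ereal a" "Cap B < ereal b"
  shows "Cap (A \<union> B) < ereal (a + b)"
proof -
  obtain G f where G: "relopen G" "A \<subseteq> G" "f \<in> H1 M"
    "AE x in mu M. x \<in> G \<longrightarrow> 1 \<le> f x" "\<E>1 f < a"
    using assms(1) unfolding capacity_less_iff by auto
  obtain H h where H: "relopen H" "B \<subseteq> H" "h \<in> H1 M"
    "AE x in mu M. x \<in> H \<longrightarrow> 1 \<le> h x" "\<E>1 h < b"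
    using assms(2) unfolding capacity_less_iff by auto
  have "AE x in mu M. x \<in> G \<union> H \<longrightarrow> 1 \<le> max (f x) (h x)"
    using G(4) H(4) by eventually_elim auto
  moreover have "\<E>1 (\<lambda>x. max (f x) (h x)) < a + b"
    using H1_max(2)[OF G(3) H(3)] G(5) H(5) by simp
  moreover have "relopen (G \<union> H)" "A \<union> B \<subseteq> G \<union> H"
    using G H by auto
  ultimately show ?thesis
    unfolding capacity_less_iff using H1_max(1)[OF G(3) H(3)] by blast
qed

text \<open>The supremum of the witnesses is a witness for the union: the energy of a maximum is at most the
  sum of the energies, and bounded increasing limits preserve the bound.\<close>

lemma capacity_countable_union:
  assumes cap: "\<And>n. Cap (A n) < ereal (\<epsilon> n)" and sums: "\<epsilon> sums e"
  shows "Cap (\<Union>n. A n) \<le> ereal e"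
proof -
  define W where "W n G f \<longleftrightarrow> relopen G \<and> A n \<subseteq> G \<and> f \<in> H1 M \<and>
      (\<forall>x. 0 \<le> f x) \<and> (\<forall>x. f x \<le> 1) \<and>
      (AE x in mu M. x \<in> G \<longrightarrow> 1 \<le> f x) \<and> \<E>1 f < \<epsilon> n" for n G f
  have "\<forall>n. \<exists>G f. W n G f"
    unfolding W_def by (intro allI, rule capacity_lessE[OF cap], blast)
  then obtain G f where Wn: "\<And>n. W n (G n) (f n)" by metis
  then have G: "\<And>n. relopen (G n)" "\<And>n. A n \<subseteq> G n"
    and f: "\<And>n. f n \<in> H1 M" "\<And>n x. 0 \<le> f n x" "\<And>n x. f n x \<le> 1"
      "\<And>n. AE x in mu M. x \<in> G n \<longrightarrow> 1 \<le> f n x" "\<And>n. \<E>1 (f n) < \<epsilon> n"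
    by (auto simp: W_def)
  define h where "h = rec_nat (f 0) (\<lambda>n u x. max (u x) (f (Suc n) x))"
  have h0: "h 0 = f 0" and hS: "h (Suc n) = (\<lambda>x. max (h n x) (f (Suc n) x))" for n
    by (simp_all add: h_def)
  have hH: "h n \<in> H1 M \<and> \<E>1 (h n) \<le> (\<Sum>i\<le>n. \<epsilon> i)" for n
  proof (induction n)
    case 0
    then show ?case using f(1)[of 0] f(5)[of 0] by (simp add: h0)
  next
    case (Suc n)
    then show ?case
      using H1_max[of "h n" "f (Suc n)"] f(1)[of "Suc n"] f(5)[of "Suc n"] by (simp add: hS)
  qed
  have \<epsilon>0: "0 \<le> \<epsilon> n" for n
    using energy1_nonneg[OF f(1)[of n]] f(5)[of n] by simp
  have he: "\<E>1 (h n) \<le> e" for n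
  proof -
    have "(\<Sum>i\<le>n. \<epsilon> i) \<le> e"
      using sum_le_suminf[of \<epsilon> "{..n}"] sums \<epsilon>0 by (simp add: sums_iff)
    then show ?thesis using hH[of n] by simp
  qed
  have h01: "0 \<le> h n x \<and> h n x \<le> 1" for n x
    by (induction n) (auto simp: h0 hS f(2,3) max_def)
  have hinc: "incseq (\<lambda>n. h n x)" for x
    by (rule incseq_SucI) (simp add: hS)
  define u where "u x = (SUP n. h n x)" for x
  have lim: "(\<lambda>n. h n x) \<longlonglongrightarrow> u x" for x
    unfolding u_def by (rule LIMSEQ_incseq_SUP[OF _ hinc]) (use h01 in \<open>auto intro!: bdd_aboveI[of _ 1]\<close>)
  have hu: "h n x \<le> u x" for n x
    by (rule incseq_le[OF hinc lim])
  have fh: "f n x \<le> h n x" for n x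
    by (cases n) (auto simp: h0 hS)
  have u01: "0 \<le> u x \<and> u x \<le> 1" for x
    using LIMSEQ_le_const[OF lim, of 0] LIMSEQ_le_const2[OF lim, of x 1] h01 by auto
  have [measurable]: "h n \<in> borel_measurable (mu M)" for n
    using hH by (auto intro: H1_measurable)
  have [measurable]: "u \<in> borel_measurable (mu M)"
    by (rule borel_measurable_LIMSEQ_real[of _ h]) (use lim in auto)
  have uL: "u \<in> L2 M"
    unfolding L2_def using u01
    by (auto intro!: mu.integrable_const_bound[of _ 1] simp: abs_square_le_1)
  have nsq0: "(\<lambda>n. nsq (\<lambda>x. h n x - u x)) \<longlonglongrightarrow> 0"
  proof -
    have "(\<lambda>n. LINT x|mu M. (h n x - u x)\<^sup>2) \<longlonglongrightarrow> (LINT x|mu M. 0)"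
    proof (rule integral_dominated_convergence[where w="\<lambda>_. 1"])
      have "(\<lambda>n. (h n x - u x)\<^sup>2) \<longlonglongrightarrow> (u x - u x)\<^sup>2" for x
        by (intro tendsto_intros lim)
      then show "AE x in mu M. (\<lambda>n. (h n x - u x)\<^sup>2) \<longlonglongrightarrow> 0" by simp
      have "\<bar>h n x - u x\<bar> \<le> 1" for n x using h01[of n x] u01[of x] by (auto simp: abs_le_iff)
      then show "AE x in mu M. norm ((h n x - u x)\<^sup>2) \<le> 1" for n by (simp add: abs_square_le_1)
    qed auto
    then show ?thesis by (simp add: nsq_def)
  qed
  have uE: "u \<in> H1 M \<and> \<E> u \<le> e - nsq (h m)" for m
  proof -
    have "eventually (\<lambda>n. \<E> (h n) \<le> e - nsq (h m)) sequentially"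
    proof (rule eventually_sequentiallyI[of m])
      fix n assume "m \<le> n"
      have "nsq (h m) \<le> nsq (h n)"
        unfolding nsq_def using hH[of m] hH[of n] h01 incseqD[OF hinc \<open>m \<le> n\<close>]
        by (intro integral_mono power_mono) (auto dest: H1_L2 simp: L2_def)
      then show "\<E> (h n) \<le> e - nsq (h m)"
        using he[of n] by (simp add: energy1_eq)
    qed
    then show ?thesis
      using energy_limit[OF _ uL nsq0] hH by blast
  qed
  have "nsq u \<le> e - \<E> u"
    by (rule nsq_limit[OF _ uL nsq0]) (use uE hH in \<open>auto intro: H1_L2 simp: algebra_simps\<close>)
  then have ue: "\<E>1 u \<le> e" by (simp add: energy1_eq)
  have "AE x in mu M. x \<in> (\<Union>n. G n) \<longrightarrow> 1 \<le> u x"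
  proof -
    have "AE x in mu M. \<forall>n. x \<in> G n \<longrightarrow> 1 \<le> f n x"
      unfolding AE_all_countable using f(4) by simp
    then show ?thesis
      by eventually_elim (meson UN_E fh hu order_trans)
  qed
  then have "Cap (\<Union>n. A n) \<le> ereal (\<E>1 u)"
    using G uE by (intro capacity_leI[of "\<Union>n. G n"]) auto
  also have "\<dots> \<le> ereal e" using ue by simp
  finally show ?thesis .
qed

lemma openin_sets_mu: "relopen G \<Longrightarrow> G \<in> sets (mu M)"
  by (rule sets_muI) (auto simp: openin_open intro!: sets.Int)

lemma capacity_zero_AE:
  assumes "Cap A = 0"
  shows "AE x in mu M. x \<notin> A"
proof -
  have "\<exists>G\<in>sets (mu M). A \<subseteq> G \<and> measure (mu M) G \<le> (1/2) ^ n" for n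
  proof -
    have "Cap A < ereal ((1/2) ^ n)" using assms by simp
    then obtain G f where G: "relopen G" "A \<subseteq> G" "f \<in> H1 M" "\<And>x. 0 \<le> f x"
      "AE x in mu M. x \<in> G \<longrightarrow> 1 \<le> f x" "\<E>1 f < (1/2) ^ n"
      by (rule capacity_lessE) blast
    have Gs[measurable]: "G \<in> sets (mu M)" by (rule openin_sets_mu[OF G(1)])
    have "G \<inter> M = G" using openin_imp_subset[OF G(1)] by auto
    then have "measure (mu M) G = (LINT x|mu M. indicator G x)" by simp
    also have "\<dots> \<le> nsq f"
      unfolding nsq_def
    proof (rule integral_mono_AE)
      show "AE x in mu M. indicator G x \<le> (f x)\<^sup>2"
        using G(5) by eventually_elim (auto split: split_indicator simp: one_le_power)
      show "integrable (mu M) (\<lambda>x. (f x)\<^sup>2)" using H1_L2[OF G(3)] by (simp add: L2_def)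
    qed (auto simp: less_top[symmetric])
    also have "\<dots> \<le> (1/2) ^ n" using nsq_le_energy1[OF G(3)] G(6) by simp
    finally show ?thesis using G Gs by auto
  qed
  then obtain G where G: "\<And>n. G n \<in> sets (mu M)" "\<And>n. A \<subseteq> G n" "\<And>n. measure (mu M) (G n) \<le> (1/2) ^ n"
    by metis
  have le: "measure (mu M) (\<Inter>n. G n) \<le> (1/2) ^ n" for n
    using mu.finite_measure_mono[of "\<Inter>n. G n" "G n"] G by (meson INF_lower UNIV_I order_trans)
  have "measure (mu M) (\<Inter>n. G n) \<le> 0"
    by (rule LIMSEQ_le_const[OF LIMSEQ_power_zero[of "1/2::real"]]) (use le in auto)
  then have "measure (mu M) (\<Inter>n. G n) = 0" using measure_nonneg[of "mu M" "\<Inter>n. G n"] by linarith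
  then have "(\<Inter>n. G n) \<in> null_sets (mu M)"
    using G by (intro null_setsI) (auto simp: mu.emeasure_eq_measure)
  then have "AE x in mu M. x \<notin> (\<Inter>n. G n)" by (rule AE_not_in)
  then show ?thesis by (rule eventually_mono) (use G(2) in auto)
qed

lemma capacity_zero_countable_union:
  fixes A :: "nat \<Rightarrow> 'a set"
  assumes "\<And>n. Cap (A n) = 0"
  shows "Cap (\<Union>n. A n) = 0"
proof (rule capacity_zeroI)
  fix e :: real assume "0 < e"
  show "Cap (\<Union>n. A n) \<le> ereal e"
  proof (rule capacity_countable_union)
    have "(\<lambda>n. e * (1/2) ^ Suc n) sums (e * 1)"
      by (intro sums_mult power_half_series)
    then show "(\<lambda>n. e * (1/2) ^ Suc n) sums e" by simp
    show "Cap (A n) < ereal (e * (1/2) ^ Suc n)" for n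
      using assms \<open>0 < e\<close> by simp
  qed
qed

subsection \<open>Quasi-everywhere and quasi-continuity\<close>

lemma quasi_everywhere_on_mono:
  assumes "qe A Q" "B \<subseteq> A" "\<And>x. x \<in> B \<Longrightarrow> Q x \<Longrightarrow> R x"
  shows "qe B R"
proof -
  have "Cap {x \<in> B. \<not> R x} \<le> Cap {x \<in> A. \<not> Q x}"
    by (rule capacity_mono) (use assms in auto)
  then show ?thesis
    using assms(1) capacity_nonneg[of "{x \<in> B. \<not> R x}"] by (simp add: quasi_everywhere_on_def)
qed

lemma quasi_everywhere_on_UN:
  fixes A :: "nat \<Rightarrow> 'a set"
  assumes "\<And>n. qe (A n) Q"
  shows "qe (\<Union>n. A n) Q"
proof -
  have "{x \<in> (\<Union>n. A n). \<not> Q x} = (\<Union>n. {x \<in> A n. \<not> Q x})" by auto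
  then show ?thesis
    using capacity_zero_countable_union[of "\<lambda>n. {x \<in> A n. \<not> Q x}"] assms
    by (simp add: quasi_everywhere_on_def)
qed

lemma quasi_everywhere_on_all:
  fixes Q :: "nat \<Rightarrow> 'a \<Rightarrow> bool"
  assumes "\<And>n. qe A (Q n)"
  shows "qe A (\<lambda>x. \<forall>n. Q n x)"
proof -
  have "{x \<in> A. \<not> (\<forall>n. Q n x)} = (\<Union>n. {x \<in> A. \<not> Q n x})" by auto
  then show ?thesis
    using capacity_zero_countable_union[of "\<lambda>n. {x \<in> A. \<not> Q n x}"] assms
    by (simp add: quasi_everywhere_on_def)
qed

lemma quasi_everywhere_on_conj:
  assumes "qe A Q" "qe A R"
  shows "qe A (\<lambda>x. Q x \<and> R x)"
proof -
  have "qe A (\<lambda>x. \<forall>n::nat. (if n = 0 then Q x else R x))"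
  proof (rule quasi_everywhere_on_all)
    show "qe A (\<lambda>x. if n = 0 then Q x else R x)" for n :: nat
      using assms by (cases "n = 0") simp_all
  qed
  then show ?thesis
  proof (rule quasi_everywhere_on_mono)
    fix x assume "\<forall>n::nat. (if n = 0 then Q x else R x)"
    then show "Q x \<and> R x" by (metis zero_neq_one)
  qed simp
qed

lemma quasi_everywhere_onI: "(\<And>x. x \<in> A \<Longrightarrow> Q x) \<Longrightarrow> qe A Q"
  by (simp add: quasi_everywhere_on_def capacity_empty cong: conj_cong)

lemma quasi_everywhere_AE:
  "qe M Q \<Longrightarrow> AE x in mu M. Q x"
  using capacity_zero_AE[of "{x \<in> M. \<not> Q x}"] AE_space[of "mu M"]
  by (auto simp: quasi_everywhere_on_def elim: eventually_elim2)

lemma quasi_continuousE: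
  assumes "quasi_continuous M f" "0 < \<epsilon>"
  obtains G where "relopen G" "Cap G < ereal \<epsilon>" "continuous_on (M - G) f"
  using assms unfolding quasi_continuous_def by blast

lemma continuous_imp_quasi_continuous: "continuous_on M f \<Longrightarrow> quasi_continuous M f"
  unfolding quasi_continuous_def by (auto intro!: exI[of _ "{}"] simp: capacity_empty)

lemma quasi_continuous_compose2:
  fixes \<phi> :: "real \<Rightarrow> real \<Rightarrow> real"
  assumes f: "quasi_continuous M f" and g: "quasi_continuous M g"
    and cont: "continuous_on UNIV (\<lambda>z. \<phi> (fst z) (snd z))"
  shows "quasi_continuous M (\<lambda>x. \<phi> (f x) (g x))"
  unfolding quasi_continuous_def
proof (intro allI impI)
  fix \<epsilon> :: real assume "0 < \<epsilon>"
  then have e2: "0 < \<epsilon> / 2" by simp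
  obtain G where G: "relopen G" "Cap G < ereal (\<epsilon> / 2)" "continuous_on (M - G) f"
    by (rule quasi_continuousE[OF f e2])
  obtain H where H: "relopen H" "Cap H < ereal (\<epsilon> / 2)" "continuous_on (M - H) g"
    by (rule quasi_continuousE[OF g e2])
  have "continuous_on (M - (G \<union> H)) (\<lambda>x. (f x, g x))"
    using G(3) H(3) by (intro continuous_on_Pair) (auto elim: continuous_on_subset)
  from continuous_on_compose2[OF cont this]
  have "continuous_on (M - (G \<union> H)) (\<lambda>x. \<phi> (f x) (g x))" by simp
  moreover have "Cap (G \<union> H) < ereal \<epsilon>" using capacity_Un[OF G(2) H(2)] by simp
  ultimately show "\<exists>G. relopen G \<and> Cap G < ereal \<epsilon> \<and> continuous_on (M - G) (\<lambda>x. \<phi> (f x) (g x))"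
    using G(1) H(1) by blast
qed

lemma openin_Un_preimage:
  fixes g :: "'a \<Rightarrow> real"
  assumes G: "relopen G" and g: "continuous_on (M - G) g" and T: "open T"
  shows "relopen (G \<union> {x \<in> M - G. g x \<in> T})"
proof -
  have "openin (top_of_set (M - G)) ((M - G) \<inter> g -` T)"
    by (rule continuous_openin_preimage_gen[OF g T])
  then obtain U where U: "open U" "(M - G) \<inter> g -` T = (M - G) \<inter> U"
    by (auto simp: openin_open)
  have "G \<union> {x \<in> M - G. g x \<in> T} = G \<union> (M \<inter> U)"
    using U(2) openin_imp_subset[OF G] by auto
  then show ?thesis using G U(1) by auto
qed

text \<open>The set where \<open>g\<close> leaves \<open>S\<close> is \<open>\<mu>\<close>-null and, up to an open set \<open>U\<close> of small capacity,
  open. Adding it to \<open>U\<close> does not change the class of functions admissible for the capacity of \<open>U\<close>,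
  because that class is defined by an almost-everywhere condition.\<close>

lemma AE_imp_quasi_everywhere:
  assumes g: "quasi_continuous M g" and G: "relopen G" and S: "closed S"
    and ae: "AE x in mu M. x \<in> G \<longrightarrow> g x \<in> S"
  shows "qe G (\<lambda>x. g x \<in> S)"
  unfolding quasi_everywhere_on_def
proof (rule capacity_zeroI)
  fix \<epsilon> :: real assume "0 < \<epsilon>"
  obtain U where U: "relopen U" "Cap U < ereal \<epsilon>" "continuous_on (M - U) g"
    by (rule quasi_continuousE[OF g \<open>0 < \<epsilon>\<close>])
  obtain V f where V: "U \<subseteq> V" "f \<in> H1 M" "AE x in mu M. x \<in> V \<longrightarrow> 1 \<le> f x" "\<E>1 f < \<epsilon>"
    using U(2) unfolding capacity_less_iff by blast
  define W where "W = U \<union> (G \<inter> (U \<union> {x \<in> M - U. g x \<in> - S}))"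
  have "relopen W"
    unfolding W_def using U G S by (intro openin_Un openin_Int openin_Un_preimage) auto
  moreover have "{x \<in> G. g x \<notin> S} \<subseteq> W"
    unfolding W_def using openin_imp_subset[OF G] by auto
  moreover have "AE x in mu M. x \<in> W \<longrightarrow> 1 \<le> f x"
    using V(3) ae by eventually_elim (use V(1) in \<open>auto simp: W_def\<close>)
  ultimately have "Cap {x \<in> G. g x \<notin> S} \<le> ereal (\<E>1 f)"
    using V(2) by (intro capacity_leI)
  also have "\<dots> \<le> ereal \<epsilon>" using V(4) by simp
  finally show "Cap {x \<in> G. g x \<notin> S} \<le> ereal \<epsilon>" .
qed

definition qc_version :: "('a \<Rightarrow> real) \<Rightarrow> ('a \<Rightarrow> real) \<Rightarrow> bool" where
  "qc_version g f \<longleftrightarrow> quasi_continuous M g \<and> (AE x in mu M. g x = f x)"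

lemma qc_version_compose2:
  fixes \<phi> :: "real \<Rightarrow> real \<Rightarrow> real"
  assumes "qc_version g f" "qc_version g' f'" "continuous_on UNIV (\<lambda>z. \<phi> (fst z) (snd z))"
  shows "qc_version (\<lambda>x. \<phi> (g x) (g' x)) (\<lambda>x. \<phi> (f x) (f' x))"
  using assms unfolding qc_version_def
  by (auto intro: quasi_continuous_compose2 elim: eventually_elim2)

lemma qc_version_unique:
  assumes "qc_version g f" "qc_version g' f"
  shows "qe M (\<lambda>x. g x = g' x)"
proof -
  have v: "qc_version (\<lambda>x. g x - g' x) (\<lambda>x. f x - f x)"
    by (rule qc_version_compose2[OF assms]) (intro continuous_intros)
  have "qe M (\<lambda>x. g x - g' x \<in> {0})"
    by (rule AE_imp_quasi_everywhere) (use v in \<open>auto simp: qc_version_def\<close>)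
  then show ?thesis by (rule quasi_everywhere_on_mono) auto
qed

text \<open>The set \<open>{g > 1 / (1 + s)}\<close> is open up to a set of small capacity and contains \<open>A\<close> up to another
  one. The maximum of \<open>(1 + s) f\<close> and of witnesses for these two small sets is therefore admissible for
  an open set containing \<open>A\<close>.\<close>

lemma capacity_le_energy1:
  assumes f: "f \<in> H1 M" and v: "qc_version g f" and A: "A \<subseteq> M"
    and qe: "qe A (\<lambda>x. 1 \<le> g x)"
  shows "Cap A \<le> ereal (\<E>1 f)"
proof -
  have bound: "Cap A \<le> ereal ((1 + s)\<^sup>2 * \<E>1 f + 2 * s)" if s: "0 < s" for s
  proof -
    have gq: "quasi_continuous M g" using v by (simp add: qc_version_def)
    obtain U where U: "relopen U" "Cap U < ereal s" "continuous_on (M - U) g"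
      by (rule quasi_continuousE[OF gq s])
    obtain U' u where U': "U \<subseteq> U'" "u \<in> H1 M" "AE x in mu M. x \<in> U' \<longrightarrow> 1 \<le> u x" "\<E>1 u < s"
      using U(2) unfolding capacity_less_iff by blast
    have "Cap {x \<in> A. \<not> 1 \<le> g x} < ereal s"
      using qe s by (simp add: quasi_everywhere_on_def)
    then obtain V w where V: "relopen V" "{x \<in> A. \<not> 1 \<le> g x} \<subseteq> V"
      "w \<in> H1 M" "AE x in mu M. x \<in> V \<longrightarrow> 1 \<le> w x" "\<E>1 w < s"
      unfolding capacity_less_iff by blast
    define W where "W = (U \<union> {x \<in> M - U. g x \<in> {1 / (1 + s)<..}}) \<union> V"
    define h where "h x = max ((1 + s) * f x) (max (u x) (w x))" for x
    have hH: "h \<in> H1 M" "\<E>1 h \<le> (1 + s)\<^sup>2 * \<E>1 f + 2 * s"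
    proof -
      note uw = H1_max[OF U'(2) V(3)]
      note hh = H1_max[OF H1_cmult(1)[OF f, of "1 + s"] uw(1)]
      show "h \<in> H1 M" using hh(1) by (simp add: h_def[abs_def])
      have "\<E>1 h \<le> \<E>1 (\<lambda>x. (1 + s) * f x) + \<E>1 (\<lambda>x. max (u x) (w x))"
        using hh(2) by (simp add: h_def[abs_def])
      moreover have "\<E>1 (\<lambda>x. (1 + s) * f x) \<le> (1 + s)\<^sup>2 * \<E>1 f"
        by (rule H1_cmult(4)[OF f])
      ultimately show "\<E>1 h \<le> (1 + s)\<^sup>2 * \<E>1 f + 2 * s"
        using uw(2) U'(4) V(5) by simp
    qed
    have "relopen W"
      unfolding W_def using U V by (intro openin_Un openin_Un_preimage) auto
    moreover have "A \<subseteq> W"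
    proof
      fix x assume x: "x \<in> A"
      have "1 / (1 + s) < 1" using s by simp
      then show "x \<in> W" using x A V(2) by (auto simp: W_def)
    qed
    moreover have "AE x in mu M. x \<in> W \<longrightarrow> 1 \<le> h x"
    proof -
      have "AE x in mu M. g x = f x" using v by (simp add: qc_version_def)
      then show ?thesis
        using U'(3) V(4)
      proof eventually_elim
        case (elim x)
        show ?case
        proof
          assume "x \<in> W"
          then consider "x \<in> U" | "1 / (1 + s) < f x" | "x \<in> V"
            using elim(1) by (auto simp: W_def)
          then show "1 \<le> h x"
          proof cases
            case 2
            then have "1 < (1 + s) * f x" using s by (simp add: field_simps)
            then show ?thesis by (simp add: h_def)
          qed (use elim U'(1) in \<open>auto simp: h_def\<close>)
        qed
      qed
    qed
    ultimately have "Cap A \<le> ereal (\<E>1 h)"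
      using hH(1) by (intro capacity_leI)
    then show ?thesis using hH(2) by (meson ereal_less_eq(3) order_trans)
  qed
  have "((\<lambda>s. ereal ((1 + s)\<^sup>2 * \<E>1 f + 2 * s)) \<longlongrightarrow> ereal ((1 + 0)\<^sup>2 * \<E>1 f + 2 * 0)) (at_right 0)"
    by (intro tendsto_intros)
  moreover have "eventually (\<lambda>s. Cap A \<le> ereal ((1 + s)\<^sup>2 * \<E>1 f + 2 * s)) (at_right 0)"
    using bound by (auto simp: eventually_at_right_less intro: eventually_mono[OF eventually_at_right_less])
  ultimately show ?thesis
    using tendsto_lowerbound by fastforce
qed

lemma tendsto_zero_fast_subseq:
  fixes d :: "nat \<Rightarrow> real"
  assumes "d \<longlonglongrightarrow> 0"
  shows "\<exists>r::nat\<Rightarrow>nat. strict_mono r \<and> (\<forall>n. d (r n) < (1/8) ^ n)"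
proof -
  have "\<exists>r. strict_mono r \<and> (\<forall>n. \<forall>m\<ge>r n. d m < (1/8) ^ n)"
  proof (rule Cauchy_fast_subseq)
    fix e :: real assume "0 < e"
    from order_tendstoD(2)[OF assms this] show "\<exists>N. \<forall>m\<ge>N. \<forall>n\<ge>N. d m < e"
      by (auto simp: eventually_sequentially)
  qed
  then show ?thesis by blast
qed

subsection \<open>Quasi-continuous versions and limits\<close>

text \<open>A fast subsequence converges uniformly off open sets of arbitrarily small capacity: by the
  Chebyshev inequality the exceptional sets of the successive differences have summable capacities.\<close>

lemma qc_version_limit:
  fixes f g :: "nat \<Rightarrow> 'a \<Rightarrow> real"
  assumes f: "\<And>n. f n \<in> H1 M" and u: "u \<in> H1 M"
    and lim: "(\<lambda>n. \<E>1 (\<lambda>x. f n x - u x)) \<longlonglongrightarrow> 0"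
    and v: "\<And>n. qc_version (g n) (f n)"
  shows "\<exists>(r::nat\<Rightarrow>nat) h. qc_version h u \<and>
    qe M (\<lambda>x. (\<lambda>n. g (r n) x) \<longlonglongrightarrow> h x)"
proof -
  obtain r :: "nat \<Rightarrow> nat" where fast: "\<And>n. \<E>1 (\<lambda>x. f (r n) x - u x) < (1/8) ^ n"
    using tendsto_zero_fast_subseq[OF lim] by blast
  define F where "F n = f (r n)" for n
  define G where "G n = g (r n)" for n
  have FH: "F n \<in> H1 M" and GF: "qc_version (G n) (F n)" for n
    using f v by (auto simp: F_def G_def)
  have step: "\<E>1 (\<lambda>x. F (Suc n) x - F n x) \<le> 3 * (1/8) ^ n" for n
  proof -
    have "\<E>1 (\<lambda>x. F (Suc n) x - F n x)
        \<le> 2 * \<E>1 (\<lambda>x. F (Suc n) x - u x) + 2 * \<E>1 (\<lambda>x. u x - F n x)"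
      by (rule energy1_diff_triangle[OF FH u FH])
    moreover have "\<E>1 (\<lambda>x. u x - F n x) = \<E>1 (\<lambda>x. F n x - u x)"
      by (rule energy1_diff_commute[OF u FH])
    moreover have "\<E>1 (\<lambda>x. F (Suc n) x - u x) < (1/8) * (1/8) ^ n" "\<E>1 (\<lambda>x. F n x - u x) < (1/8) ^ n"
      using fast[of n] fast[of "Suc n"] by (simp_all add: F_def)
    moreover have "0 < (1/8::real) ^ n" by simp
    ultimately show ?thesis by argo
  qed
  define B where "B n = {x \<in> M. (1/2) ^ n \<le> \<bar>G (Suc n) x - G n x\<bar>}" for n
  have capB: "Cap (B n) < ereal (4 * (1/2) ^ n)" for n
  proof -
    have dH: "(\<lambda>x. F (Suc n) x - F n x) \<in> H1 M" by (intro H1_diff FH)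
    have a: "(\<lambda>x. \<bar>F (Suc n) x - F n x\<bar>) \<in> H1 M"
      "\<E>1 (\<lambda>x. \<bar>F (Suc n) x - F n x\<bar>) \<le> \<E>1 (\<lambda>x. F (Suc n) x - F n x)"
      by (rule H1_contraction[OF dH, of abs]; simp add: abs_triangle_ineq3)+
    note b = H1_cmult[OF a(1), of "2 ^ n"]
    have "\<E>1 (\<lambda>x. 2 ^ n * \<bar>F (Suc n) x - F n x\<bar>) \<le> (2 ^ n)\<^sup>2 * \<E>1 (\<lambda>x. \<bar>F (Suc n) x - F n x\<bar>)"
      by (rule b(4))
    also have "\<dots> \<le> (2 ^ n)\<^sup>2 * (3 * (1/8) ^ n)"
      using a(2) step[of n] by (intro mult_left_mono) auto
    also have "\<dots> = 3 * (2 * 2 * (1/8)) ^ n"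
      unfolding power_mult_distrib power2_eq_square by (simp only: mult_ac)
    also have "\<dots> < 4 * (1/2) ^ n" by simp
    finally have e: "\<E>1 (\<lambda>x. 2 ^ n * \<bar>F (Suc n) x - F n x\<bar>) < 4 * (1/2) ^ n" .
    have "Cap (B n) \<le> ereal (\<E>1 (\<lambda>x. 2 ^ n * \<bar>F (Suc n) x - F n x\<bar>))"
    proof (rule capacity_le_energy1[OF b(1)])
      show "qc_version (\<lambda>x. 2 ^ n * \<bar>G (Suc n) x - G n x\<bar>) (\<lambda>x. 2 ^ n * \<bar>F (Suc n) x - F n x\<bar>)"
        by (rule qc_version_compose2[OF GF GF]) (intro continuous_intros)
      show "qe (B n) (\<lambda>x. 1 \<le> 2 ^ n * \<bar>G (Suc n) x - G n x\<bar>)"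
        by (rule quasi_everywhere_onI) (auto simp: B_def field_simps power_one_over)
    qed (auto simp: B_def)
    also have "\<dots> < ereal (4 * (1/2) ^ n)" using e by simp
    finally show ?thesis .
  qed
  have "\<forall>n. \<exists>Z. relopen Z \<and> Cap Z < ereal ((1/2) ^ n) \<and> continuous_on (M - Z) (G n)"
    using GF unfolding qc_version_def quasi_continuous_def by simp
  then obtain Z where Z: "\<And>n. relopen (Z n)" "\<And>n. Cap (Z n) < ereal ((1/2) ^ n)"
    "\<And>n. continuous_on (M - Z n) (G n)" by metis
  have "\<forall>n. \<exists>V. relopen V \<and> B n \<union> Z n \<subseteq> V \<and> Cap V < ereal (5 * (1/2) ^ n)"
  proof
    fix n
    have "Cap (B n \<union> Z n) < ereal (4 * (1/2) ^ n + (1/2) ^ n)"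
      by (rule capacity_Un[OF capB Z(2)])
    then have "Cap (B n \<union> Z n) < ereal (5 * (1/2) ^ n)" by simp
    then show "\<exists>V. relopen V \<and> B n \<union> Z n \<subseteq> V \<and> Cap V < ereal (5 * (1/2) ^ n)"
      unfolding capacity_less_iff by blast
  qed
  then obtain V where V: "\<And>n. relopen (V n)" "\<And>n. B n \<union> Z n \<subseteq> V n"
    "\<And>n. Cap (V n) < ereal (5 * (1/2) ^ n)" by metis
  define W where "W m = (\<Union>n. V (n + m))" for m
  have Wopen: "relopen (W m)" for m
    unfolding W_def using V(1) by auto
  have capW: "Cap (W m) \<le> ereal (10 * (1/2) ^ m)" for m
    unfolding W_def
  proof (rule capacity_countable_union)
    show "Cap (V (n + m)) < ereal (5 * (1/2) ^ (n + m))" for n by (rule V(3))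
    have "(\<lambda>n. (5 * (1/2) ^ m) * (1/2::real) ^ n) sums ((5 * (1/2) ^ m) * (1 / (1 - 1/2)))"
      by (intro sums_mult geometric_sums) simp
    then show "(\<lambda>n. 5 * (1/2) ^ (n + m)) sums (10 * (1/2::real) ^ m)"
      by (simp add: power_add mult_ac)
  qed
  define h where "h x = lim (\<lambda>n. G n x)" for x
  have conv: "(\<forall>x\<in>M - W m. (\<lambda>n. G n x) \<longlonglongrightarrow> h x) \<and> continuous_on (M - W m) h" for m
  proof -
    define D where "D i x = G (Suc (m + i)) x - G (m + i) x" for i x
    have small: "norm (D i x) \<le> (1/2) ^ i" if "x \<in> M - W m" for i x
    proof -
      have "x \<notin> V (m + i)" using that by (auto simp: W_def add.commute)
      then have "x \<notin> B (m + i)" using V(2) by blast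
      then have "norm (D i x) \<le> (1/2) ^ (m + i)" using that by (auto simp: B_def D_def)
      also have "\<dots> \<le> (1/2) ^ i" by (simp add: power_decreasing)
      finally show ?thesis .
    qed
    have unif: "uniform_limit (M - W m) (\<lambda>n x. \<Sum>i<n. D i x) (\<lambda>x. \<Sum>i. D i x) sequentially"
      by (rule Weierstrass_m_test[OF small]) (simp_all add: summable_geometric)
    have tele: "(\<Sum>i<n. D i x) = G (m + n) x - G m x" for n x
      unfolding D_def using sum_lessThan_telescope[of "\<lambda>i. G (m + i) x" n] by simp
    have contG: "continuous_on (M - W m) (G (m + n))" for n
    proof (rule continuous_on_subset[OF Z(3)])
      have "V (n + m) \<subseteq> W m" unfolding W_def by blast
      then have "Z (m + n) \<subseteq> W m" using V(2)[of "n + m"] by (auto simp: add.commute)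
      then show "M - W m \<subseteq> M - Z (m + n)" by blast
    qed
    have pw: "(\<lambda>n. G n x) \<longlonglongrightarrow> (\<Sum>i. D i x) + G m x" if "x \<in> M - W m" for x
    proof -
      have "(\<lambda>n. G (m + n) x - G m x) \<longlonglongrightarrow> (\<Sum>i. D i x)"
        using tendsto_uniform_limitI[OF unif that] by (simp add: tele)
      from tendsto_add[OF this tendsto_const[of "G m x"]]
      have "(\<lambda>n. G (n + m) x) \<longlonglongrightarrow> (\<Sum>i. D i x) + G m x" by (simp add: add.commute)
      then show ?thesis by (rule LIMSEQ_offset)
    qed
    then have heq: "h x = (\<Sum>i. D i x) + G m x" if "x \<in> M - W m" for x
      unfolding h_def using that by (intro limI)
    have "continuous_on (M - W m) (\<lambda>x. \<Sum>i. D i x)"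
    proof (rule uniform_limit_theorem[OF _ unif])
      show "\<forall>\<^sub>F n in sequentially. continuous_on (M - W m) (\<lambda>x. \<Sum>i<n. D i x)"
        unfolding tele using contG contG[of 0] by (intro always_eventually allI continuous_on_diff) auto
    qed simp
    then have "continuous_on (M - W m) (\<lambda>x. (\<Sum>i. D i x) + G m x)"
      using contG[of 0] by (intro continuous_on_add) auto
    then have "continuous_on (M - W m) h"
      by (subst continuous_on_cong[OF refl heq])
    then show ?thesis using pw heq by simp
  qed
  have small: "\<exists>m. Cap (W m) < ereal \<epsilon>" if "0 < \<epsilon>" for \<epsilon>
  proof -
    have "(\<lambda>m. 10 * (1/2::real) ^ m) \<longlonglongrightarrow> 10 * 0"
      by (intro tendsto_intros LIMSEQ_power_zero) simp
    then have "eventually (\<lambda>m. 10 * (1/2::real) ^ m < \<epsilon>) sequentially"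
      using that by (intro order_tendstoD) auto
    then obtain m where "10 * (1/2::real) ^ m < \<epsilon>" by (auto simp: eventually_sequentially)
    then show ?thesis using capW[of m] by (intro exI[of _ m]) (auto elim: le_less_trans)
  qed
  have hq: "quasi_continuous M h"
    unfolding quasi_continuous_def using small Wopen conv by blast
  have qe: "qe M (\<lambda>x. (\<lambda>n. G n x) \<longlonglongrightarrow> h x)"
    unfolding quasi_everywhere_on_def
  proof (rule capacity_zeroI)
    fix \<epsilon> :: real assume "0 < \<epsilon>"
    then obtain m where m: "Cap (W m) < ereal \<epsilon>" using small by blast
    have "Cap {x \<in> M. \<not> (\<lambda>n. G n x) \<longlonglongrightarrow> h x} \<le> Cap (W m)"
      by (rule capacity_mono) (use conv[of m] in blast)
    then show "Cap {x \<in> M. \<not> (\<lambda>n. G n x) \<longlonglongrightarrow> h x} \<le> ereal \<epsilon>" using m by simp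
  qed
  have "AE x in mu M. summable (\<lambda>n. (F n x - u x)\<^sup>2)"
  proof (rule AE_summable_squares)
    show "square_integrable (mu M) (\<lambda>x. F n x - u x)" for n
      using H1_L2[OF H1_diff(1)[OF FH u], of n] by (simp add: L2_iff)
    show "summable (\<lambda>n. LINT x|mu M. (F n x - u x)\<^sup>2)"
    proof (rule summable_comparison_test)
      have "nsq (\<lambda>x. F n x - u x) \<le> (1/8) ^ n" for n
        using nsq_le_energy1[OF H1_diff(1)[OF FH u], of n] fast[of n] by (simp add: F_def)
      then show "\<exists>N. \<forall>n\<ge>N. norm (LINT x|mu M. (F n x - u x)\<^sup>2) \<le> (1/8) ^ n"
        by (simp add: nsq_def)
    qed (simp add: summable_geometric)
  qed
  moreover have "AE x in mu M. \<forall>n. G n x = F n x"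
    unfolding AE_all_countable using GF by (simp add: qc_version_def)
  ultimately have "AE x in mu M. h x = u x"
    using quasi_everywhere_AE[OF qe]
  proof eventually_elim
    case (elim x)
    have "(\<lambda>n. (F n x - u x)\<^sup>2) \<longlonglongrightarrow> 0" by (rule summable_LIMSEQ_zero[OF elim(1)])
    moreover have "(\<lambda>n. (F n x - u x)\<^sup>2) \<longlonglongrightarrow> (h x - u x)\<^sup>2"
      using elim(2,3) by (intro tendsto_intros) simp
    ultimately have "(h x - u x)\<^sup>2 = 0" by (rule LIMSEQ_unique[symmetric])
    then show ?case by simp
  qed
  with hq qe show ?thesis by (auto simp: qc_version_def G_def)
qed

text \<open>Regularity of the form provides continuous approximations.\<close>

lemma exists_qc_version:
  assumes "f \<in> H1 M"
  shows "\<exists>g. qc_version g f"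
proof -
  have "\<forall>n. \<exists>h\<in>H1 M. continuous_on M h \<and> \<E>1 (\<lambda>x. f x - h x) < (1/2) ^ n"
    using regular assms unfolding regular_form_def by simp
  then obtain h where h: "\<And>n. h n \<in> H1 M" "\<And>n. continuous_on M (h n)"
    "\<And>n. \<E>1 (\<lambda>x. f x - h n x) < (1/2) ^ n" by metis
  have "(\<lambda>n. \<E>1 (\<lambda>x. h n x - f x)) \<longlonglongrightarrow> 0"
  proof (rule tendsto_sandwich[OF _ _ tendsto_const LIMSEQ_power_zero[of "1/2::real"]])
    show "\<forall>\<^sub>F n in sequentially. 0 \<le> \<E>1 (\<lambda>x. h n x - f x)"
      using energy1_nonneg[OF H1_diff(1)[OF h(1) assms]] by simp
    show "\<forall>\<^sub>F n in sequentially. \<E>1 (\<lambda>x. h n x - f x) \<le> (1/2) ^ n"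
      using h(3) energy1_diff_commute[OF h(1) assms] by (simp add: less_imp_le)
  qed simp
  moreover have "qc_version (h n) (h n)" for n
    using h(2) by (simp add: qc_version_def continuous_imp_quasi_continuous)
  ultimately show ?thesis
    using qc_version_limit[of h f h, OF h(1) assms] by blast
qed

text \<open>For \<open>S = {0}\<close> this is the domain of the form killed on \<open>A\<close>; for \<open>S = [1, \<infinity>)\<close> it is the class
  over which the energy is minimized to obtain the capacity of \<open>A\<close>.\<close>

definition qe_class :: "'a set \<Rightarrow> real set \<Rightarrow> ('a \<Rightarrow> real) set" where
  "qe_class A S = {f \<in> H1 M. \<exists>g. qc_version g f \<and> qe A (\<lambda>x. g x \<in> S)}"

lemma vanishes_qe_on_iff: "f \<in> H1 M \<Longrightarrow> vanishes_qe_on M A f \<longleftrightarrow> f \<in> qe_class A {0}"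
  by (simp add: vanishes_qe_on_def qe_class_def qc_version_def conj_assoc)

lemma qe_class_H1: "qe_class A S \<subseteq> H1 M"
  by (auto simp: qe_class_def)

lemma qe_class_antimono: "B \<subseteq> A \<Longrightarrow> qe_class A S \<subseteq> qe_class B S"
  unfolding qe_class_def by (auto intro: quasi_everywhere_on_mono)

lemma qe_class_midpoint:
  assumes f: "f \<in> qe_class A S" and g: "g \<in> qe_class A S" and S: "convex S"
  shows "(\<lambda>x. (f x + g x) / 2) \<in> qe_class A S"
proof -
  obtain f' where f': "qc_version f' f" "qe A (\<lambda>x. f' x \<in> S)"
    using f by (auto simp: qe_class_def)
  obtain g' where g': "qc_version g' g" "qe A (\<lambda>x. g' x \<in> S)"
    using g by (auto simp: qe_class_def)
  have "(\<lambda>x. (1/2) * (f x + g x)) \<in> H1 M"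
    by (rule H1_cmult(1)[OF H1_add(1)[OF _ _ zero_less_one]]) (use f g qe_class_H1 in auto)
  moreover have "qc_version (\<lambda>x. (f' x + g' x) / 2) (\<lambda>x. (f x + g x) / 2)"
    by (rule qc_version_compose2[OF f'(1) g'(1)]) (intro continuous_intros, simp)
  moreover have "qe A (\<lambda>x. (f' x + g' x) / 2 \<in> S)"
  proof (rule quasi_everywhere_on_mono[OF quasi_everywhere_on_conj[OF f'(2) g'(2)]])
    fix x assume "f' x \<in> S \<and> g' x \<in> S"
    then show "(f' x + g' x) / 2 \<in> S"
      using convexD[OF S, of "f' x" "g' x" "1/2" "1/2"] by (simp add: add_divide_distrib)
  qed simp
  ultimately show ?thesis by (auto simp: qe_class_def)
qed

lemma qe_class_closed:
  assumes A: "A \<subseteq> M" and S: "closed S" and f: "\<And>k. f k \<in> qe_class A S" and u: "u \<in> H1 M"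
    and lim: "(\<lambda>k. \<E>1 (\<lambda>x. f k x - u x)) \<longlonglongrightarrow> 0"
  shows "u \<in> qe_class A S"
proof -
  have "\<forall>k. \<exists>g. qc_version g (f k) \<and> qe A (\<lambda>x. g x \<in> S)"
    using f by (simp add: qe_class_def)
  then obtain g where g: "\<And>k. qc_version (g k) (f k)" "\<And>k. qe A (\<lambda>x. g k x \<in> S)"
    by metis
  obtain r :: "nat \<Rightarrow> nat" and h where h: "qc_version h u"
    and conv: "qe M (\<lambda>x. (\<lambda>n. g (r n) x) \<longlonglongrightarrow> h x)"
    using qc_version_limit[of f u g] f u lim g(1) qe_class_H1 by blast
  have "qe A (\<lambda>x. \<forall>k. g k x \<in> S)"
    by (rule quasi_everywhere_on_all) (rule g(2))
  moreover have "qe A (\<lambda>x. (\<lambda>n. g (r n) x) \<longlonglongrightarrow> h x)"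
    by (rule quasi_everywhere_on_mono[OF conv A])
  ultimately have "qe A (\<lambda>x. (\<forall>k. g k x \<in> S) \<and> (\<lambda>n. g (r n) x) \<longlonglongrightarrow> h x)"
    by (rule quasi_everywhere_on_conj)
  then have "qe A (\<lambda>x. h x \<in> S)"
    by (rule quasi_everywhere_on_mono) (auto intro: closed_sequentially[OF S])
  with h u show ?thesis by (auto simp: qe_class_def)
qed

lemma qe_class_UN:
  fixes A :: "nat \<Rightarrow> 'a set"
  assumes A: "\<And>n. A n \<subseteq> M" and f: "\<And>n. f \<in> qe_class (A n) S"
  shows "f \<in> qe_class (\<Union>n. A n) S"
proof -
  have "\<forall>n. \<exists>g. qc_version g f \<and> qe (A n) (\<lambda>x. g x \<in> S)"
    using f by (simp add: qe_class_def)
  then obtain g where g: "\<And>n. qc_version (g n) f" "\<And>n. qe (A n) (\<lambda>x. g n x \<in> S)"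
    by metis
  have "qe (A n) (\<lambda>x. g 0 x \<in> S)" for n
  proof -
    have "qe (A n) (\<lambda>x. g 0 x = g n x)"
      by (rule quasi_everywhere_on_mono[OF qc_version_unique[OF g(1) g(1)] A])
    from quasi_everywhere_on_conj[OF this g(2)] show ?thesis
      by (rule quasi_everywhere_on_mono) auto
  qed
  then have "qe (\<Union>n. A n) (\<lambda>x. g 0 x \<in> S)"
    by (rule quasi_everywhere_on_UN)
  with g(1) f[of 0] show ?thesis by (auto simp: qe_class_def)
qed

text \<open>For \<open>v = 0\<close> this produces equilibrium functions, and for large \<open>N\<close> functions close to \<open>v\<close> that
  satisfy all the constraints.\<close>

lemma exists_minimizer_in_qe_class:
  fixes A :: "nat \<Rightarrow> 'a set"
  assumes inc: "incseq A" and A: "\<And>n. A n \<subseteq> M" and S: "closed S" "convex S"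
    and v: "v \<in> L2 M" and N: "0 < N"
    and near: "\<And>n e. 0 < e \<Longrightarrow> \<exists>g\<in>qe_class (A n) S. \<E> g + N * nsq (\<lambda>x. g x - v x) < L + e"
  shows "\<exists>g\<in>qe_class (\<Union>n. A n) S. \<E> g + N * nsq (\<lambda>x. g x - v x) \<le> L"
proof -
  have "\<exists>g. (\<forall>n. g \<in> qe_class (A n) S) \<and> \<E> g + N * nsq (\<lambda>x. g x - v x) \<le> L"
  proof (rule exists_minimizer_in_Inter)
    show "qe_class (A (Suc n)) S \<subseteq> qe_class (A n) S" for n
      by (rule qe_class_antimono) (use inc in \<open>simp add: incseq_Suc_iff\<close>)
  qed (fact qe_class_H1 qe_class_midpoint[OF _ _ S(2)] qe_class_closed[OF A S(1)] v N near)+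
  then show ?thesis using qe_class_UN[of A _ S, OF A] by blast
qed

lemma AE_imp_qe_class:
  assumes f: "f \<in> H1 M" and G: "relopen G" and S: "closed S"
    and ae: "AE x in mu M. x \<in> G \<longrightarrow> f x \<in> S"
  shows "f \<in> qe_class G S"
proof -
  obtain g where g: "qc_version g f" using exists_qc_version[OF f] by blast
  have "AE x in mu M. x \<in> G \<longrightarrow> g x \<in> S"
    using ae g unfolding qc_version_def by (auto elim: eventually_elim2)
  then have "qe G (\<lambda>x. g x \<in> S)"
    using AE_imp_quasi_everywhere[OF _ G S] g by (simp add: qc_version_def)
  with f g show ?thesis by (auto simp: qe_class_def)
qed

text \<open>Near-equilibrium functions of the sets converge, by the parallelogram law, to a function that
  is admissible for the union. This holds for arbitrary sets, as Choquet's theorem requires.\<close>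

lemma capacity_incseq:
  fixes A :: "nat \<Rightarrow> 'a set"
  assumes inc: "incseq A" and A: "\<And>n. A n \<subseteq> M" and le: "\<And>n. Cap (A n) \<le> ereal c"
  shows "Cap (\<Union>n. A n) \<le> ereal c"
proof -
  have "\<exists>g\<in>qe_class (\<Union>n. A n) {1..}. \<E> g + 1 * nsq (\<lambda>x. g x - 0) \<le> c"
  proof (rule exists_minimizer_in_qe_class[OF inc A])
    show "(\<lambda>x. 0) \<in> L2 M" by (simp add: L2_def)
    show "\<exists>g\<in>qe_class (A n) {1..}. \<E> g + 1 * nsq (\<lambda>x. g x - 0) < c + e" if "0 < e" for n e
    proof -
      have "Cap (A n) < ereal (c + e)" using le[of n] that by (simp add: le_less_trans)
      then obtain G f where G: "relopen G" "A n \<subseteq> G" "f \<in> H1 M"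
        "AE x in mu M. x \<in> G \<longrightarrow> 1 \<le> f x" "\<E>1 f < c + e"
        unfolding capacity_less_iff by blast
      then have "f \<in> qe_class G {1..}" by (intro AE_imp_qe_class) auto
      then have "f \<in> qe_class (A n) {1..}" using qe_class_antimono[OF G(2)] by auto
      with G(5) show ?thesis by (auto simp: energy1_eq)
    qed
  qed simp_all
  then obtain g where g: "g \<in> qe_class (\<Union>n. A n) {1..}" "\<E>1 g \<le> c"
    by (auto simp: energy1_eq)
  then obtain h where "g \<in> H1 M" "qc_version h g" "qe (\<Union>n. A n) (\<lambda>x. 1 \<le> h x)"
    by (auto simp: qe_class_def)
  then have "Cap (\<Union>n. A n) \<le> ereal (\<E>1 g)"
    using A by (intro capacity_le_energy1) auto
  then show ?thesis using g(2) by (meson ereal_less_eq(3) order_trans)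
qed

lemma qe_class_H1D: "f \<in> qe_class A S \<Longrightarrow> f \<in> H1 M"
  by (simp add: qe_class_def)

subsection \<open>Exhausting a Borel set by compact sets\<close>

lemma capacity_compact_approximation:
  assumes A: "A \<in> sets borel" "A \<subseteq> M" and r: "r < Cap A"
  shows "\<exists>K. compact K \<and> K \<subseteq> A \<and> r \<le> Cap K"
proof -
  have inc: "Cap (\<Union>n. B n) \<le> r" if "incseq B" "\<And>n::nat. B n \<subseteq> M" "\<And>n. Cap (B n) \<le> r" for B
  proof -
    have "0 \<le> r" using that(3)[of 0] capacity_nonneg[of "B 0"] by (rule order_trans[rotated])
    moreover have "r < \<infinity>" using r by (auto intro: less_le_trans)
    ultimately obtain c where c: "r = ereal c" by (cases r) auto
    then show ?thesis using capacity_incseq[OF that(1,2), of c] that(3) by simp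
  qed
  obtain K where K: "compact K" "K \<subseteq> A" "\<And>G. relopen G \<Longrightarrow> K \<subseteq> G \<Longrightarrow> r < Cap G"
    using Choquet_capacitability[of M "Cap" r A, OF compact_M capacity_mono inc A r] by blast
  have "r \<le> Cap K"
    unfolding capacity_def[of M K]
  proof (intro INF_greatest)
    fix G assume "G \<in> {G. relopen G \<and> K \<subseteq> G}"
    then have G: "relopen G" "K \<subseteq> G" by auto
    have "Cap G \<le> open_capacity M G"
      unfolding capacity_def by (rule INF_lower) (use G in auto)
    then show "r \<le> open_capacity M G" using K(3)[OF G] by (meson less_imp_le order_trans)
  qed
  with K show ?thesis by blast
qed

text \<open>The compact sets are chosen to exhaust the capacity of the trace of \<open>A\<close> on every set of a
  countable base that is closed under finite unions, hence on every open set. A function that is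
  continuous off an open set \<open>G\<close> of small capacity has \<open>{f \<noteq> 0}\<close> open up to \<open>G\<close>. If it vanishes on the
  compact sets, the trace of \<open>{f \<noteq> 0}\<close> on them is small, so the trace on \<open>A\<close> is equally small.\<close>

lemma exists_compact_exhaustion:
  assumes A: "A \<in> sets borel" "A \<subseteq> M"
  obtains C :: "nat \<Rightarrow> 'a set" where "\<And>n. compact (C n)" "incseq C" "\<And>n. C n \<subseteq> A"
    "\<And>f. quasi_continuous M f \<Longrightarrow> qe (\<Union>n. C n) (\<lambda>x. f x = 0) \<Longrightarrow>
      qe A (\<lambda>x. f x = 0)"
proof -
  obtain \<B> :: "'a set set" where \<B>: "countable \<B>" "topological_basis \<B>"
    using ex_countable_basis by blast
  define \<U> where "\<U> = Union ` {F. finite F \<and> F \<subseteq> \<B>}"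
  have "countable \<U>" unfolding \<U>_def using \<B>(1) by (intro countable_image countable_Collect_finite_subset)
  moreover have "{} \<in> \<U>" unfolding \<U>_def by force
  ultimately have "range (from_nat_into \<U>) = \<U>" by (intro range_from_nat_into) auto
  then obtain U :: "nat \<Rightarrow> 'a set" where U: "range U = \<U>" by blast
  have Uopen: "open (U i)" for i
  proof -
    have "U i \<in> \<U>" using U by auto
    then show ?thesis unfolding \<U>_def using topological_basis_open[OF \<B>(2)] by (auto intro!: open_Union) blast
  qed
  have Abor: "A \<inter> U i \<in> sets borel" for i by (rule sets.Int[OF A(1) borel_open[OF Uopen]])
  define Q where "Q i j K \<longleftrightarrow> compact K \<and> K \<subseteq> A \<inter> U i \<and>
    Cap (A \<inter> U i) - ereal (1 / real (Suc j)) \<le> Cap K" for i j K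
  have "\<forall>i j. \<exists>K. Q i j K"
    unfolding Q_def
  proof (intro allI)
    fix i j :: nat
    have "0 \<le> Cap (A \<inter> U i)" "Cap (A \<inter> U i) \<le> 1"
      using A by (auto intro: capacity_nonneg capacity_le_1)
    then obtain c where c: "Cap (A \<inter> U i) = ereal c" by (cases "Cap (A \<inter> U i)") auto
    have "\<exists>K. compact K \<and> K \<subseteq> A \<inter> U i \<and> ereal (c - 1 / real (Suc j)) \<le> Cap K"
      by (rule capacity_compact_approximation) (use Abor A c in auto)
    then show "\<exists>K. compact K \<and> K \<subseteq> A \<inter> U i \<and> Cap (A \<inter> U i) - ereal (1 / real (Suc j)) \<le> Cap K"
      by (simp add: c)
  qed
  then obtain K where KQ: "\<And>i j. Q i j (K i j)" by metis
  then have K: "\<And>i j. compact (K i j)" "\<And>i j. K i j \<subseteq> A \<inter> U i"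
    "\<And>i j. Cap (A \<inter> U i) - ereal (1 / real (Suc j)) \<le> Cap (K i j)"
    by (auto simp: Q_def)
  define C where "C n = (\<Union>k\<le>n. case prod_decode k of (i, j) \<Rightarrow> K i j)" for n
  define B where "B = (\<Union>n. C n)"
  have "compact (C n)" for n
    unfolding C_def using K(1) by (intro compact_UN) (auto split: prod.split)
  moreover have "incseq C"
    unfolding C_def incseq_def by (intro allI impI UN_mono) auto
  moreover have CA: "C n \<subseteq> A" for n
    unfolding C_def using K(2) by (intro UN_least) (auto split: prod.split)
  moreover have "qe A (\<lambda>x. f x = 0)"
    if f: "quasi_continuous M f" and fB: "qe (\<Union>n. C n) (\<lambda>x. f x = 0)" for f
  proof -
    have BA: "B \<subseteq> A" using CA by (auto simp: B_def)
    have KB: "K i j \<subseteq> B" for i j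
    proof -
      have "K i j \<subseteq> C (prod_encode (i, j))"
        unfolding C_def by (auto intro!: bexI[of _ "prod_encode (i, j)"])
      then show ?thesis by (auto simp: B_def)
    qed
    have capU: "Cap (A \<inter> U i) \<le> Cap (B \<inter> U i)" for i
    proof (rule ereal_le_epsilon2)
      fix e :: real assume "0 < e"
      then obtain j where j: "1 / real (Suc j) < e" by (rule nat_approx_posE)
      have "Cap (A \<inter> U i) - ereal (1 / real (Suc j)) \<le> Cap (B \<inter> U i)"
        by (rule order_trans[OF K(3) capacity_mono]) (use K(2)[of i j] KB[of i j] in blast)
      then have "Cap (A \<inter> U i) \<le> Cap (B \<inter> U i) + ereal (1 / real (Suc j))"
        by (simp add: ereal_minus_le)
      also have "\<dots> \<le> Cap (B \<inter> U i) + ereal e"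
        using j by (intro add_left_mono) simp
      finally show "Cap (A \<inter> U i) \<le> Cap (B \<inter> U i) + ereal e" .
    qed
    have capV: "Cap (A \<inter> V) \<le> Cap (B \<inter> V)" if V: "open V" for V
    proof -
      obtain \<V> where \<V>: "\<V> \<subseteq> \<B>" "\<Union>\<V> = V"
        using topological_basisE \<B>(2) V unfolding topological_basis_def by blast
      show ?thesis
      proof (cases "\<V> = {}")
        case True
        then show ?thesis using \<V> by (auto simp: capacity_empty)
      next
        case False
        have "countable \<V>" using \<V>(1) \<B>(1) countable_subset by blast
        then have rng: "range (from_nat_into \<V>) = \<V>"
          by (rule range_from_nat_into[OF False])
        define W where "W n = (\<Union>k\<le>n. from_nat_into \<V> k)" for n
        have WU: "\<exists>i. W n = U i" for n
        proof -
          have "W n = \<Union>(from_nat_into \<V> ` {..n})" by (simp add: W_def)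
          moreover have "from_nat_into \<V> ` {..n} \<subseteq> \<B>" using rng \<V>(1) by blast
          ultimately have "W n \<in> \<U>" unfolding \<U>_def by blast
          then show ?thesis using U by blast
        qed
        have WV: "(\<Union>n. W n) = V"
          using rng \<V>(2) unfolding W_def by blast
        have "0 \<le> Cap (B \<inter> V)" "Cap (B \<inter> V) \<le> 1"
          using A BA by (auto intro: capacity_nonneg capacity_le_1)
        then obtain c where c: "Cap (B \<inter> V) = ereal c" by (cases "Cap (B \<inter> V)") auto
        have "Cap (\<Union>n. A \<inter> W n) \<le> ereal c"
        proof (rule capacity_incseq)
          show "incseq (\<lambda>n. A \<inter> W n)" unfolding W_def incseq_def by force
          show "A \<inter> W n \<subseteq> M" for n using A by auto
          show "Cap (A \<inter> W n) \<le> ereal c" for n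
          proof -
            obtain i where i: "W n = U i" using WU by blast
            have "Cap (A \<inter> W n) \<le> Cap (B \<inter> W n)" unfolding i by (rule capU)
            also have "\<dots> \<le> Cap (B \<inter> V)" using WV by (intro capacity_mono) auto
            finally show ?thesis by (simp add: c)
          qed
        qed
        moreover have "(\<Union>n. A \<inter> W n) = A \<inter> V" using WV by auto
        ultimately show ?thesis by (simp add: c)
      qed
    qed
    show ?thesis
      unfolding quasi_everywhere_on_def
    proof (rule capacity_zeroI)
      fix e :: real assume "0 < e"
      then have e3: "0 < e / 3" by simp
      obtain G where G: "relopen G" "Cap G < ereal (e / 3)" "continuous_on (M - G) f"
        by (rule quasi_continuousE[OF f e3])
      have "openin (top_of_set (M - G)) ((M - G) \<inter> f -` (- {0}))"
        by (rule continuous_openin_preimage_gen[OF G(3)]) auto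
      then obtain V where V: "open V" "(M - G) \<inter> f -` (- {0}) = (M - G) \<inter> V"
        by (auto simp: openin_open)
      have "B \<inter> V \<subseteq> G \<union> {x \<in> B. f x \<noteq> 0}"
        using V(2) A BA by blast
      moreover have "Cap {x \<in> B. f x \<noteq> 0} < ereal (e / 3)"
        using fB e3 by (simp add: quasi_everywhere_on_def B_def)
      ultimately have "Cap (B \<inter> V) < ereal (e / 3 + e / 3)"
        using capacity_Un[OF G(2)] capacity_mono by (meson le_less_trans)
      then have "Cap (A \<inter> V) < ereal (e / 3 + e / 3)"
        using capV[OF V(1)] by (rule le_less_trans[rotated])
      then have "Cap ((A \<inter> V) \<union> G) < ereal (e / 3 + e / 3 + e / 3)"
        using capacity_Un[OF _ G(2)] by blast
      moreover have "{x \<in> A. f x \<noteq> 0} \<subseteq> (A \<inter> V) \<union> G"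
        using V(2) A by blast
      ultimately have "Cap {x \<in> A. f x \<noteq> 0} \<le> ereal (e / 3 + e / 3 + e / 3)"
        using capacity_mono by (meson less_imp_le order_trans)
      then show "Cap {x \<in> A. f x \<noteq> 0} \<le> ereal e" by simp
    qed
  qed
  ultimately show thesis by (rule that)
qed

section \<open>The killed eigenvalue\<close>

lemma nsq_eq_0_iff: "f \<in> L2 M \<Longrightarrow> nsq f = 0 \<longleftrightarrow> (AE x in mu M. f x = 0)"
  unfolding nsq_def by (subst integral_nonneg_eq_0_iff_AE) (auto simp: L2_def)

lemma killed_eigenvalue_eq:
  "eig A = (INF f \<in> {f \<in> qe_class A {0}. nsq f \<noteq> 0}. ereal (\<E> f / nsq f))"
  unfolding killed_eigenvalue_def inner_L2_self
  by (rule arg_cong2[where f="\<lambda>F S. Inf (F ` S)"])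
    (auto simp: vanishes_qe_on_iff nsq_eq_0_iff[OF H1_L2] qe_class_H1D)

lemma killed_eigenvalue_nonneg: "0 \<le> eig A"
  unfolding killed_eigenvalue_eq
  by (intro INF_greatest) (auto intro!: divide_nonneg_nonneg energy_nonneg nsq_nonneg dest: qe_class_H1D)

lemma killed_eigenvalue_mono: "B \<subseteq> A \<Longrightarrow> eig B \<le> eig A"
  unfolding killed_eigenvalue_eq using qe_class_antimono[of B A "{0}"] by (intro INF_superset_mono) auto

lemma Rayleigh_lower_bound:
  assumes "ereal c \<le> eig A" "f \<in> qe_class A {0}"
  shows "c * nsq f \<le> \<E> f"
proof (cases "nsq f = 0")
  case True
  then show ?thesis using energy_nonneg qe_class_H1 assms(2) by auto
next
  case False
  have "ereal c \<le> ereal (\<E> f / nsq f)"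
    using assms(1) unfolding killed_eigenvalue_eq by (rule order_trans) (rule INF_lower, use assms(2) False in auto)
  then show ?thesis using False nsq_nonneg[of f] by (simp add: field_simps)
qed

lemma qe_class_cmult:
  assumes "f \<in> qe_class A {0}"
  shows "(\<lambda>x. c * f x) \<in> qe_class A {0}"
proof -
  obtain g where g: "qc_version g f" "qe A (\<lambda>x. g x \<in> {0})"
    using assms by (auto simp: qe_class_def)
  have "qc_version (\<lambda>x. c * g x) (\<lambda>x. c * f x)"
    by (rule qc_version_compose2[OF g(1) g(1), of "\<lambda>u v. c * u"]) (intro continuous_intros)
  moreover have "qe A (\<lambda>x. c * g x \<in> {0})"
    by (rule quasi_everywhere_on_mono[OF g(2)]) auto
  moreover have "(\<lambda>x. c * f x) \<in> H1 M"
    using assms qe_class_H1 by (intro H1_cmult) auto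
  ultimately show ?thesis by (auto simp: qe_class_def)
qed

lemma nsq_limit_eq_1:
  assumes f: "\<And>n. f n \<in> L2 M" and g: "g \<in> L2 M" and lim: "(\<lambda>n. nsq (\<lambda>x. f n x - g x)) \<longlonglongrightarrow> 0"
    and 1: "\<And>n. nsq (f n) = 1"
  shows "nsq g = 1"
proof (rule antisym)
  show "nsq g \<le> 1" by (rule nsq_limit[OF f g lim]) (simp add: 1)
  show "1 \<le> nsq g"
  proof (rule le_of_le_one_plus_mult)
    fix s :: real assume s: "0 < s"
    have le: "1 \<le> (1 + s) * nsq g + (1 + 1/s) * nsq (\<lambda>x. f n x - g x)" for n
      using nsq_add_le[OF g L2_diff[OF f g] s, of n] by (simp add: 1)
    have "(\<lambda>n. (1 + s) * nsq g + (1 + 1/s) * nsq (\<lambda>x. f n x - g x)) \<longlonglongrightarrow> (1 + s) * nsq g + (1 + 1/s) * 0"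
      by (intro tendsto_intros lim)
    from LIMSEQ_le_const[OF this] le show "1 \<le> (1 + s) * nsq g" by auto
  qed
qed

lemma nsq_cmult: "nsq (\<lambda>x. c * f x) = c\<^sup>2 * nsq f"
  by (simp add: nsq_def power_mult_distrib)

lemma aform_cmult: "aform t (\<lambda>x. c * f x) = c\<^sup>2 * aform t f"
  by (simp add: aform_def right_diff_distrib[symmetric] power_mult_distrib)

text \<open>The eigenvalue is continuous along the exhaustion: normalized near-minimizers converge in
  \<open>L\<^sup>2\<close>, to a limit \<open>f\<close> that is approximated in \<open>L\<^sup>2\<close> by functions in the intersection of the killed
  form domains, with the energy controlled. They are obtained by penalizing the distance to \<open>f\<close>.\<close>

lemma killed_eigenvalue_compact_approximation:
  assumes A: "A \<in> sets borel" "A \<subseteq> M" and \<Lambda>: "ereal \<Lambda> < eig A"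
  shows "\<exists>K. compact K \<and> K \<subseteq> A \<and> ereal \<Lambda> < eig K"
proof (rule ccontr)
  assume contra: "\<not> ?thesis"
  obtain C :: "nat \<Rightarrow> 'a set" where C: "\<And>n. compact (C n)" "incseq C" "\<And>n. C n \<subseteq> A"
    "\<And>f. quasi_continuous M f \<Longrightarrow> qe (\<Union>n. C n) (\<lambda>x. f x = 0) \<Longrightarrow>
      qe A (\<lambda>x. f x = 0)"
    using exists_compact_exhaustion[OF A] by blast
  have CM: "C n \<subseteq> M" for n using C(3) A(2) by blast
  have le: "eig (C n) \<le> ereal \<Lambda>" for n
    using contra C(1)[of n] C(3)[of n] by (meson not_le)
  obtain L where L: "ereal \<Lambda> < ereal L" "ereal L < eig A"
    using ereal_dense2[OF \<Lambda>] by blast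
  obtain c where c: "ereal L < ereal c" "ereal c < eig A"
    using ereal_dense2[OF L(2)] by blast
  have "\<forall>n. \<exists>f. f \<in> qe_class (C n) {0} \<and> nsq f = 1 \<and> \<E> f \<le> L"
  proof
    fix n
    have "eig (C n) < ereal L" using le[of n] L(1) by (rule le_less_trans)
    then obtain f where f: "f \<in> qe_class (C n) {0}" "nsq f \<noteq> 0" "\<E> f / nsq f < L"
      unfolding killed_eigenvalue_eq INF_less_iff by auto
    have pos: "0 < nsq f" using f(2) nsq_nonneg[of f] by simp
    define g where "g x = (1 / sqrt (nsq f)) * f x" for x
    have "g \<in> qe_class (C n) {0}" unfolding g_def[abs_def] by (rule qe_class_cmult[OF f(1)])
    moreover have "nsq g = 1" unfolding g_def[abs_def] nsq_cmult using pos by (simp add: power_divide)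
    moreover have "\<E> g \<le> L"
    proof -
      have "f \<in> H1 M" using f(1) qe_class_H1 by auto
      then have "\<E> g \<le> (1 / sqrt (nsq f))\<^sup>2 * \<E> f"
        unfolding g_def[abs_def] by (rule H1_cmult(2))
      then show ?thesis using f(3) pos by (simp add: power_divide)
    qed
    ultimately show "\<exists>f. f \<in> qe_class (C n) {0} \<and> nsq f = 1 \<and> \<E> f \<le> L" by blast
  qed
  then obtain f where f: "\<And>n. f n \<in> qe_class (C n) {0}" "\<And>n. nsq (f n) = 1" "\<And>n. \<E> (f n) \<le> L"
    by metis
  have fH: "f n \<in> H1 M" for n using f(1) qe_class_H1 by blast
  have fL: "f n \<in> L2 M" for n by (rule H1_L2[OF fH])
  obtain r g where r: "strict_mono (r :: nat \<Rightarrow> nat)" and g: "g \<in> L2 M"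
    and lim: "(\<lambda>n. nsq (\<lambda>x. f (r n) x - g x)) \<longlonglongrightarrow> 0"
  proof -
    have "aform (1 / 2 ^ j) (f k) \<le> L" for j k
      by (rule order_trans[OF aform_le_energy[OF _ fH] f(3)]) simp
    then show thesis using L2_compactness[of f 1 1 L] fL f(2) that by auto
  qed
  have g1: "nsq g = 1" by (rule nsq_limit_eq_1[OF fL g lim f(2)])
  have L0: "0 \<le> L" using f(3)[of 0] energy_nonneg[OF fH[of 0]] by simp
  have c0: "0 < c" "L < c" using L0 c(1) by auto
  have close: "\<exists>u. u \<in> qe_class A {0} \<and> \<E> u + N * nsq (\<lambda>x. u x - g x) \<le> L" if N: "0 < N" for N
  proof -
    have "\<exists>u\<in>qe_class (\<Union>n. C n) {0}. \<E> u + N * nsq (\<lambda>x. u x - g x) \<le> L"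
    proof (rule exists_minimizer_in_qe_class[OF C(2) CM])
      show "\<exists>u\<in>qe_class (C n) {0}. \<E> u + N * nsq (\<lambda>x. u x - g x) < L + e" if "0 < e" for n e
      proof -
        have "eventually (\<lambda>k. nsq (\<lambda>x. f (r k) x - g x) < e / N) sequentially"
          using order_tendstoD(2)[OF lim] that N by simp
        then have "eventually (\<lambda>k. n \<le> k \<and> nsq (\<lambda>x. f (r k) x - g x) < e / N) sequentially"
          using eventually_ge_at_top[of n] by eventually_elim simp
        then obtain k where k: "n \<le> k" "nsq (\<lambda>x. f (r k) x - g x) < e / N"
          by (auto simp: eventually_sequentially)
        have "n \<le> r k" using k(1) seq_suble[OF r, of k] by simp
        then have "f (r k) \<in> qe_class (C n) {0}"
          using f(1)[of "r k"] qe_class_antimono[of "C n" "C (r k)"] C(2) by (auto dest: incseqD)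
        moreover have "N * nsq (\<lambda>x. f (r k) x - g x) < e" using k(2) N by (simp add: field_simps)
        ultimately show ?thesis using f(3)[of "r k"] by force
      qed
    qed (use g N in auto)
    then obtain u where u: "u \<in> qe_class (\<Union>n. C n) {0}" "\<E> u + N * nsq (\<lambda>x. u x - g x) \<le> L" by blast
    from u(1) have "u \<in> qe_class A {0}" using C(4) by (auto simp: qe_class_def qc_version_def)
    with u(2) show ?thesis by blast
  qed
  have "1 \<le> L / c"
  proof (rule le_of_le_one_plus_mult)
    fix s :: real assume s: "0 < s"
    have le: "1 \<le> (1 + s) * (L / c) + (1 + 1/s) * (L / real (Suc n))" for n
    proof -
      obtain u where u: "u \<in> qe_class A {0}" "\<E> u + real (Suc n) * nsq (\<lambda>x. u x - g x) \<le> L"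
        using close[of "real (Suc n)"] by auto
      have uH: "u \<in> H1 M" using u(1) qe_class_H1 by auto
      have "0 \<le> \<E> u" "0 \<le> real (Suc n) * nsq (\<lambda>x. u x - g x)"
        using energy_nonneg[OF uH] nsq_nonneg by simp_all
      then have 1: "\<E> u \<le> L" and 2: "real (Suc n) * nsq (\<lambda>x. u x - g x) \<le> L"
        using u(2) by simp_all
      have "c * nsq u \<le> \<E> u"
        using Rayleigh_lower_bound[OF _ u(1), of c] c(2) by simp
      then have "nsq u \<le> L / c" using 1 c0 by (simp add: field_simps)
      moreover have "nsq (\<lambda>x. g x - u x) \<le> L / real (Suc n)"
        using 2 by (simp add: field_simps nsq_def power2_commute)
      moreover have "1 \<le> (1 + s) * nsq u + (1 + 1/s) * nsq (\<lambda>x. g x - u x)"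
        using nsq_add_le[OF H1_L2[OF uH] L2_diff[OF g H1_L2[OF uH]] s] by (simp add: g1)
      ultimately show ?thesis
        using s by (elim order_trans) (intro add_mono mult_left_mono, auto)
    qed
    have "(\<lambda>n. L / real (Suc n)) \<longlonglongrightarrow> 0"
      using LIMSEQ_Suc[OF lim_const_over_n[of L]] by simp
    then have "(\<lambda>n. (1 + s) * (L / c) + (1 + 1/s) * (L / real (Suc n))) \<longlonglongrightarrow> (1 + s) * (L / c) + (1 + 1/s) * 0"
      by (intro tendsto_intros)
    from LIMSEQ_le_const[OF this] le show "1 \<le> (1 + s) * (L / c)" by auto
  qed
  then show False using c0 by simp
qed

text \<open>Otherwise there would be normalized functions, vanishing almost everywhere on \<open>G\<close>, whose
  approximating forms stay below \<open>\<Lambda>\<close> at every scale. By \<open>L2_compactness\<close> they would have a limit of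
  norm \<open>1\<close> and energy at most \<open>\<Lambda>\<close> that vanishes almost everywhere on \<open>G\<close>, hence quasi-everywhere,
  because \<open>G\<close> is open.\<close>

lemma aform_lower_bound_open:
  assumes G: "relopen G" and \<Lambda>: "ereal \<Lambda> < eig G" and h: "0 < h"
  shows "\<exists>k. \<forall>f\<in>L2 M. (AE x in mu M. x \<in> G \<longrightarrow> f x = 0) \<longrightarrow> \<Lambda> * nsq f \<le> aform (h / 2 ^ k) f"
proof (rule ccontr)
  assume contra: "\<not> ?thesis"
  have "\<forall>k. \<exists>f. f \<in> L2 M \<and> (AE x in mu M. x \<in> G \<longrightarrow> f x = 0) \<and> nsq f = 1 \<and> aform (h / 2 ^ k) f \<le> \<Lambda>"
  proof
    fix k
    obtain f where f: "f \<in> L2 M" "AE x in mu M. x \<in> G \<longrightarrow> f x = 0" "aform (h / 2 ^ k) f < \<Lambda> * nsq f"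
      using contra not_le by blast
    have "nsq f \<noteq> 0"
      using f(3) aform_nonneg[of "h / 2 ^ k" f] h by auto
    then have pos: "0 < nsq f" using nsq_nonneg[of f] by simp
    define g where "g x = (1 / sqrt (nsq f)) * f x" for x
    have "g \<in> L2 M" unfolding g_def[abs_def] by (rule L2_cmult[OF f(1)])
    moreover have "AE x in mu M. x \<in> G \<longrightarrow> g x = 0"
      using f(2) by eventually_elim (simp add: g_def)
    moreover have "nsq g = 1" unfolding g_def[abs_def] nsq_cmult using pos by (simp add: power_divide)
    moreover have "aform (h / 2 ^ k) g \<le> \<Lambda>"
      unfolding g_def[abs_def] aform_cmult using f(3) pos by (simp add: power_divide field_simps)
    ultimately show "\<exists>f. f \<in> L2 M \<and> (AE x in mu M. x \<in> G \<longrightarrow> f x = 0) \<and> nsq f = 1 \<and> aform (h / 2 ^ k) f \<le> \<Lambda>"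
      by blast
  qed
  then obtain f where f: "\<And>k. f k \<in> L2 M" "\<And>k. AE x in mu M. x \<in> G \<longrightarrow> f k x = 0" "\<And>k. nsq (f k) = 1"
    "\<And>k. aform (h / 2 ^ k) (f k) \<le> \<Lambda>" by metis
  have bound: "aform (h / 2 ^ j) (f k) \<le> \<Lambda>" if "j \<le> k" for j k
    using aform_halving_mono[OF h f(1) that] f(4)[of k] by (rule order_trans)
  obtain r g where r: "strict_mono (r :: nat \<Rightarrow> nat)" and g: "g \<in> L2 M"
    and lim: "(\<lambda>n. nsq (\<lambda>x. f (r n) x - g x)) \<longlonglongrightarrow> 0"
    using L2_compactness[of f 1 h \<Lambda>] f(1,3) h bound by auto
  have g1: "nsq g = 1" by (rule nsq_limit_eq_1[OF f(1) g lim f(3)])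
  have "aform (h / 2 ^ j) g \<le> \<Lambda>" for j
  proof (rule aform_limit[OF _ f(1) g lim])
    show "eventually (\<lambda>n. aform (h / 2 ^ j) (f (r n)) \<le> \<Lambda>) sequentially"
    proof (rule eventually_sequentiallyI[of j])
      fix n assume "j \<le> n"
      then show "aform (h / 2 ^ j) (f (r n)) \<le> \<Lambda>" using seq_suble[OF r, of n] by (intro bound) simp
    qed
  qed (use h in simp)
  then have gH: "g \<in> H1 M" and gE: "\<E> g \<le> \<Lambda>" using H1I[OF h g] by auto
  have gG: "AE x in mu M. x \<in> G \<longrightarrow> g x \<in> {0}"
  proof -
    have [measurable]: "G \<in> sets (mu M)" by (rule openin_sets_mu[OF G])
    have [measurable]: "g \<in> borel_measurable (mu M)" by (rule L2_measurable[OF g])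
    have L: "(\<lambda>x. indicator G x * g x) \<in> L2 M"
      unfolding L2_iff by (rule square_integrable_bound[OF g[unfolded L2_iff]]) (auto split: split_indicator)
    have "nsq (\<lambda>x. indicator G x * g x) \<le> nsq (\<lambda>x. f (r n) x - g x)" for n
      unfolding nsq_def
    proof (rule integral_mono_AE)
      show "integrable (mu M) (\<lambda>x. (indicator G x * g x)\<^sup>2)" using L by (simp add: L2_def)
      show "integrable (mu M) (\<lambda>x. (f (r n) x - g x)\<^sup>2)" using L2_diff[OF f(1) g] by (simp add: L2_def)
      show "AE x in mu M. (indicator G x * g x)\<^sup>2 \<le> (f (r n) x - g x)\<^sup>2"
        using f(2)[of "r n"] by eventually_elim (auto split: split_indicator)
    qed
    then have "nsq (\<lambda>x. indicator G x * g x) \<le> 0"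
      using LIMSEQ_le_const[OF lim] by blast
    then have "nsq (\<lambda>x. indicator G x * g x) = 0" using nsq_nonneg by (intro antisym)
    then have "AE x in mu M. indicator G x * g x = 0" by (simp add: nsq_eq_0_iff[OF L])
    then show ?thesis by eventually_elim (auto split: split_indicator_asm)
  qed
  have "g \<in> qe_class G {0}" by (rule AE_imp_qe_class[OF gH G _ gG]) simp
  then have "eig G \<le> ereal (\<E> g / nsq g)"
    unfolding killed_eigenvalue_eq using g1 by (intro INF_lower) auto
  also have "\<dots> \<le> ereal \<Lambda>" using gE g1 by simp
  finally show False using \<Lambda> by simp
qed

section \<open>Survival along a time grid\<close>

definition killed_step :: "real \<Rightarrow> 'a set \<Rightarrow> ('a \<Rightarrow> ennreal) \<Rightarrow> 'a \<Rightarrow> ennreal" where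
  "killed_step h F f y = (\<integral>\<^sup>+z. indicator F z * f z \<partial>K h y)"

lemma measurable_killed_step:
  assumes "0 < h" "F \<in> sets (mu M)" "f \<in> borel_measurable (mu M)"
  shows "killed_step h F f \<in> borel_measurable (mu M)"
  unfolding killed_step_def[abs_def] using assms by (intro measurable_nn_integral_K) auto

definition grid_event :: "real \<Rightarrow> real \<Rightarrow> 'a set \<Rightarrow> nat \<Rightarrow> 'w set" where
  "grid_event s h F n = {\<omega>\<in>space \<Omega>. \<forall>i\<le>n. X (s + real i * h) \<omega> \<in> F}"

lemma grid_event_Suc:
  "grid_event s h F (Suc n) = grid_event s h F n \<inter> (X (s + real (Suc n) * h) -` F \<inter> space \<Omega>)"
  unfolding grid_event_def by (auto simp: le_Suc_eq simp del: of_nat_Suc)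

lemma vimage_natural_sets:
  "0 \<le> r \<Longrightarrow> r \<le> t \<Longrightarrow> F \<in> sets borel \<Longrightarrow> X r -` F \<inter> space \<Omega> \<in> natural_sets \<Omega> X t"
  unfolding natural_sets_def by (rule sigma_sets.Basic) blast

lemma grid_event_natural:
  assumes "0 \<le> s" "0 \<le> h" "F \<in> sets borel"
  shows "grid_event s h F n \<in> natural_sets \<Omega> X (s + real n * h)"
proof (induction n)
  case 0
  have "grid_event s h F 0 = X s -` F \<inter> space \<Omega>" by (auto simp: grid_event_def)
  then show ?case using assms vimage_natural_sets[of s s F] by simp
next
  case (Suc n)
  let ?t = "s + real (Suc n) * h"
  interpret N: sigma_algebra "space \<Omega>" "natural_sets \<Omega> X ?t"
    unfolding natural_sets_def by (rule sigma_algebra_sigma_sets) auto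
  have "s + real n * h \<le> ?t" using assms(2) by (intro add_left_mono mult_right_mono) auto
  then have "grid_event s h F n \<in> natural_sets \<Omega> X ?t"
    using Suc natural_sets_mono by blast
  moreover have "X ?t -` F \<inter> space \<Omega> \<in> natural_sets \<Omega> X ?t"
    using assms by (intro vimage_natural_sets add_nonneg_nonneg mult_nonneg_nonneg) auto
  ultimately show ?case unfolding grid_event_Suc by (rule N.Int)
qed

text \<open>The grid is processed from its last time backwards: the Markov property at the last time but
  one replaces \<open>f\<close> by \<open>killed_step h F f\<close>.\<close>

lemma grid_event_expectation:
  assumes x: "x \<in> M" and s: "0 < s" and h: "0 < h" and F: "F \<in> sets (mu M)"
    and f: "f \<in> borel_measurable (mu M)"
  shows "(\<integral>\<^sup>+\<omega>. indicator (grid_event s h F n) \<omega> * f (X (s + real n * h) \<omega>) \<partial>P x)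
       = (\<integral>\<^sup>+y. indicator F y * (killed_step h F ^^ n) f y \<partial>K s x)"
  using f
proof (induction n arbitrary: f)
  case 0
  have "(\<integral>\<^sup>+\<omega>. indicator (grid_event s h F 0) \<omega> * f (X (s + real 0 * h) \<omega>) \<partial>P x)
      = (\<integral>\<^sup>+\<omega>. indicator F (X s \<omega>) * f (X s \<omega>) \<partial>P x)"
    using x by (intro nn_integral_cong) (auto simp: grid_event_def split: split_indicator)
  also have "\<dots> = (\<integral>\<^sup>+y. indicator F y * f y \<partial>K s x)"
    using x s F 0 by (intro nn_integral_P_K) auto
  finally show ?case by simp
next
  case (Suc n)
  note f = \<open>f \<in> borel_measurable (mu M)\<close>
  let ?t = "s + real n * h"
  have t: "0 \<le> ?t" using s h by simp
  have th: "s + real (Suc n) * h = ?t + h" by (simp add: algebra_simps)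
  have "(\<integral>\<^sup>+\<omega>. indicator (grid_event s h F (Suc n)) \<omega> * f (X (s + real (Suc n) * h) \<omega>) \<partial>P x)
      = (\<integral>\<^sup>+\<omega>. indicator (grid_event s h F n) \<omega> * (indicator F (X (?t + h) \<omega>) * f (X (?t + h) \<omega>)) \<partial>P x)"
  proof (rule nn_integral_cong)
    fix \<omega> assume "\<omega> \<in> space (P x)"
    then have "\<omega> \<in> grid_event s h F (Suc n) \<longleftrightarrow> \<omega> \<in> grid_event s h F n \<and> X (?t + h) \<omega> \<in> F"
      unfolding grid_event_Suc th using x by auto
    then show "indicator (grid_event s h F (Suc n)) \<omega> * f (X (s + real (Suc n) * h) \<omega>)
        = indicator (grid_event s h F n) \<omega> * (indicator F (X (?t + h) \<omega>) * f (X (?t + h) \<omega>))"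
      unfolding th by (simp split: split_indicator)
  qed
  also have "\<dots> = (\<integral>\<^sup>+\<omega>. indicator (grid_event s h F n) \<omega> * (\<integral>\<^sup>+y. indicator F y * f y \<partial>K h (X ?t \<omega>)) \<partial>P x)"
  proof (rule Markov_property[OF x t h])
    show "grid_event s h F n \<in> natural_sets \<Omega> X ?t"
      using s h sets_muD[OF F] by (intro grid_event_natural) auto
  qed (use F f in measurable)
  also have "\<dots> = (\<integral>\<^sup>+\<omega>. indicator (grid_event s h F n) \<omega> * killed_step h F f (X ?t \<omega>) \<partial>P x)"
    by (simp add: killed_step_def)
  also have "\<dots> = (\<integral>\<^sup>+y. indicator F y * (killed_step h F ^^ n) (killed_step h F f) y \<partial>K s x)"
    by (rule Suc.IH) (rule measurable_killed_step[OF h F f])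
  finally show ?case by (simp only: funpow_Suc_right comp_def)
qed

text \<open>The iterates of \<open>killed_step\<close> as real functions, to which the \<open>L\<^sup>2\<close> theory applies.\<close>

primrec survival :: "real \<Rightarrow> 'a set \<Rightarrow> nat \<Rightarrow> 'a \<Rightarrow> real" where
  "survival h F 0 = indicator F"
| "survival h F (Suc n) = (\<lambda>y. indicator F y * \<T> h (survival h F n) y)"

lemma survival_properties:
  assumes h: "0 < h" and F: "F \<in> sets (mu M)"
  shows "survival h F n \<in> borel_measurable (mu M)"
    and "y \<in> M \<Longrightarrow> 0 \<le> survival h F n y" and "y \<in> M \<Longrightarrow> survival h F n y \<le> 1"
    and "y \<in> M \<Longrightarrow> indicator F y * (killed_step h F ^^ n) (\<lambda>_. 1) y = ennreal (survival h F n y)"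
proof -
  have "survival h F n \<in> borel_measurable (mu M) \<and> (\<forall>y\<in>M. 0 \<le> survival h F n y \<and> survival h F n y \<le> 1 \<and>
      indicator F y * (killed_step h F ^^ n) (\<lambda>_. 1) y = ennreal (survival h F n y))"
  proof (induction n)
    case 0
    show ?case using F by (auto split: split_indicator)
  next
    case (Suc n)
    let ?v = "survival h F n"
    have v[measurable]: "?v \<in> borel_measurable (mu M)" using Suc by blast
    have v01: "0 \<le> ?v y" "?v y \<le> 1" if "y \<in> M" for y using Suc that by auto
    have "survival h F (Suc n) \<in> borel_measurable (mu M)"
      using measurable_trans_op[OF h v] F by simp
    moreover have "0 \<le> survival h F (Suc n) y \<and> survival h F (Suc n) y \<le> 1 \<and>
        indicator F y * (killed_step h F ^^ Suc n) (\<lambda>_. 1) y = ennreal (survival h F (Suc n) y)"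
      if y: "y \<in> M" for y
    proof -
      interpret Ky: prob_space "K h y" by (rule prob_space_K[OF h y])
      have int: "integrable (K h y) ?v"
        by (rule Ky.integrable_const_bound[of _ 1]) (use v01 in \<open>auto intro!: AE_I2\<close>)
      have t: "\<T> h ?v y = (LINT z|K h y. ?v z)" by (rule trans_op_K[OF h y v])
      have "0 \<le> (LINT z|K h y. ?v z)"
        by (rule Bochner_Integration.integral_nonneg) (use v01 in auto)
      moreover have "(LINT z|K h y. ?v z) \<le> (LINT z|K h y. 1)"
        by (rule integral_mono) (use int v01 in auto)
      then have "(LINT z|K h y. ?v z) \<le> 1" by (simp add: Ky.prob_space[simplified])
      moreover have "(killed_step h F ^^ Suc n) (\<lambda>_. 1) y = ennreal (LINT z|K h y. ?v z)"
      proof -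
        have "(killed_step h F ^^ Suc n) (\<lambda>_. 1) y = (\<integral>\<^sup>+z. ennreal (?v z) \<partial>K h y)"
          unfolding funpow.simps comp_def killed_step_def[of h F "(killed_step h F ^^ n) (\<lambda>_. 1)" y]
          using Suc by (intro nn_integral_cong) simp
        also have "\<dots> = ennreal (LINT z|K h y. ?v z)"
          by (rule nn_integral_eq_integral[OF int]) (use v01 in \<open>auto intro!: AE_I2\<close>)
        finally show ?thesis .
      qed
      ultimately show ?thesis by (auto simp: t split: split_indicator)
    qed
    ultimately show ?case by blast
  qed
  then show "survival h F n \<in> borel_measurable (mu M)"
    and "y \<in> M \<Longrightarrow> 0 \<le> survival h F n y" and "y \<in> M \<Longrightarrow> survival h F n y \<le> 1"
    and "y \<in> M \<Longrightarrow> indicator F y * (killed_step h F ^^ n) (\<lambda>_. 1) y = ennreal (survival h F n y)"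
    by auto
qed

lemma survival_L2: "0 < h \<Longrightarrow> F \<in> sets (mu M) \<Longrightarrow> survival h F n \<in> L2 M"
  unfolding L2_def using survival_properties(1)[of h F n] survival_properties(2,3)[of h F _ n]
  by (auto intro!: mu.integrable_const_bound[of _ 1] AE_I2 simp: abs_square_le_1 abs_le_iff)

lemma survival_zero: "y \<notin> F \<Longrightarrow> survival h F n y = 0"
  by (cases n) auto

declare survival.simps [simp del]

text \<open>The operator \<open>1\<^sub>F P\<^sub>h 1\<^sub>F\<close> is symmetric and nonnegative, because \<open>P\<^sub>h\<close> is the square of the symmetric
  operator \<open>P\<^bsub>h/2\<^esub>\<close>, and its quadratic form is at most \<open>1 - h \<Lambda> \<le> e\<^bsup>-\<Lambda>h\<^esup>\<close>. By the Cauchy-Schwarz inequality for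
  this form, used here as an inequality between arithmetic and geometric means, the norm has the same
  bound.\<close>

lemma nsq_survival_le:
  assumes h: "0 < h" and F: "F \<in> sets (mu M)"
    and low: "\<And>f. f \<in> L2 M \<Longrightarrow> (\<And>x. x \<notin> F \<Longrightarrow> f x = 0) \<Longrightarrow> \<Lambda> * nsq f \<le> aform h f"
  shows "nsq (survival h F (Suc n)) \<le> (exp (- \<Lambda> * h))\<^sup>2 * nsq (survival h F n)"
proof -
  define q where "q = exp (- \<Lambda> * h)"
  have q: "0 < q" by (simp add: q_def)
  let ?u = "survival h F n" and ?w = "survival h F (Suc n)"
  let ?P = "\<T> (h / 2)"
  have h2: "0 < h / 2" using h by simp
  have form: "nsq (?P f) \<le> q * nsq f" if f: "f \<in> L2 M" "\<And>x. x \<notin> F \<Longrightarrow> f x = 0" for f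
  proof -
    have sq: "square_integrable (mu M) f" using f by (simp add: L2_iff)
    have "(LINT x|mu M. f x * \<T> h f x) = nsq (?P f)"
      using trans_op_split[OF h2 h2 sq sq] by (simp add: nsq_def power2_eq_square)
    then have "h * aform h f = nsq f - nsq (?P f)" using aform_eq[OF h f(1)] h by simp
    moreover have "h * (\<Lambda> * nsq f) \<le> h * aform h f"
      using low[OF f] h by (intro mult_left_mono) auto
    moreover have "(1 - \<Lambda> * h) * nsq f \<le> q * nsq f"
      using exp_ge_add_one_self[of "- \<Lambda> * h"] nsq_nonneg by (intro mult_right_mono) (auto simp: q_def)
    ultimately show ?thesis by (simp add: algebra_simps)
  qed
  have uL: "?u \<in> L2 M" and wL: "?w \<in> L2 M" by (rule survival_L2[OF h F])+
  then have squ: "square_integrable (mu M) ?u" and sqw: "square_integrable (mu M) ?w"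
    unfolding L2_iff .
  have Pu: "square_integrable (mu M) (?P ?u)" and Pw: "square_integrable (mu M) (?P ?w)"
    by (rule trans_op_square_integrable(1)[OF h2 squ], rule trans_op_square_integrable(1)[OF h2 sqw])
  have "nsq ?w = (LINT x|mu M. ?w x * \<T> h ?u x)"
    unfolding nsq_def by (rule Bochner_Integration.integral_cong) (auto simp: survival.simps(2) power2_eq_square split: split_indicator)
  also have "\<dots> = (LINT x|mu M. ?P ?w x * ?P ?u x)"
    using trans_op_split[OF h2 h2 sqw squ] by simp
  also have "\<dots> \<le> (LINT x|mu M. (?P ?w x)\<^sup>2 / (2 * q) + q / 2 * (?P ?u x)\<^sup>2)"
  proof (rule integral_mono)
    show "integrable (mu M) (\<lambda>x. ?P ?w x * ?P ?u x)"
      by (rule square_integrable_integrable_mult[OF Pw Pu])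
    show "integrable (mu M) (\<lambda>x. (?P ?w x)\<^sup>2 / (2 * q) + q / 2 * (?P ?u x)\<^sup>2)"
      using Pu Pw by (auto simp: square_integrable_def)
    fix x
    have "0 \<le> (?P ?w x - q * ?P ?u x)\<^sup>2 / (2 * q)" using q by simp
    also have "\<dots> = (?P ?w x)\<^sup>2 / (2 * q) + q / 2 * (?P ?u x)\<^sup>2 - ?P ?w x * ?P ?u x"
      using q by (simp add: power2_diff power_mult_distrib field_simps power2_eq_square)
    finally show "?P ?w x * ?P ?u x \<le> (?P ?w x)\<^sup>2 / (2 * q) + q / 2 * (?P ?u x)\<^sup>2" by simp
  qed
  also have "\<dots> = nsq (?P ?w) / (2 * q) + q / 2 * nsq (?P ?u)"
    using Pu Pw by (simp add: nsq_def square_integrable_def)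
  also have "\<dots> \<le> q * nsq ?w / (2 * q) + q / 2 * (q * nsq ?u)"
    using form[OF wL survival_zero] form[OF uL survival_zero] q
    by (intro add_mono divide_right_mono mult_left_mono) auto
  also have "\<dots> = nsq ?w / 2 + q\<^sup>2 * nsq ?u / 2"
    using q by (simp add: power2_eq_square)
  finally show ?thesis by (simp add: q_def)
qed

lemma integral_survival_le:
  assumes h: "0 < h" and F: "F \<in> sets (mu M)"
    and low: "\<And>f. f \<in> L2 M \<Longrightarrow> (\<And>x. x \<notin> F \<Longrightarrow> f x = 0) \<Longrightarrow> \<Lambda> * nsq f \<le> aform h f"
  shows "(LINT x|mu M. survival h F n x) \<le> exp (- \<Lambda> * h) ^ n"
proof -
  have "nsq (survival h F n) \<le> (exp (- \<Lambda> * h) ^ n)\<^sup>2"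
  proof (induction n)
    case 0
    have "nsq (survival h F 0) \<le> (LINT x|mu M. 1)"
      unfolding nsq_def using survival_L2[OF h F, of 0]
      by (intro integral_mono) (auto simp: L2_def survival.simps(1) split: split_indicator)
    then show ?case by (simp add: mu.prob_space[simplified])
  next
    case (Suc n)
    have "nsq (survival h F (Suc n)) \<le> (exp (- \<Lambda> * h))\<^sup>2 * nsq (survival h F n)"
      by (rule nsq_survival_le[OF h F low])
    also have "\<dots> \<le> (exp (- \<Lambda> * h))\<^sup>2 * (exp (- \<Lambda> * h) ^ n)\<^sup>2"
      using Suc by (intro mult_left_mono) auto
    finally show ?case by (simp add: power_mult_distrib)
  qed
  moreover have "(LINT x|mu M. survival h F n x)\<^sup>2 \<le> nsq (survival h F n)"
    unfolding nsq_def using survival_L2[OF h F] by (intro mu.square_integral_le) (simp add: L2_iff)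
  ultimately have "(LINT x|mu M. survival h F n x)\<^sup>2 \<le> (exp (- \<Lambda> * h) ^ n)\<^sup>2" by simp
  then show ?thesis by (rule power2_le_imp_le) simp
qed

lemma emeasure_grid_event_le:
  assumes x: "x \<in> M" and s: "0 < s" and p: "\<And>y. y \<in> M \<Longrightarrow> p s x y \<le> a" and a: "0 \<le> a"
    and h: "0 < h" and F: "F \<in> sets (mu M)"
    and low: "\<And>f. f \<in> L2 M \<Longrightarrow> (\<And>x. x \<notin> F \<Longrightarrow> f x = 0) \<Longrightarrow> \<Lambda> * nsq f \<le> aform h f"
  shows "grid_event s h F n \<in> sets \<Omega>"
    and "emeasure (P x) (grid_event s h F n) \<le> ennreal (a * exp (- \<Lambda> * h) ^ n)"
proof -
  show D: "grid_event s h F n \<in> sets \<Omega>"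
    using grid_event_natural[of s h F n] s h sets_muD[OF F] natural_sets_subset by auto
  have [measurable]: "survival h F n \<in> borel_measurable (mu M)" by (rule survival_properties(1)[OF h F])
  have "emeasure (P x) (grid_event s h F n) = (\<integral>\<^sup>+\<omega>. indicator (grid_event s h F n) \<omega> * 1 \<partial>P x)"
    using D x by simp
  also have "\<dots> = (\<integral>\<^sup>+y. indicator F y * (killed_step h F ^^ n) (\<lambda>_. 1) y \<partial>K s x)"
    using grid_event_expectation[OF x s h F, of "\<lambda>_. 1" n] by simp
  also have "\<dots> = (\<integral>\<^sup>+y. ennreal (survival h F n y) \<partial>K s x)"
    by (rule nn_integral_cong) (simp add: survival_properties(4)[OF h F])
  also have "\<dots> = (\<integral>\<^sup>+y. ennreal (p s x y) * ennreal (survival h F n y) \<partial>mu M)"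
    by (rule nn_integral_K[OF s x]) measurable
  also have "\<dots> \<le> (\<integral>\<^sup>+y. ennreal a * ennreal (survival h F n y) \<partial>mu M)"
    by (rule nn_integral_mono) (auto intro!: mult_right_mono ennreal_leI p)
  also have "\<dots> = ennreal a * (\<integral>\<^sup>+y. ennreal (survival h F n y) \<partial>mu M)"
    by (rule nn_integral_cmult) measurable
  also have "(\<integral>\<^sup>+y. ennreal (survival h F n y) \<partial>mu M) = ennreal (LINT y|mu M. survival h F n y)"
    using mu.square_integrable_integrable[OF survival_L2[OF h F, of n, unfolded L2_iff]]
      survival_properties(2)[OF h F] by (intro nn_integral_eq_integral) (auto intro!: AE_I2)
  also have "ennreal a * \<dots> \<le> ennreal a * ennreal (exp (- \<Lambda> * h) ^ n)"
    by (intro mult_left_mono ennreal_leI integral_survival_le[OF h F low]) auto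
  also have "\<dots> = ennreal (a * exp (- \<Lambda> * h) ^ n)"
    using a by (simp add: ennreal_mult)
  finally show "emeasure (P x) (grid_event s h F n) \<le> ennreal (a * exp (- \<Lambda> * h) ^ n)" .
qed

section \<open>Survival in continuous time\<close>

definition avoid_event :: "real \<Rightarrow> 'a set \<Rightarrow> 'w set" where
  "avoid_event T A = {\<omega>\<in>space \<Omega>. \<forall>t. 0 \<le> t \<longrightarrow> t \<le> T \<longrightarrow> X t \<omega> \<notin> A}"

lemma avoid_open:
  assumes G: "relopen G" and \<Lambda>: "ereal \<Lambda> < eig G"
    and x: "x \<in> M" and s: "0 < s" and p: "\<And>y. y \<in> M \<Longrightarrow> p s x y \<le> a" and a: "1 \<le> a" and u: "0 \<le> u"
  shows "outer_measure_of (P x) (avoid_event (s + u) G) \<le> ennreal (a * exp (- \<Lambda> * u))"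
proof (cases "u = 0")
  case True
  \<comment> \<open>there is no grid of positive mesh, but the bound is at least \<open>1\<close>\<close>
  interpret Px: prob_space "P x" by (rule prob_space_P[OF x])
  have "outer_measure_of (P x) (avoid_event (s + u) G) \<le> outer_measure_of (P x) (space (P x))"
    using x by (intro outer_measure_of_mono) (auto simp: avoid_event_def)
  also have "\<dots> = 1" by (simp add: Px.emeasure_space_1)
  also have "\<dots> \<le> ennreal (a * exp (- \<Lambda> * u))" using a True by (simp add: ennreal_leI flip: ennreal_1)
  finally show ?thesis .
next
  case False
  then have u: "0 < u" using u by simp
  obtain k where k: "\<And>f. f \<in> L2 M \<Longrightarrow> (AE x in mu M. x \<in> G \<longrightarrow> f x = 0) \<Longrightarrow> \<Lambda> * nsq f \<le> aform (u / 2 ^ k) f"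
    using aform_lower_bound_open[OF G \<Lambda> u] by blast
  define h where "h = u / 2 ^ k"
  have h: "0 < h" using u by (simp add: h_def)
  have F: "M - G \<in> sets (mu M)"
    using sets.compl_sets[OF openin_sets_mu[OF G]] by simp
  have low: "\<Lambda> * nsq f \<le> aform h f" if "f \<in> L2 M" "\<And>x. x \<notin> M - G \<Longrightarrow> f x = 0" for f
    unfolding h_def by (rule k) (use that in auto)
  have a0: "0 \<le> a" using a by simp
  note grid = emeasure_grid_event_le[OF x s p a0 h F low, where n="2 ^ k"]
  have hk: "real i * h \<le> u" if "i \<le> 2 ^ k" for i
  proof -
    have "real i * h \<le> 2 ^ k * h"
      using that h by (intro mult_right_mono) (auto simp flip: of_nat_le_iff)
    then show ?thesis by (simp add: h_def)
  qed
  have "avoid_event (s + u) G \<subseteq> grid_event s h (M - G) (2 ^ k)"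
  proof
    fix \<omega> assume \<omega>: "\<omega> \<in> avoid_event (s + u) G"
    have "X (s + real i * h) \<omega> \<in> M - G" if "i \<le> 2 ^ k" for i
    proof -
      have "0 \<le> s + real i * h" "s + real i * h \<le> s + u" using s h hk[OF that] by auto
      then show ?thesis using \<omega> X_in_M by (auto simp: avoid_event_def)
    qed
    then show "\<omega> \<in> grid_event s h (M - G) (2 ^ k)" using \<omega> by (auto simp: avoid_event_def grid_event_def)
  qed
  then have "outer_measure_of (P x) (avoid_event (s + u) G) \<le> outer_measure_of (P x) (grid_event s h (M - G) (2 ^ k))"
    by (rule outer_measure_of_mono)
  also have "\<dots> = emeasure (P x) (grid_event s h (M - G) (2 ^ k))"
    by (rule outer_measure_of_eq, unfold sets_P[OF x], rule grid(1))
  also have "\<dots> \<le> ennreal (a * exp (- \<Lambda> * h) ^ (2 ^ k))"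
    by (rule grid(2))
  also have "exp (- \<Lambda> * h) ^ (2 ^ k) = exp (real (2 ^ k) * (- \<Lambda> * h))"
    by (rule exp_of_nat_mult[symmetric])
  also have "real (2 ^ k) * (- \<Lambda> * h) = - \<Lambda> * u"
    by (simp add: h_def)
  finally show ?thesis .
qed

text \<open>A continuous path that avoids a compact set on \<open>[0, T]\<close> avoids one of its neighbourhoods, so
  the event is covered by the increasing union of the events for shrinking neighbourhoods. Outer
  measures are continuous along increasing sequences of arbitrary sets, and \<open>eig\<close> is monotone.\<close>

lemma avoid_compact:
  assumes C: "compact C" "C \<subseteq> M" and \<Lambda>: "ereal \<Lambda> < eig C"
    and x: "x \<in> M" and s: "0 < s" and p: "\<And>y. y \<in> M \<Longrightarrow> p s x y \<le> a" and a: "1 \<le> a" and u: "0 \<le> u"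
  shows "outer_measure_of (P x) (avoid_event (s + u) C) \<le> ennreal (a * exp (- \<Lambda> * u))"
proof -
  define G where "G k = M \<inter> (\<Union>y\<in>C. ball y (1 / real (Suc k)))" for k
  have Gopen: "relopen (G k)" for k
    unfolding G_def by (intro openin_open_Int open_UN ballI open_ball)
  have CG: "C \<subseteq> G k" for k
    using C(2) by (auto simp: G_def intro!: bexI)
  have Gdec: "G n \<subseteq> G k" if "k \<le> n" for k n
  proof -
    have "1 / real (Suc n) \<le> 1 / real (Suc k)" using that by (simp add: field_simps)
    then show ?thesis unfolding G_def by (auto intro!: bexI intro: order_less_le_trans)
  qed
  have inc: "incseq (\<lambda>k. avoid_event (s + u) (G k))"
    unfolding incseq_def avoid_event_def using Gdec by blast
  have sub: "avoid_event (s + u) C \<subseteq> (\<Union>k. avoid_event (s + u) (G k))"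
  proof
    fix \<omega> assume \<omega>: "\<omega> \<in> avoid_event (s + u) C"
    let ?S = "(\<lambda>t. X t \<omega>) ` {0..s + u}"
    have "compact ?S"
      using paths[of \<omega>] \<omega> by (intro compact_continuous_image)
        (auto simp: avoid_event_def elim: continuous_on_subset)
    moreover have "?S \<inter> C = {}" using \<omega> by (auto simp: avoid_event_def)
    ultimately obtain d where d: "0 < d" "\<And>z y. z \<in> ?S \<Longrightarrow> y \<in> C \<Longrightarrow> d \<le> dist z y"
      using separate_compact_closed[of ?S C] compact_imp_closed[OF C(1)] by blast
    obtain k where k: "1 / real (Suc k) < d" using d(1) by (rule nat_approx_posE)
    have "X t \<omega> \<notin> G k" if "0 \<le> t" "t \<le> s + u" for t
    proof
      assume "X t \<omega> \<in> G k"
      then obtain y where "y \<in> C" "dist y (X t \<omega>) < 1 / real (Suc k)" by (auto simp: G_def)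
      moreover have "d \<le> dist (X t \<omega>) y" by (rule d(2)) (use that \<open>y \<in> C\<close> in auto)
      ultimately show False using k by (simp add: dist_commute)
    qed
    then show "\<omega> \<in> (\<Union>k. avoid_event (s + u) (G k))" using \<omega> by (auto simp: avoid_event_def)
  qed
  have "outer_measure_of (P x) (avoid_event (s + u) C) \<le> outer_measure_of (P x) (\<Union>k. avoid_event (s + u) (G k))"
    by (rule outer_measure_of_mono[OF sub])
  also have "\<dots> = (SUP k. outer_measure_of (P x) (avoid_event (s + u) (G k)))"
    by (rule SUP_outer_measure_of_incseq[symmetric, OF _ inc]) (use x in \<open>auto simp: avoid_event_def\<close>)
  also have "\<dots> \<le> ennreal (a * exp (- \<Lambda> * u))"
  proof (rule SUP_least)
    fix k
    have "ereal \<Lambda> < eig (G k)"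
      using \<Lambda> killed_eigenvalue_mono[OF CG] by (rule less_le_trans)
    then show "outer_measure_of (P x) (avoid_event (s + u) (G k)) \<le> ennreal (a * exp (- \<Lambda> * u))"
      by (intro avoid_open Gopen x s p a u)
  qed
  finally show ?thesis .
qed

lemma not_hit_subset_avoid:
  assumes "C \<subseteq> A"
  shows "{\<omega>\<in>space \<Omega>. \<not> hitting_time X A \<omega> \<le> ereal T} \<subseteq> avoid_event T C"
proof
  fix \<omega> assume \<omega>: "\<omega> \<in> {\<omega>\<in>space \<Omega>. \<not> hitting_time X A \<omega> \<le> ereal T}"
  have "X t \<omega> \<notin> C" if t: "0 \<le> t" "t \<le> T" for t
  proof
    assume "X t \<omega> \<in> C"
    then have "hitting_time X A \<omega> \<le> ereal t"
      unfolding hitting_time_def using assms t by (intro INF_lower) auto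
    also have "\<dots> \<le> ereal T" using t by simp
    finally show False using \<omega> by simp
  qed
  then show "\<omega> \<in> avoid_event T C" using \<omega> by (auto simp: avoid_event_def)
qed

lemma not_hit_le_exp:
  assumes A: "A \<in> sets (mu M)" and \<Lambda>: "ereal \<Lambda> < eig A"
    and x: "x \<in> M" and s: "0 < s" and p: "\<And>y. y \<in> M \<Longrightarrow> p s x y \<le> a" and a: "1 \<le> a" and u: "0 \<le> u"
  shows "outer_measure_of (P x) {\<omega>\<in>space \<Omega>. \<not> hitting_time X A \<omega> \<le> ereal (s + u)}
    \<le> ennreal (a * exp (- \<Lambda> * u))"
proof -
  obtain C where C: "compact C" "C \<subseteq> A" "ereal \<Lambda> < eig C"
    using killed_eigenvalue_compact_approximation[OF _ _ \<Lambda>] sets_muD[OF A] by blast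
  have "outer_measure_of (P x) {\<omega>\<in>space \<Omega>. \<not> hitting_time X A \<omega> \<le> ereal (s + u)}
      \<le> outer_measure_of (P x) (avoid_event (s + u) C)"
    by (intro outer_measure_of_mono not_hit_subset_avoid C)
  also have "\<dots> \<le> ennreal (a * exp (- \<Lambda> * u))"
    using C sets_muD[OF A] by (intro avoid_compact x s p a u) auto
  finally show ?thesis .
qed

lemma not_hit_le:
  assumes A: "A \<in> sets (mu M)"
    and x: "x \<in> M" and s: "0 < s" and p: "\<And>y. y \<in> M \<Longrightarrow> p s x y \<le> a" and a: "1 \<le> a" and u: "0 \<le> u"
  shows "outer_measure_of (P x) {\<omega>\<in>space \<Omega>. \<not> hitting_time X A \<omega> \<le> ereal (s + u)}
    \<le> ennreal (a * exp_neg (eig A * ereal u))" (is "?m \<le> _")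
proof -
  have bound: "?m \<le> ennreal (a * exp (- \<Lambda> * u))" if "ereal \<Lambda> < eig A" for \<Lambda>
    by (rule not_hit_le_exp[OF A that x s p a u])
  consider l where "eig A = ereal l" | "eig A = \<infinity>"
    using killed_eigenvalue_nonneg[of A] by (cases "eig A") auto
  then show ?thesis
  proof cases
    case 1
    have "((\<lambda>e. ennreal (a * exp (- (l - e) * u))) \<longlongrightarrow> ennreal (a * exp (- (l - 0) * u))) (at_right 0)"
      by (intro tendsto_ennrealI tendsto_intros)
    moreover have "eventually (\<lambda>e. ?m \<le> ennreal (a * exp (- (l - e) * u))) (at_right 0)"
      using eventually_at_right_less[of "0::real"] by eventually_elim (rule bound, simp add: 1)
    ultimately have "?m \<le> ennreal (a * exp (- (l - 0) * u))"
      by (rule tendsto_lowerbound) simp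
    then show ?thesis by (simp add: 1 exp_neg_def)
  next
    case 2
    show ?thesis
    proof (cases "u = 0")
      case True
      \<comment> \<open>here \<open>\<infinity> * 0 = 0\<close>, and the right-hand side is \<open>a\<close>\<close>
      then show ?thesis using bound[of 0] by (simp add: 2 exp_neg_def zero_ereal_def[symmetric])
    next
      case False
      then have u: "0 < u" using u by simp
      have "(\<lambda>n. ennreal (a * exp (- real n * u))) \<longlonglongrightarrow> ennreal (a * 0)"
      proof (intro tendsto_ennrealI tendsto_mult tendsto_const)
        have "(\<lambda>n. exp (- u) ^ n) \<longlonglongrightarrow> 0" using u by (intro LIMSEQ_power_zero) simp
        then show "(\<lambda>n. exp (- real n * u)) \<longlonglongrightarrow> 0" by (simp add: exp_of_nat_mult[symmetric])
      qed
      then have "?m \<le> ennreal (a * 0)"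
        by (rule LIMSEQ_le_const) (use bound in \<open>auto simp: 2\<close>)
      then show ?thesis using u by (simp add: 2 exp_neg_def)
    qed
  qed
qed

end

lemma outer_measure_of_Un:
  assumes "A \<subseteq> space N" "B \<subseteq> space N"
  shows "outer_measure_of N (A \<union> B) \<le> outer_measure_of N A + outer_measure_of N B"
proof -
  obtain E where E: "E \<in> sets N" "A \<subseteq> E" "outer_measure_of N A = emeasure N E"
    using outer_measure_of_attain[OF assms(1)] by blast
  obtain F where F: "F \<in> sets N" "B \<subseteq> F" "outer_measure_of N B = emeasure N F"
    using outer_measure_of_attain[OF assms(2)] by blast
  have "outer_measure_of N (A \<union> B) \<le> outer_measure_of N (E \<union> F)"
    by (rule outer_measure_of_mono) (use E F in auto)
  also have "\<dots> \<le> emeasure N E + emeasure N F"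
    using E(1) F(1) by (simp add: emeasure_subadditive)
  finally show ?thesis using E(3) F(3) by simp
qed

lemma outer_measure_of_UN_finite:
  assumes "finite I" "\<And>i. i \<in> I \<Longrightarrow> A i \<subseteq> space N" "\<And>i. i \<in> I \<Longrightarrow> outer_measure_of N (A i) \<le> ennreal (c i)"
    "\<And>i. i \<in> I \<Longrightarrow> 0 \<le> c i"
  shows "outer_measure_of N (\<Union>i\<in>I. A i) \<le> ennreal (\<Sum>i\<in>I. c i)"
  using assms
proof (induction I rule: finite_induct)
  case empty
  then show ?case by simp
next
  case (insert i I)
  have "outer_measure_of N (A i \<union> (\<Union>i\<in>I. A i)) \<le> outer_measure_of N (A i) + outer_measure_of N (\<Union>i\<in>I. A i)"
    using insert by (intro outer_measure_of_Un) auto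
  also have "\<dots> \<le> ennreal (c i) + ennreal (\<Sum>i\<in>I. c i)"
    using insert by (intro add_mono) auto
  also have "\<dots> = ennreal (c i + (\<Sum>i\<in>I. c i))"
    using insert by (intro ennreal_plus[symmetric] sum_nonneg) auto
  finally show ?case using insert by simp
qed

theorem theorem4p4:
  fixes M :: "'a::euclidean_space set"
    and \<Omega> :: "'w measure" and P :: "'a \<Rightarrow> 'w measure" and X :: "real \<Rightarrow> 'w \<Rightarrow> 'a"
    and p :: "real \<Rightarrow> 'a \<Rightarrow> 'a \<Rightarrow> real"
    and s\<^sub>0 a T :: real and \<A> :: "'a set set" and x :: 'a
  assumes "reflected_brownian_motion M \<Omega> P X"
    and "neumann_heat_kernel M \<Omega> P X p"
    and "s\<^sub>0 > 0" and "a \<ge> 1"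
    and "\<And>t x y. t \<ge> s\<^sub>0 \<Longrightarrow> x \<in> M \<Longrightarrow> y \<in> M \<Longrightarrow> p t x y \<le> a"
    and "finite \<A>"
    and "\<And>A. A \<in> \<A> \<Longrightarrow> A \<in> sets (mu M)"
    and "\<And>A. A \<in> \<A> \<Longrightarrow> capacity M A > 0"
    and "x \<in> M" and "T \<ge> s\<^sub>0"
  shows "outer_measure_of (P x) (space \<Omega> - all_hit \<Omega> X \<A> T)
           \<le> ennreal (a * spectral_profile M \<A> (T - s\<^sub>0))"
proof -
  interpret rbm_kernel M \<Omega> P X p
    using assms(1,2) by (simp add: rbm_kernel_def rbm_kernel_axioms_def)
  define c where "c A = a * exp_neg (killed_eigenvalue M A * ereal (T - s\<^sub>0))" for A
  have "space \<Omega> - all_hit \<Omega> X \<A> T = (\<Union>A\<in>\<A>. {\<omega>\<in>space \<Omega>. \<not> hitting_time X A \<omega> \<le> ereal T})"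
    by (auto simp: all_hit_def)
  also have "outer_measure_of (P x) \<dots> \<le> ennreal (\<Sum>A\<in>\<A>. c A)"
  proof (rule outer_measure_of_UN_finite[OF \<open>finite \<A>\<close>])
    fix A assume "A \<in> \<A>"
    show "outer_measure_of (P x) {\<omega>\<in>space \<Omega>. \<not> hitting_time X A \<omega> \<le> ereal T} \<le> ennreal (c A)"
      using not_hit_le[OF assms(7)[OF \<open>A \<in> \<A>\<close>] \<open>x \<in> M\<close> \<open>s\<^sub>0 > 0\<close> assms(5)[OF order_refl \<open>x \<in> M\<close>] \<open>a \<ge> 1\<close>, of "T - s\<^sub>0"]
        \<open>T \<ge> s\<^sub>0\<close> by (simp add: c_def)
    show "0 \<le> c A" using \<open>a \<ge> 1\<close> by (simp add: c_def exp_neg_def)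
  qed (use \<open>x \<in> M\<close> in auto)
  also have "(\<Sum>A\<in>\<A>. c A) = a * spectral_profile M \<A> (T - s\<^sub>0)"
    by (simp add: c_def spectral_profile_def sum_distrib_left)
  finally show ?thesis .
qed

end
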